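(* For a von Neumann algebra $\mathcal{M}$, we have $$\aleph_0 \cdot \chi_r'(\mathcal{M}) = \aleph_0 \cdot \operatorname{gen}'(\mathcal{M}).$$ Thus the invariants $\operatorname{gen}'(\mathcal{M})$ and $\chi_r'(\mathcal{M})$ only differ when $\operatorname{gen}'(\mathcal{M})$ is finite and $\mathcal{M}$ is not atomic abelian.
   Context: Von Neumann algebras are nonzero. A subset $S$ of a von Neumann algebra $\mathcal{M}$ generates $\mathcal{M}$ if $\mathcal{M}$ is the smallest von Neumann algebra (with the same unit) containing $S$. $\operatorname{gen}(\mathcal{M})$ is the minimal cardinality of a generating set, with the convention $\operatorname{gen}(\mathbb{C}) = 1$ (instead of $0$). $\chi_r(\mathcal{M})$ is the minimal dimension of a Hilbert space on which $\mathcal{M}$ acts faithfully and normally. For a cardinal invariant $F$ of von Neumann algebras, its localization is $$F'(\mathcal{M}) = \min\{\kappa \mid \mathcal{M} \text{ can be written as a direct sum of algebras } \{\mathcal{M}_\alpha\} \text{ with } F(\mathcal{M}_\alpha) \leq \kappa \text{ for all } \alpha\},$$ where direct sums are $\ell^\infty$-direct sums (norm-bounded families). Thus $\operatorname{gen}'$ and $\chi_r'$ are the localizations of $\operatorname{gen}$ and $\chi_r$. Atomic abelian means isomorphic to $\ell^\infty_I$ for some set $I$. *)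

theory Defs
  imports "HOL-Analysis.Analysis" "HOL-Algebra.Module" "HOL-Algebra.QuotRing"
begin

unbundle cardinal_syntax

section \<open>Hilbert spaces and their operators\<close>

text \<open>
  The inner product is antilinear in the first argument. The real inner product inherited from
  the class \<open>real_inner\<close>, which also determines the norm, is its real part.
\<close>

class complex_hilbert = banach + real_inner +
  fixes scaleC :: "complex \<Rightarrow> 'a \<Rightarrow> 'a" (infixr \<open>*\<^sub>C\<close> 75)
    and cinner :: "'a \<Rightarrow> 'a \<Rightarrow> complex"
  assumes scaleC_add_right: "c *\<^sub>C (x + y) = c *\<^sub>C x + c *\<^sub>C y"
    and scaleC_add_left: "(c + d) *\<^sub>C x = c *\<^sub>C x + d *\<^sub>C x"
    and scaleC_scaleC: "c *\<^sub>C d *\<^sub>C x = (c * d) *\<^sub>C x"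
    and scaleC_of_real: "complex_of_real r *\<^sub>C x = r *\<^sub>R x"
    and cinner_commute: "cinner x y = cnj (cinner y x)"
    and cinner_add_right: "cinner x (y + z) = cinner x y + cinner x z"
    and cinner_scaleC_right: "cinner x (c *\<^sub>C y) = c * cinner x y"
    and inner_eq_Re_cinner: "inner x y = Re (cinner x y)"

text \<open>
  All Hilbert spaces are taken to be closed complex subspaces of an ambient Hilbert space \<open>'h\<close>,
  the whole space \<open>UNIV\<close> being one of them.
\<close>

definition closed_csubspace :: "'h::complex_hilbert set \<Rightarrow> bool" where
  "closed_csubspace H \<longleftrightarrow>
     0 \<in> H \<and> (\<forall>x\<in>H. \<forall>y\<in>H. x + y \<in> H) \<and> (\<forall>c. \<forall>x\<in>H. c *\<^sub>C x \<in> H) \<and> closed H"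

definition hilbert_basis :: "'h::complex_hilbert set \<Rightarrow> 'h set \<Rightarrow> bool" where
  "hilbert_basis H B \<longleftrightarrow>
     B \<subseteq> H \<and> (\<forall>b\<in>B. \<forall>b'\<in>B. cinner b b' = (if b = b' then 1 else 0)) \<and>
     (\<forall>x\<in>H. (\<forall>b\<in>B. cinner b x = 0) \<longrightarrow> x = 0)"

text \<open>
  The bounded operators on \<open>H\<close>. Such an operator is represented by its extension to \<open>'h\<close> that
  vanishes on the orthogonal complement of \<open>H\<close>; composition, adjoints and the operator norm
  (\<open>onorm\<close>) on \<open>H\<close> are then those of the ambient space, and the identity of \<open>H\<close> is represented
  by the orthogonal projection onto \<open>H\<close>.
\<close>

definition bounded_ops :: "'h::complex_hilbert set \<Rightarrow> ('h \<Rightarrow> 'h) set" where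
  "bounded_ops H =
     {T. bounded_linear T \<and> (\<forall>c x. T (c *\<^sub>C x) = c *\<^sub>C T x) \<and> range T \<subseteq> H \<and>
         (\<forall>x. (\<forall>y\<in>H. cinner y x = 0) \<longrightarrow> T x = 0)}"

definition id_op :: "'h::complex_hilbert set \<Rightarrow> 'h \<Rightarrow> 'h" where
  "id_op H = (THE P. P \<in> bounded_ops H \<and> (\<forall>x\<in>H. P x = x))"

definition cadjoint :: "('h::complex_hilbert \<Rightarrow> 'h) \<Rightarrow> 'h \<Rightarrow> 'h" where
  "cadjoint T = (THE S. \<forall>x y. cinner (S x) y = cinner x (T y))"

text \<open>
  The topology on \<open>bounded_ops H\<close> induced by the functionals
  \<open>T \<mapsto> \<Sum>n. \<langle>\<xi> n, T (\<eta> n)\<rangle>\<close> with \<open>\<xi>\<close> and \<open>\<eta>\<close> square-summable.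
\<close>

definition ultraweak_topology :: "'h::complex_hilbert set \<Rightarrow> ('h \<Rightarrow> 'h) topology" where
  "ultraweak_topology H = topology_generated_by
     {{T \<in> bounded_ops H. (\<Sum>n. cinner (\<xi> n) (T (\<eta> n))) \<in> U} | \<xi> \<eta> U.
        range \<xi> \<subseteq> H \<and> range \<eta> \<subseteq> H \<and>
        summable (\<lambda>n::nat. (norm (\<xi> n))\<^sup>2) \<and> summable (\<lambda>n::nat. (norm (\<eta> n))\<^sup>2) \<and> open U}"

section \<open>Star-algebras\<close>

record 'a star_algebra = "(complex, 'a) module" +
  star :: "'a \<Rightarrow> 'a"

definition star_hom :: "'a star_algebra \<Rightarrow> 'b star_algebra \<Rightarrow> ('a \<Rightarrow> 'b) set" where
  "star_hom A B =
     {f \<in> ring_hom A B. \<forall>x\<in>carrier A.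
        (\<forall>c. f (c \<odot>\<^bsub>A\<^esub> x) = c \<odot>\<^bsub>B\<^esub> f x) \<and> f (star A x) = star B (f x)}"

definition star_isomorphic :: "'a star_algebra \<Rightarrow> 'b star_algebra \<Rightarrow> bool" where
  "star_isomorphic A B \<longleftrightarrow> (\<exists>f \<in> star_hom A B. bij_betw f (carrier A) (carrier B))"

definition op_algebra ::
  "'h::complex_hilbert set \<Rightarrow> ('h \<Rightarrow> 'h) set \<Rightarrow> ('h \<Rightarrow> 'h) star_algebra" where
  "op_algebra H M =
     \<lparr>carrier = M, mult = (\<circ>), one = id_op H, zero = (\<lambda>_. 0), add = (\<lambda>S T x. S x + T x),
      smult = (\<lambda>c T x. c *\<^sub>C T x), star = cadjoint\<rparr>"

definition complex_algebra :: "complex star_algebra" where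
  "complex_algebra =
     \<lparr>carrier = UNIV, mult = (*), one = 1, zero = 0, add = (+), smult = (*), star = cnj\<rparr>"

text \<open>The direct sum of the algebras \<open>A i\<close>: norm-bounded families with pointwise operations.\<close>

definition linf_sum ::
  "('a \<Rightarrow> real) \<Rightarrow> 'i set \<Rightarrow> ('i \<Rightarrow> 'a star_algebra) \<Rightarrow> ('i \<Rightarrow> 'a) star_algebra" where
  "linf_sum nrm I A =
     \<lparr>carrier = {x \<in> \<Pi>\<^sub>E i\<in>I. carrier (A i). bdd_above ((\<lambda>i. nrm (x i)) ` I)},
      mult = (\<lambda>x y. \<lambda>i\<in>I. x i \<otimes>\<^bsub>A i\<^esub> y i),
      one = (\<lambda>i\<in>I. \<one>\<^bsub>A i\<^esub>),
      zero = (\<lambda>i\<in>I. \<zero>\<^bsub>A i\<^esub>),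
      add = (\<lambda>x y. \<lambda>i\<in>I. x i \<oplus>\<^bsub>A i\<^esub> y i),
      smult = (\<lambda>c x. \<lambda>i\<in>I. c \<odot>\<^bsub>A i\<^esub> x i),
      star = (\<lambda>x. \<lambda>i\<in>I. star (A i) (x i))\<rparr>"

section \<open>Von Neumann algebras and their cardinal invariants\<close>

definition commutant :: "'h::complex_hilbert set \<Rightarrow> ('h \<Rightarrow> 'h) set \<Rightarrow> ('h \<Rightarrow> 'h) set" where
  "commutant H M = {T \<in> bounded_ops H. \<forall>S\<in>M. T \<circ> S = S \<circ> T}"

text \<open>
  Nonzero von Neumann algebras on \<open>H\<close>: self-adjoint sets of operators equal to their double
  commutant. In particular they contain the identity of \<open>H\<close>.
\<close>

definition von_neumann_algebra :: "'h::complex_hilbert set \<Rightarrow> ('h \<Rightarrow> 'h) set \<Rightarrow> bool" where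
  "von_neumann_algebra H M \<longleftrightarrow>
     closed_csubspace H \<and> M \<subseteq> bounded_ops H \<and> cadjoint ` M \<subseteq> M \<and>
     commutant H (commutant H M) = M \<and> M \<noteq> {\<lambda>_. 0}"

definition generates ::
  "'h::complex_hilbert set \<Rightarrow> ('h \<Rightarrow> 'h) set \<Rightarrow> ('h \<Rightarrow> 'h) set \<Rightarrow> bool" where
  "generates H S M \<longleftrightarrow>
     von_neumann_algebra H M \<and> S \<subseteq> M \<and>
     (\<forall>N. von_neumann_algebra H N \<and> S \<subseteq> N \<longrightarrow> M \<subseteq> N)"

definition faithful_normal_rep ::
  "'h::complex_hilbert set \<Rightarrow> ('h \<Rightarrow> 'h) set \<Rightarrow> 'h set \<Rightarrow> (('h \<Rightarrow> 'h) \<Rightarrow> ('h \<Rightarrow> 'h)) \<Rightarrow> bool" where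
  "faithful_normal_rep H M K \<pi> \<longleftrightarrow>
     \<pi> \<in> star_hom (op_algebra H M) (op_algebra K (bounded_ops K)) \<and> inj_on \<pi> M \<and>
     continuous_map (subtopology (ultraweak_topology H) M) (ultraweak_topology K) \<pi>"

text \<open>
  Cardinals are represented, as in the library, by the relations \<open>r\<close> with \<open>Card_order r\<close>, up to
  \<open>=o\<close>; a nonempty set of cardinals has a least element, unique up to \<open>=o\<close>.
\<close>

definition min_card :: "'x rel set \<Rightarrow> 'x rel" where
  "min_card C = (SOME \<kappa>. \<kappa> \<in> C \<and> (\<forall>\<kappa>'\<in>C. \<kappa> \<le>o \<kappa>'))"

text \<open>The first case is the convention that the scalars have one generator.\<close>

definition gen :: "'h::complex_hilbert set \<Rightarrow> ('h \<Rightarrow> 'h) set \<Rightarrow> ('h \<Rightarrow> 'h) rel" where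
  "gen H M =
     (if M = {\<lambda>x. c *\<^sub>C id_op H x | c. True} then |{id_op H}|
      else min_card {|S| | S. generates H S M})"

text \<open>
  It is enough to let \<open>K\<close> range over the closed subspaces of \<open>'h\<close>: the algebra \<open>M\<close> acts
  faithfully and normally on \<open>H\<close>, and every Hilbert space whose dimension is at most that of
  \<open>H\<close> is isomorphic to a closed subspace of \<open>H\<close>.
\<close>

definition chi_r :: "'h::complex_hilbert set \<Rightarrow> ('h \<Rightarrow> 'h) set \<Rightarrow> 'h rel" where
  "chi_r H M =
     min_card {|B| | B. \<exists>K \<pi>. closed_csubspace K \<and> hilbert_basis K B \<and> faithful_normal_rep H M K \<pi>}"

text \<open>
  Index sets inside \<open>'h\<close> and summands acting on subspaces of \<open>'h\<close> lose no generality: the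
  summands of \<open>M\<close> correspond to nonzero pairwise orthogonal central projections \<open>z\<close> of \<open>M\<close>, and
  are isomorphic to the algebras \<open>z M\<close> acting on the ranges of these projections.
  A cardinal that is at most \<open>F H M\<close> is represented by a relation of the same type as \<open>F H M\<close>.
\<close>

definition localization ::
  "('h::complex_hilbert set \<Rightarrow> ('h \<Rightarrow> 'h) set \<Rightarrow> 'x rel) \<Rightarrow> 'h set \<Rightarrow> ('h \<Rightarrow> 'h) set \<Rightarrow> 'x rel" where
  "localization F H M = min_card {\<kappa>. Card_order \<kappa> \<and>
     (\<exists>(I :: 'h set) K N.
        (\<forall>i\<in>I. von_neumann_algebra (K i) (N i) \<and> F (K i) (N i) \<le>o \<kappa>) \<and>
        star_isomorphic (op_algebra H M) (linf_sum onorm I (\<lambda>i. op_algebra (K i) (N i))))}"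

definition atomic_abelian :: "'h::complex_hilbert set \<Rightarrow> ('h \<Rightarrow> 'h) set \<Rightarrow> bool" where
  "atomic_abelian H M \<longleftrightarrow>
     (\<exists>I :: 'h set. star_isomorphic (op_algebra H M) (linf_sum cmod I (\<lambda>_. complex_algebra)))"

end

theory Submission
  imports Defs
begin

text \<open>
  Let \<open>M\<close> act faithfully and normally on a Hilbert space with orthonormal basis \<open>B\<close>. The matrix
  coefficients with respect to \<open>B\<close> are weakly continuous on the unit ball of \<open>M\<close> and separate its
  points. The ball being weakly compact, they determine its topology, so it has a dense subset of
  cardinality at most \<open>\<aleph>\<^sub>0 \<cdot> |B|\<close>, and this subset generates \<open>M\<close>. If \<open>B\<close> is finite, then \<open>M\<close> is
  spanned by at most \<open>|B|\<^sup>2\<close> operators.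

  Conversely, let \<open>S\<close> generate \<open>M\<close>. For a vector \<open>x\<close>, the cyclic subspace \<open>[M x]\<close> is spanned by
  the images of \<open>x\<close> under words in \<open>S \<union> S\<^sup>*\<close>, so its dimension is at most \<open>\<aleph>\<^sub>0 \<cdot> |S|\<close>. The projection
  \<open>z\<close> onto \<open>[M M' x]\<close> is central and \<open>z M\<close> acts faithfully on \<open>[M x]\<close>. A maximal family of vectors
  \<open>x\<close> for which these central projections are orthogonal decomposes \<open>M\<close> as the direct sum of the
  algebras \<open>z M\<close>.
\<close>

section \<open>Complex Hilbert spaces\<close>

text \<open>The factor aleph_0 would hide an algebra whose localized \<open>gen\<close> is aleph_0
  while its localized \<open>chi_r\<close> is finite. The quadratic bound for finite bases excludes
  this: an infinite localized \<open>gen\<close> forces an infinite localized \<open>chi_r\<close>,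
  and infinite cardinals absorb the factor. For atomic abelian algebras both invariants are 1, which
  depends on the convention for the scalars.

  The unit ball is essential for topological reasons. On norm-bounded sets the series that define
  the ultraweak topology converge uniformly, so normality can be tested with single forms, and these
  make the ball compact.

  Generated algebras are handled through commutants alone. No element of \<open>M\<close> is
  approximated by polynomials in the generators; the projection onto a suitable closed subspace is
  shown to commute with the generators and their adjoints, hence with \<open>M\<close>.

  A further obstacle is typing: \<open>gen\<close> and \<open>chi_r\<close> are cardinals on
  different types, and \<open>localization\<close> minimizes over cardinals of one type only, so
  bounds have to be copied from type to type.\<close>

lemma scaleC_one [simp]: "1 *\<^sub>C (x::'a::complex_hilbert) = x"
  using scaleC_of_real[of 1 x] by simp

lemma scaleC_zero_left [simp]: "0 *\<^sub>C (x::'a::complex_hilbert) = 0"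
  using scaleC_of_real[of 0 x] by simp

lemma scaleC_zero_right [simp]: "c *\<^sub>C (0::'a::complex_hilbert) = 0"
  using scaleC_add_right[of c 0 0] by simp

lemma scaleC_minus_one [simp]: "(-1) *\<^sub>C (x::'a::complex_hilbert) = - x"
  using scaleC_of_real[of "-1" x] by simp

lemma scaleC_minus_right: "c *\<^sub>C (- x) = - (c *\<^sub>C (x::'a::complex_hilbert))"
  using scaleC_add_right[of c "x" "- x"] by (simp add: eq_neg_iff_add_eq_0 add.commute)

lemma scaleC_diff_right: "c *\<^sub>C (x - y) = c *\<^sub>C x - c *\<^sub>C (y::'a::complex_hilbert)"
  using scaleC_add_right[of c x "- y"] by (simp add: scaleC_minus_right)

lemma cinner_add_left: "cinner (x + y) z = cinner x z + cinner y (z::'a::complex_hilbert)"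
  by (metis cinner_add_right cinner_commute complex_cnj_add)

lemma cinner_scaleC_left: "cinner (c *\<^sub>C x) y = cnj c * cinner x (y::'a::complex_hilbert)"
  by (metis cinner_commute cinner_scaleC_right complex_cnj_cnj complex_cnj_mult)

lemma cinner_zero_right [simp]: "cinner x (0::'a::complex_hilbert) = 0"
  using cinner_add_right[of x 0 0] by simp

lemma cinner_zero_left [simp]: "cinner (0::'a::complex_hilbert) x = 0"
  using cinner_add_left[of 0 0 x] by simp

lemma cinner_minus_right: "cinner x (- y) = - cinner x (y::'a::complex_hilbert)"
  using cinner_add_right[of x y "- y"] by (simp add: eq_neg_iff_add_eq_0 add.commute)

lemma cinner_diff_right: "cinner x (y - z) = cinner x y - cinner x (z::'a::complex_hilbert)"
  using cinner_add_right[of x y "- z"] by (simp add: cinner_minus_right)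

lemma cinner_self: "cinner x x = complex_of_real ((norm (x::'a::complex_hilbert))\<^sup>2)"
proof (rule complex_eqI)
  show "Re (cinner x x) = Re (complex_of_real ((norm x)\<^sup>2))"
    by (simp add: inner_eq_Re_cinner[symmetric] power2_norm_eq_inner)
  have "Im (cinner x x) = - Im (cinner x x)"
    using arg_cong[OF cinner_commute[of x x], of Im] by simp
  then show "Im (cinner x x) = Im (complex_of_real ((norm x)\<^sup>2))"
    by simp
qed

lemma cinner_self_eq_zero [simp]: "cinner x x = 0 \<longleftrightarrow> (x::'a::complex_hilbert) = 0"
  by (simp add: cinner_self)

lemma cinner_eqI:
  fixes x y :: "'a::complex_hilbert"
  assumes "\<And>z. cinner z x = cinner z y"
  shows "x = y"
  using assms[of "x - y"] cinner_self_eq_zero[of "x - y"] by (simp add: cinner_diff_right)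

lemma norm_scaleC: "norm (c *\<^sub>C x) = cmod c * norm (x::'a::complex_hilbert)"
proof -
  have "complex_of_real ((norm (c *\<^sub>C x))\<^sup>2) = complex_of_real ((cmod c * norm x)\<^sup>2)"
  proof -
    have "cinner (c *\<^sub>C x) (c *\<^sub>C x) = (c * cnj c) * cinner x x"
      by (simp add: cinner_scaleC_left cinner_scaleC_right)
    then show ?thesis
      unfolding cinner_self complex_norm_square[symmetric] power_mult_distrib of_real_mult .
  qed
  then have "(norm (c *\<^sub>C x))\<^sup>2 = (cmod c * norm x)\<^sup>2"
    using of_real_eq_iff by blast
  then show ?thesis
    by (simp add: power2_eq_iff_nonneg)
qed

lemma cinner_Cauchy_Schwarz: "cmod (cinner x y) \<le> norm x * norm (y::'a::complex_hilbert)"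
proof (cases "cinner x y = 0")
  case False
  \<comment> \<open>The phase that turns the complex product into its modulus, so that the real
    Cauchy-Schwarz inequality applies to \<open>x\<close> and the rotated \<open>y\<close>.\<close>
  define a where "a = cnj (cinner x y) / complex_of_real (cmod (cinner x y))"
  have "cmod a = 1"
    using False by (simp add: a_def norm_divide)
  have "a * cinner x y = complex_of_real (cmod (cinner x y))"
    using False by (simp add: a_def field_simps complex_norm_square[symmetric] power2_eq_square)
  then have "cmod (cinner x y) = inner x (a *\<^sub>C y)"
    by (simp add: inner_eq_Re_cinner cinner_scaleC_right)
  also have "\<dots> \<le> norm x * norm (a *\<^sub>C y)"
    by (rule norm_cauchy_schwarz)
  finally show ?thesis
    using \<open>cmod a = 1\<close> by (simp add: norm_scaleC)
qed simp

lemma bounded_linear_scaleC: "bounded_linear (\<lambda>x::'a::complex_hilbert. c *\<^sub>C x)"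
proof (rule bounded_linear_intro[where K="cmod c"])
  fix r and x :: 'a
  have "c *\<^sub>C (r *\<^sub>R x) = (c * complex_of_real r) *\<^sub>C x"
    by (simp add: scaleC_of_real[symmetric] scaleC_scaleC)
  also have "\<dots> = r *\<^sub>R (c *\<^sub>C x)"
    by (simp add: scaleC_of_real[symmetric] scaleC_scaleC mult.commute)
  finally show "c *\<^sub>C (r *\<^sub>R x) = r *\<^sub>R (c *\<^sub>C x)" .
qed (auto simp: scaleC_add_right norm_scaleC)

lemma bounded_bilinear_cinner: "bounded_bilinear (cinner :: 'a::complex_hilbert \<Rightarrow> 'a \<Rightarrow> complex)"
proof
  show "\<exists>K. \<forall>a b::'a. cmod (cinner a b) \<le> norm a * norm b * K"
    using cinner_Cauchy_Schwarz by (intro exI[of _ 1]) auto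
qed (auto simp: cinner_add_left cinner_add_right cinner_scaleC_left cinner_scaleC_right
    scaleC_of_real[symmetric] scaleR_conv_of_real)

lemmas continuous_on_cinner [continuous_intros] =
  bounded_bilinear.continuous_on[OF bounded_bilinear_cinner]

lemma cinner_sum_right: "cinner x (sum f A) = (\<Sum>a\<in>A. cinner x (f a :: 'a::complex_hilbert))"
  by (rule bounded_bilinear.sum_right[OF bounded_bilinear_cinner])

lemma norm_add_square_orthogonal:
  fixes x y :: "'a::complex_hilbert"
  assumes "cinner x y = 0"
  shows "(norm (x + y))\<^sup>2 = (norm x)\<^sup>2 + (norm y)\<^sup>2"
proof -
  have "inner x y = 0" using assms by (simp add: inner_eq_Re_cinner)
  then show ?thesis
    unfolding power2_norm_eq_inner by (simp add: inner_add_left inner_add_right inner_commute[of y x])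
qed

section \<open>Projections\<close>

lemma closed_csubspaceD:
  assumes "closed_csubspace H"
  shows "0 \<in> H" "x \<in> H \<Longrightarrow> y \<in> H \<Longrightarrow> x + y \<in> H" "x \<in> H \<Longrightarrow> c *\<^sub>C x \<in> H" "closed H"
    "x \<in> H \<Longrightarrow> y \<in> H \<Longrightarrow> x - y \<in> H" "x \<in> H \<Longrightarrow> r *\<^sub>R x \<in> H" "x \<in> H \<Longrightarrow> - x \<in> H"
proof -
  note * = assms[unfolded closed_csubspace_def]
  show "0 \<in> H" "x \<in> H \<Longrightarrow> y \<in> H \<Longrightarrow> x + y \<in> H" "x \<in> H \<Longrightarrow> c *\<^sub>C x \<in> H" "closed H"
    using * by auto
  show neg: "x \<in> H \<Longrightarrow> - x \<in> H" for x
    using * scaleC_minus_one[of x] by metis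
  show "x \<in> H \<Longrightarrow> y \<in> H \<Longrightarrow> x - y \<in> H"
    using neg[of y] * by (metis add_uminus_conv_diff)
  show "x \<in> H \<Longrightarrow> r *\<^sub>R x \<in> H"
    using * by (metis scaleC_of_real)
qed

text \<open>A minimizing sequence is Cauchy: midpoints stay in \<open>H\<close>, hence at distance
  at least \<open>d\<close> from \<open>x\<close>, and the parallelogram law turns this into a bound
  on the distance of two members.\<close>

lemma closest_point_csubspace_exists:
  fixes x :: "'a::complex_hilbert"
  assumes H: "closed_csubspace H"
  shows "\<exists>p\<in>H. \<forall>y\<in>H. norm (x - p) \<le> norm (x - y)"
proof -
  define d where "d = Inf ((\<lambda>y. norm (x - y)) ` H)"
  have bb: "bdd_below ((\<lambda>y. norm (x - y)) ` H)"
    by (auto intro!: bdd_belowI[of _ 0])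
  have d_le: "d \<le> norm (x - y)" if "y \<in> H" for y
    unfolding d_def by (rule cInf_lower[OF _ bb]) (use that in auto)
  have ne: "H \<noteq> {}" using closed_csubspaceD(1)[OF H] by auto
  have "d \<ge> 0"
    unfolding d_def by (rule cInf_greatest) (use ne in auto)
  have "\<exists>y\<in>H. norm (x - y) < d + 1 / real (Suc n)" for n
    using cInf_less_iff[OF _ bb, of "d + 1 / real (Suc n)"] ne unfolding d_def by auto
  then obtain Y where Y: "\<And>n. Y n \<in> H" "\<And>n. norm (x - Y n) < d + 1 / real (Suc n)"
    by metis
  have par: "(norm (Y m - Y n))\<^sup>2 \<le> 2 * (norm (x - Y m))\<^sup>2 + 2 * (norm (x - Y n))\<^sup>2 - 4 * d\<^sup>2" for m n
  proof -
    have "(1/2) *\<^sub>R (Y m + Y n) \<in> H"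
      using Y by (intro closed_csubspaceD(2,6)[OF H]) auto
    from d_le[OF this] have "2 * d \<le> 2 * norm (x - (1/2) *\<^sub>R (Y m + Y n))" by simp
    also have "\<dots> = norm (2 *\<^sub>R (x - (1/2) *\<^sub>R (Y m + Y n)))" by simp
    also have "2 *\<^sub>R (x - (1/2) *\<^sub>R (Y m + Y n)) = (x - Y m) + (x - Y n)"
      by (simp add: algebra_simps scaleR_2)
    finally have "(2 * d)\<^sup>2 \<le> (norm ((x - Y m) + (x - Y n)))\<^sup>2"
      using \<open>d \<ge> 0\<close> by (intro power_mono) auto
    moreover have "(norm ((x - Y m) + (x - Y n)))\<^sup>2 + (norm ((x - Y m) - (x - Y n)))\<^sup>2
        = 2 * (norm (x - Y m))\<^sup>2 + 2 * (norm (x - Y n))\<^sup>2"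
      unfolding power2_norm_eq_inner
      by (simp add: inner_add_left inner_add_right inner_diff_left inner_diff_right inner_commute)
    moreover have "(x - Y m) - (x - Y n) = - (Y m - Y n)" by simp
    ultimately show ?thesis
      by (simp only: norm_minus_cancel power_mult_distrib) simp
  qed
  have lim_d: "(\<lambda>n. norm (x - Y n)) \<longlonglongrightarrow> d"
  proof (rule tendsto_sandwich)
    show "\<forall>\<^sub>F n in sequentially. d \<le> norm (x - Y n)" using d_le Y by auto
    show "\<forall>\<^sub>F n in sequentially. norm (x - Y n) \<le> d + 1 / real (Suc n)"
      by (intro always_eventually allI less_imp_le Y(2))
    show "(\<lambda>n. d + 1 / real (Suc n)) \<longlonglongrightarrow> d"
      using tendsto_add[OF tendsto_const[of d] LIMSEQ_inverse_real_of_nat]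
      by (simp add: inverse_eq_divide)
  qed simp
  have "Cauchy Y"
  proof (rule metric_CauchyI)
    fix e :: real assume "e > 0"
    have "(\<lambda>n. (norm (x - Y n))\<^sup>2) \<longlonglongrightarrow> d\<^sup>2"
      by (intro tendsto_intros lim_d)
    moreover have "d\<^sup>2 < d\<^sup>2 + e\<^sup>2 / 4" using \<open>e > 0\<close> by simp
    ultimately have "\<forall>\<^sub>F n in sequentially. (norm (x - Y n))\<^sup>2 < d\<^sup>2 + e\<^sup>2 / 4"
      by (rule order_tendstoD)
    then obtain N where N: "\<And>n. n \<ge> N \<Longrightarrow> (norm (x - Y n))\<^sup>2 < d\<^sup>2 + e\<^sup>2 / 4"
      by (auto simp: eventually_sequentially)
    have "dist (Y m) (Y n) < e" if "m \<ge> N" "n \<ge> N" for m n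
    proof -
      have "(norm (Y m - Y n))\<^sup>2 < e\<^sup>2"
        using par[of m n] N[OF that(1)] N[OF that(2)] by simp
      then show ?thesis
        using \<open>e > 0\<close> by (simp add: dist_norm power_less_imp_less_base)
    qed
    then show "\<exists>N. \<forall>m\<ge>N. \<forall>n\<ge>N. dist (Y m) (Y n) < e" by blast
  qed
  then obtain p where p: "Y \<longlonglongrightarrow> p"
    using Cauchy_convergent_iff convergent_def by blast
  have "p \<in> H"
    using closed_sequentially[OF closed_csubspaceD(4)[OF H]] Y(1) p by blast
  moreover have "(\<lambda>n. norm (x - Y n)) \<longlonglongrightarrow> norm (x - p)"
    by (intro tendsto_intros p)
  then have "norm (x - p) = d"
    using lim_d LIMSEQ_unique by blast
  ultimately show ?thesis using d_le by auto
qed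

lemma orthogonal_decomposition_exists:
  fixes x :: "'a::complex_hilbert"
  assumes H: "closed_csubspace H"
  shows "\<exists>p\<in>H. \<forall>y\<in>H. cinner y (x - p) = 0"
proof -
  obtain p where p: "p \<in> H" and min: "\<And>y. y \<in> H \<Longrightarrow> norm (x - p) \<le> norm (x - y)"
    using closest_point_csubspace_exists[OF H] by blast
  have re: "inner y (x - p) = 0" if "y \<in> H" for y
  proof (cases "y = 0")
    case False
    \<comment> \<open>\<open>t\<close> times \<open>y\<close> is the real projection of
      \<open>x - p\<close> onto \<open>y\<close>, the correction that would shorten
      \<open>x - p\<close> the most; minimality of \<open>p\<close> forces it to vanish.\<close>
    define t where "t = inner y (x - p) / (norm y)\<^sup>2"
    have "p + t *\<^sub>R y \<in> H"
      using p that by (intro closed_csubspaceD(2,6)[OF H])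
    from min[OF this] have "(norm (x - p))\<^sup>2 \<le> (norm ((x - p) - t *\<^sub>R y))\<^sup>2"
      by (intro power_mono) (auto simp: algebra_simps)
    also have "\<dots> = (norm (x - p))\<^sup>2 - 2 * t * inner y (x - p) + t\<^sup>2 * (norm y)\<^sup>2"
      unfolding power2_norm_eq_inner
      by (simp add: inner_diff_left inner_diff_right inner_commute power2_eq_square algebra_simps)
    also have "\<dots> = (norm (x - p))\<^sup>2 - (inner y (x - p))\<^sup>2 / (norm y)\<^sup>2"
      using False by (simp add: t_def power2_eq_square field_simps)
    finally have "(inner y (x - p))\<^sup>2 / (norm y)\<^sup>2 \<le> 0" by simp
    then show ?thesis using False
      by (simp add: divide_le_0_iff)
  qed simp
  have "cinner y (x - p) = 0" if "y \<in> H" for y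
  proof (rule complex_eqI)
    show "Re (cinner y (x - p)) = Re 0" using re[OF that] by (simp add: inner_eq_Re_cinner)
    \<comment> \<open>\<open>H\<close> is a complex subspace, so real orthogonality to the rotated
      vector supplies the imaginary part.\<close>
    have "inner (\<i> *\<^sub>C y) (x - p) = 0" using re closed_csubspaceD(3)[OF H that] by blast
    then show "Im (cinner y (x - p)) = Im 0"
      by (simp add: inner_eq_Re_cinner cinner_scaleC_left)
  qed
  with p show ?thesis by blast
qed

lemma bounded_opsD:
  assumes "T \<in> bounded_ops H"
  shows "bounded_linear T" "T (c *\<^sub>C x) = c *\<^sub>C T x" "T x \<in> H" "T (x + y) = T x + T y"
    "T 0 = 0" "T (x - y) = T x - T y"
proof -
  show bl: "bounded_linear T" and "T (c *\<^sub>C x) = c *\<^sub>C T x" "T x \<in> H"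
    using assms by (auto simp: bounded_ops_def)
  interpret bounded_linear T by (rule bl)
  show "T (x + y) = T x + T y" "T 0 = 0" "T (x - y) = T x - T y"
    by (auto simp: add zero diff)
qed

lemma bounded_ops_orthogonal:
  "T \<in> bounded_ops H \<Longrightarrow> (\<And>y. y \<in> H \<Longrightarrow> cinner y x = 0) \<Longrightarrow> T x = 0"
  by (auto simp: bounded_ops_def)

text \<open>Stated for an arbitrary candidate \<open>P\<close> because \<open>id_op\<close> is a
  definite description: every candidate is the orthogonal projection, and this yields the uniqueness
  needed to unfold it.\<close>

lemma id_op_unique:
  fixes H :: "'a::complex_hilbert set"
  assumes H: "closed_csubspace H"
    and P: "P \<in> bounded_ops H" "\<And>x. x \<in> H \<Longrightarrow> P x = x"
  shows "P x \<in> H" "y \<in> H \<Longrightarrow> cinner y (P x) = cinner y x"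
proof -
  show "P x \<in> H" using bounded_opsD(3)[OF P(1)] .
  assume y: "y \<in> H"
  obtain p where p: "p \<in> H" "\<And>y. y \<in> H \<Longrightarrow> cinner y (x - p) = 0"
    using orthogonal_decomposition_exists[OF H] by blast
  have "P (x - p) = 0"
    using bounded_ops_orthogonal[OF P(1)] p(2) by blast
  then have "P x = p"
    using bounded_opsD(6)[OF P(1)] P(2)[OF p(1)] by simp
  then show "cinner y (P x) = cinner y x"
    using p(2)[OF y] by (simp add: cinner_diff_right)
qed

lemma id_op_exists:
  fixes H :: "'a::complex_hilbert set"
  assumes H: "closed_csubspace H"
  shows "\<exists>P. P \<in> bounded_ops H \<and> (\<forall>x\<in>H. P x = x)"
proof -
  obtain P where P: "\<And>x. P x \<in> H" "\<And>x y. y \<in> H \<Longrightarrow> cinner y (x - P x) = 0"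
    using orthogonal_decomposition_exists[OF H] by metis
  have uniq: "P x = p" if "p \<in> H" "\<And>y. y \<in> H \<Longrightarrow> cinner y (x - p) = 0" for x p
  proof -
    have "P x - p \<in> H" using P(1) that(1) by (intro closed_csubspaceD(5)[OF H])
    then have "cinner (P x - p) ((x - p) - (x - P x)) = 0"
      using that(2) P(2) unfolding cinner_diff_right[of _ "x - p"] by simp
    then show ?thesis by simp
  qed
  have add: "P (x + y) = P x + P y" for x y
  proof (rule uniq)
    show "cinner z (x + y - (P x + P y)) = 0" if "z \<in> H" for z
      using P(2)[OF that, of x] P(2)[OF that, of y] by (simp add: cinner_add_right cinner_diff_right)
  qed (use P(1) H in \<open>auto intro: closed_csubspaceD\<close>)
  have scl: "P (c *\<^sub>C x) = c *\<^sub>C P x" for c x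
  proof (rule uniq)
    show "cinner z (c *\<^sub>C x - c *\<^sub>C P x) = 0" if "z \<in> H" for z
      using P(2)[OF that, of x] by (simp add: scaleC_diff_right[symmetric] cinner_scaleC_right)
  qed (use P(1) H in \<open>auto intro: closed_csubspaceD\<close>)
  have nrm: "norm (P x) \<le> norm x" for x
  proof -
    have "(norm (P x + (x - P x)))\<^sup>2 = (norm (P x))\<^sup>2 + (norm (x - P x))\<^sup>2"
      by (rule norm_add_square_orthogonal) (rule P(2)[OF P(1)])
    then have "(norm (P x))\<^sup>2 \<le> (norm x)\<^sup>2" by simp
    then show ?thesis by (simp add: power2_le_iff_abs_le)
  qed
  have "bounded_linear P"
    by (rule bounded_linear_intro[where K=1])
      (auto simp: add scl nrm scaleC_of_real[symmetric])
  moreover have "P x = x" if "x \<in> H" for x using uniq[OF that] by simp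
  moreover have "P x = 0" if "\<forall>y\<in>H. cinner y x = 0" for x
    using uniq[of 0 x] that closed_csubspaceD(1)[OF H] by simp
  ultimately show ?thesis
    using P(1) scl by (intro exI[of _ P]) (auto simp: bounded_ops_def)
qed

lemma id_op:
  fixes H :: "'a::complex_hilbert set"
  assumes H: "closed_csubspace H"
  shows "id_op H \<in> bounded_ops H" "x \<in> H \<Longrightarrow> id_op H x = x"
proof -
  have "\<exists>!P. P \<in> bounded_ops H \<and> (\<forall>x\<in>H. P x = x)"
  proof (rule ex_ex1I[OF id_op_exists[OF H]])
    fix P Q assume P: "P \<in> bounded_ops H \<and> (\<forall>x\<in>H. P x = x)"
      and Q: "Q \<in> bounded_ops H \<and> (\<forall>x\<in>H. Q x = x)"
    show "P = Q"
    proof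
      fix x
      have "P x - Q x \<in> H"
        using id_op_unique(1)[OF H] P Q closed_csubspaceD(5)[OF H] by blast
      then have "cinner (P x - Q x) (P x - Q x) = 0"
        using id_op_unique(2)[OF H] P Q unfolding cinner_diff_right[of _ "P x"] by auto
      then show "P x = Q x" by simp
    qed
  qed
  from theI'[OF this] have "id_op H \<in> bounded_ops H \<and> (\<forall>x\<in>H. id_op H x = x)"
    unfolding id_op_def .
  then show "id_op H \<in> bounded_ops H" "x \<in> H \<Longrightarrow> id_op H x = x" by auto
qed

lemma id_op_in: "closed_csubspace H \<Longrightarrow> id_op H x \<in> H"
  using bounded_opsD(3)[OF id_op(1)] .

lemma cinner_id_op: "closed_csubspace H \<Longrightarrow> y \<in> H \<Longrightarrow> cinner y (id_op H x) = cinner y x"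
  using id_op_unique(2)[of H "id_op H"] id_op by blast

lemma id_op_selfadjoint:
  assumes H: "closed_csubspace H"
  shows "cinner (id_op H x) y = cinner x (id_op H y)"
  by (metis H cinner_commute cinner_id_op id_op_in)

lemma norm_id_op_le:
  assumes H: "closed_csubspace H"
  shows "norm (id_op H x) \<le> norm x"
proof -
  have "(norm (id_op H x + (x - id_op H x)))\<^sup>2 = (norm (id_op H x))\<^sup>2 + (norm (x - id_op H x))\<^sup>2"
    by (rule norm_add_square_orthogonal)
      (simp add: cinner_diff_right cinner_id_op[OF H id_op_in[OF H]])
  then have "(norm (id_op H x))\<^sup>2 \<le> (norm x)\<^sup>2" by simp
  then show ?thesis by (simp add: power2_le_iff_abs_le)
qed

lemma bounded_ops_id_op:
  assumes H: "closed_csubspace H" and T: "T \<in> bounded_ops H"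
  shows "T (id_op H x) = T x" "id_op H (T x) = T x"
proof -
  have "T (x - id_op H x) = 0"
    by (rule bounded_ops_orthogonal[OF T]) (simp add: cinner_diff_right cinner_id_op[OF H])
  then show "T (id_op H x) = T x" by (simp add: bounded_opsD(6)[OF T])
  show "id_op H (T x) = T x" by (rule id_op(2)[OF H bounded_opsD(3)[OF T]])
qed

lemma id_op_eqI:
  assumes H: "closed_csubspace H" and "p \<in> H" and "\<And>y. y \<in> H \<Longrightarrow> cinner y p = cinner y x"
  shows "id_op H x = p"
proof -
  have "id_op H x - p \<in> H" using assms(2) id_op_in[OF H] closed_csubspaceD(5)[OF H] by blast
  then have "cinner (id_op H x - p) (id_op H x - p) = 0"
    using assms(3) cinner_id_op[OF H] unfolding cinner_diff_right[of _ "id_op H x"] by auto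
  then show ?thesis by simp
qed

text \<open>Operators are stored with their extension by zero, so an operator on a subspace already
  is one on every larger space. This lets reduced algebras be compared with \<open>M\<close> without
  any embedding.\<close>

lemma bounded_ops_mono:
  assumes "H \<subseteq> K"
  shows "bounded_ops H \<subseteq> bounded_ops K"
  using assms unfolding bounded_ops_def by blast

section \<open>The Riesz representation theorem and adjoints\<close>

lemma bounded_opsI:
  assumes "\<And>x y. T (x + y) = T x + T y" "\<And>c x. T (c *\<^sub>C x) = c *\<^sub>C T x"
    "\<And>x. norm (T x) \<le> r * norm x" "\<And>x. T x \<in> H" 
    "\<And>x. (\<And>y. y \<in> H \<Longrightarrow> cinner y x = 0) \<Longrightarrow> T x = 0"
  shows "T \<in> bounded_ops H"
proof -
  have "bounded_linear T"
    by (rule bounded_linear_intro[where K=r]) (use assms(1-3) in \<open>auto simp: mult.commute scaleC_of_real[symmetric]\<close>)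
  then show ?thesis using assms(2,4,5) by (auto simp: bounded_ops_def)
qed

lemma Riesz_representation:
  fixes f :: "'a::complex_hilbert \<Rightarrow> complex"
  assumes add: "\<And>x y. f (x + y) = f x + f y" and scl: "\<And>c x. f (c *\<^sub>C x) = c * f x"
    and bd: "\<And>x. cmod (f x) \<le> r * norm x"
  shows "\<exists>u. \<forall>x. f x = cinner u x"
proof (cases "\<forall>x. f x = 0")
  case False
  then obtain x where x: "f x \<noteq> 0" by blast
  define K where "K = {x. f x = 0}"
  have bl: "bounded_linear f"
    by (rule bounded_linear_intro[where K=r])
      (use add scl bd in \<open>auto simp: mult.commute scaleC_of_real[symmetric] scaleR_conv_of_real\<close>)
  then have "closed K"
    unfolding K_def by (intro closed_Collect_eq linear_continuous_on continuous_on_const)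
  then have K: "closed_csubspace K"
    using linear_0[OF bounded_linear.linear[OF bl]]
    by (auto simp: closed_csubspace_def K_def add scl)
  obtain p where p: "p \<in> K" "\<And>y. y \<in> K \<Longrightarrow> cinner y (x - p) = 0"
    using orthogonal_decomposition_exists[OF K] by blast
  define w where "w = x - p"
  have fdiff: "f (x - y) = f x - f y" for x y
    using linear_diff[OF bounded_linear.linear[OF bl]] .
  have fw: "f w = f x" using p(1) by (simp add: w_def fdiff K_def)
  then have w0: "w \<noteq> 0" using x linear_0[OF bounded_linear.linear[OF bl]] by auto
  \<comment> \<open>\<open>w\<close> is orthogonal to the kernel of \<open>f\<close>; the factor is
    chosen so that \<open>f\<close> and the product with \<open>u\<close> agree at \<open>w\<close>,
    and any \<open>y\<close> differs from a multiple of \<open>w\<close> by a kernel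
    element.\<close>
  define u where "u = (cnj (f w) / complex_of_real ((norm w)\<^sup>2)) *\<^sub>C w"
  have "f y = cinner u y" for y
  proof -
    have "y - (f y / f w) *\<^sub>C w \<in> K"
      using x fw by (simp add: K_def fdiff scl)
    then have "cinner (y - (f y / f w) *\<^sub>C w) w = 0"
      using p(2) w_def by blast
    then have "cinner w (y - (f y / f w) *\<^sub>C w) = 0"
      by (metis cinner_commute complex_cnj_zero)
    then have "cinner w y = (f y / f w) * complex_of_real ((norm w)\<^sup>2)"
      by (simp add: cinner_diff_right cinner_scaleC_right cinner_self)
    then show ?thesis
      using w0 x fw by (simp add: u_def cinner_scaleC_left)
  qed
  then show ?thesis by blast
qed (auto intro!: exI[of _ 0])

text \<open>Riesz applied to the conjugate of \<open>F u v\<close> as a function of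
  \<open>u\<close>, for each fixed \<open>v\<close>. The constant \<open>r\<close> is kept so that
  forms bounded by \<open>r\<close> correspond exactly to operators in the ball of radius
  \<open>r\<close>.\<close>

lemma sesquilinear_form_representation:
  fixes F :: "'a::complex_hilbert \<Rightarrow> 'a \<Rightarrow> complex"
  assumes addl: "\<And>u u' v. F (u + u') v = F u v + F u' v"
    and addr: "\<And>u v v'. F u (v + v') = F u v + F u v'"
    and scll: "\<And>c u v. F (c *\<^sub>C u) v = cnj c * F u v"
    and sclr: "\<And>c u v. F u (c *\<^sub>C v) = c * F u v"
    and bd: "\<And>u v. cmod (F u v) \<le> r * norm u * norm v"
  shows "\<exists>T\<in>bounded_ops UNIV. (\<forall>u v. F u v = cinner u (T v)) \<and> (\<forall>v. norm (T v) \<le> r * norm v)"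
proof -
  have "\<exists>w. \<forall>u. F u v = cinner u w" for v
  proof -
    have "\<exists>w. \<forall>u. cnj (F u v) = cinner w u"
      by (rule Riesz_representation[where r="r * norm v"])
        (use bd[of _ v] in \<open>auto simp: addl scll mult_ac\<close>)
    then show ?thesis by (metis cinner_commute complex_cnj_cnj)
  qed
  then obtain T where T: "\<And>u v. F u v = cinner u (T v)" by metis
  have nT: "norm (T v) \<le> r * norm v" for v
  proof (cases "T v = 0")
    case True
    have "0 \<le> r * norm v * norm v" using bd[of v v] norm_ge_zero order_trans by blast
    then show ?thesis using True
      by (cases "v = 0") (auto simp: zero_le_mult_iff)
  next
    case False
    have "norm (T v) * norm (T v) \<le> (r * norm v) * norm (T v)"
      using bd[of "T v" v] unfolding T cinner_self by (simp add: power2_eq_square norm_mult mult_ac)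
    then show ?thesis using False by simp
  qed
  have "T \<in> bounded_ops UNIV"
  proof (rule bounded_opsI)
    show "T (x + y) = T x + T y" for x y
      by (rule cinner_eqI) (simp add: T[symmetric] addr cinner_add_right)
    show "T (c *\<^sub>C x) = c *\<^sub>C T x" for c x
      by (rule cinner_eqI) (simp add: T[symmetric] sclr cinner_scaleC_right)
    show "T x = 0" if "\<And>y. y \<in> UNIV \<Longrightarrow> cinner y x = 0" for x
      using that[of x] nT[of x] by simp
  qed (use nT in auto)
  then show ?thesis using T nT by blast
qed

lemma bounded_ops_bound:
  assumes "T \<in> bounded_ops H"
  obtains r where "r \<ge> 0" "\<And>x. norm (T x) \<le> r * norm x"
  using bounded_linear.nonneg_bounded[OF bounded_opsD(1)[OF assms]] by (metis mult.commute)

lemma cadjoint_eqI: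
  assumes "\<And>x y. cinner (S x) y = cinner x (T y)"
  shows "cadjoint T = S"
  unfolding cadjoint_def
proof (rule the_equality)
  fix S' assume S': "\<forall>x y. cinner (S' x) y = cinner x (T y)"
  show "S' = S"
  proof
    fix x
    show "S' x = S x"
      by (rule cinner_eqI) (metis S' assms cinner_commute)
  qed
qed (use assms in simp)

lemma cadjoint:
  assumes T: "T \<in> bounded_ops H"
  shows "cinner (cadjoint T x) y = cinner x (T y)"
proof -
  obtain r where r: "\<And>x. norm (T x) \<le> r * norm x"
    using bounded_ops_bound[OF T] by blast
  have "\<exists>S\<in>bounded_ops UNIV. (\<forall>u v. cinner (T u) v = cinner u (S v)) \<and> (\<forall>v. norm (S v) \<le> r * norm v)"
  proof (rule sesquilinear_form_representation)
    show "cmod (cinner (T u) v) \<le> r * norm u * norm v" for u v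
      using cinner_Cauchy_Schwarz[of "T u" v] mult_right_mono[OF r[of u], of "norm v"] by simp
  qed (auto simp: bounded_opsD[OF T] cinner_add_left cinner_add_right cinner_scaleC_left cinner_scaleC_right)
  then obtain S where S: "\<And>u v. cinner (T u) v = cinner u (S v)" by blast
  have "cadjoint T = S"
    by (rule cadjoint_eqI) (metis S cinner_commute)
  then show ?thesis by (metis S cinner_commute)
qed

lemma cadjoint_right:
  assumes T: "T \<in> bounded_ops H"
  shows "cinner x (cadjoint T y) = cinner (T x) y"
  by (metis T cadjoint cinner_commute)

lemma cadjoint_norm_le:
  assumes T: "T \<in> bounded_ops H" and r: "\<And>x. norm (T x) \<le> r * norm x"
  shows "norm (cadjoint T x) \<le> r * norm x"
proof (cases "cadjoint T x = 0")
  case True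
  then show ?thesis using order_trans[OF norm_ge_zero r[of x]] by simp
next
  case False
  have "complex_of_real ((norm (cadjoint T x))\<^sup>2) = cinner x (T (cadjoint T x))"
    by (metis cadjoint[OF T] cinner_self)
  then have "(norm (cadjoint T x))\<^sup>2 = cmod (cinner x (T (cadjoint T x)))"
    by (metis norm_of_real abs_of_nonneg zero_le_power2)
  also have "\<dots> \<le> norm x * norm (T (cadjoint T x))" by (rule cinner_Cauchy_Schwarz)
  also have "\<dots> \<le> norm x * (r * norm (cadjoint T x))" by (intro mult_left_mono r) auto
  finally have "norm (cadjoint T x) * norm (cadjoint T x) \<le> (r * norm x) * norm (cadjoint T x)"
    by (simp add: power2_eq_square mult_ac)
  then show ?thesis using False by simp
qed

lemma cadjoint_bounded_ops:
  assumes H: "closed_csubspace H" and T: "T \<in> bounded_ops H"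
  shows "cadjoint T \<in> bounded_ops H"
proof -
  obtain r where r: "\<And>x. norm (T x) \<le> r * norm x"
    using bounded_ops_bound[OF T] by blast
  show ?thesis
  proof (rule bounded_opsI)
    show "cadjoint T (x + y) = cadjoint T x + cadjoint T y" for x y
      by (rule cinner_eqI) (simp add: cadjoint_right[OF T] cinner_add_right)
    show "cadjoint T (c *\<^sub>C x) = c *\<^sub>C cadjoint T x" for c x
      by (rule cinner_eqI) (simp add: cadjoint_right[OF T] cinner_scaleC_right)
    show "norm (cadjoint T x) \<le> r * norm x" for x
      by (rule cadjoint_norm_le[OF T r])
    \<comment> \<open>\<open>T\<close> absorbs the projection onto \<open>H\<close> on its right, so
      its adjoint absorbs it on the left and has range in \<open>H\<close>.\<close>
    have "cadjoint T x = id_op H (cadjoint T x)" for x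
      by (rule cinner_eqI)
        (metis T H cadjoint_right bounded_ops_id_op(1) id_op_selfadjoint)
    then show "cadjoint T x \<in> H" for x using id_op_in[OF H] by metis
    show "cadjoint T x = 0" if "\<And>y. y \<in> H \<Longrightarrow> cinner y x = 0" for x
      by (rule cinner_eqI) (simp add: cadjoint_right[OF T] that bounded_opsD(3)[OF T])
  qed
qed

lemma cadjoint_cadjoint:
  assumes "T \<in> bounded_ops H"
  shows "cadjoint (cadjoint T) = T"
  by (rule cadjoint_eqI) (simp add: cadjoint_right[OF assms])

lemma cadjoint_compose:
  assumes "S \<in> bounded_ops H" "T \<in> bounded_ops K"
  shows "cadjoint (S \<circ> T) = cadjoint T \<circ> cadjoint S"
  by (rule cadjoint_eqI) (simp add: cadjoint[OF assms(1)] cadjoint[OF assms(2)])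

lemma cadjoint_id_op: "closed_csubspace H \<Longrightarrow> cadjoint (id_op H) = id_op H"
  by (rule cadjoint_eqI) (rule id_op_selfadjoint)

lemma bounded_ops_compose:
  assumes "S \<in> bounded_ops H" "T \<in> bounded_ops H"
  shows "S \<circ> T \<in> bounded_ops H"
proof -
  have "bounded_linear (S \<circ> T)"
    using bounded_linear_compose[OF bounded_opsD(1)[OF assms(1)] bounded_opsD(1)[OF assms(2)]]
    by (simp add: comp_def)
  then show ?thesis using assms by (auto simp: bounded_ops_def)
qed

lemma bounded_ops_add:
  assumes H: "closed_csubspace H" and "S \<in> bounded_ops H" "T \<in> bounded_ops H"
  shows "(\<lambda>x. S x + T x) \<in> bounded_ops H"
  using assms(2,3) closed_csubspaceD(2)[OF H]
  by (auto simp: bounded_ops_def scaleC_add_right image_subset_iff intro!: bounded_linear_add)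

lemma bounded_ops_scaleC:
  assumes H: "closed_csubspace H" and "T \<in> bounded_ops H"
  shows "(\<lambda>x. c *\<^sub>C T x) \<in> bounded_ops H"
  using assms(2) closed_csubspaceD(3)[OF H]
  by (auto simp: bounded_ops_def scaleC_scaleC mult.commute image_subset_iff
      intro!: bounded_linear_compose[OF bounded_linear_scaleC])

lemma bounded_ops_zero: "closed_csubspace H \<Longrightarrow> (\<lambda>x. 0) \<in> bounded_ops H"
  by (auto simp: bounded_ops_def closed_csubspaceD)

section \<open>Commutants\<close>

lemma commutantD:
  assumes "T \<in> commutant H M"
  shows "T \<in> bounded_ops H" "S \<in> M \<Longrightarrow> T (S x) = S (T x)"
  using assms by (auto simp: commutant_def fun_eq_iff)

lemma commutantI:
  assumes "T \<in> bounded_ops H" "\<And>S x. S \<in> M \<Longrightarrow> T (S x) = S (T x)"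
  shows "T \<in> commutant H M"
  using assms by (auto simp: commutant_def fun_eq_iff)

lemma commutant_antimono: "M \<subseteq> N \<Longrightarrow> commutant H N \<subseteq> commutant H M"
  by (auto simp: commutant_def)

lemma subset_double_commutant:
  assumes "M \<subseteq> bounded_ops H"
  shows "M \<subseteq> commutant H (commutant H M)"
  using assms by (auto simp: commutant_def)

lemma triple_commutant:
  assumes "M \<subseteq> bounded_ops H"
  shows "commutant H (commutant H (commutant H M)) = commutant H M"
  using commutant_antimono[OF subset_double_commutant[OF assms], of H]
    subset_double_commutant[of "commutant H M" H] commutantD(1) by blast

lemma commutant_algebra:
  assumes H: "closed_csubspace H" and M: "M \<subseteq> bounded_ops H"
  shows "id_op H \<in> commutant H M" "(\<lambda>x. 0) \<in> commutant H M"
    "S \<in> commutant H M \<Longrightarrow> T \<in> commutant H M \<Longrightarrow> (\<lambda>x. S x + T x) \<in> commutant H M"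
    "T \<in> commutant H M \<Longrightarrow> (\<lambda>x. c *\<^sub>C T x) \<in> commutant H M"
    "S \<in> commutant H M \<Longrightarrow> T \<in> commutant H M \<Longrightarrow> S \<circ> T \<in> commutant H M"
proof -
  have M': "S \<in> bounded_ops H" if "S \<in> M" for S using M that by blast
  show "id_op H \<in> commutant H M"
    by (rule commutantI[OF id_op(1)[OF H]]) (simp add: bounded_ops_id_op[OF H M'])
  show "(\<lambda>x. 0) \<in> commutant H M"
    by (rule commutantI) (use bounded_ops_zero[OF H] bounded_opsD[OF M'] in auto)
  show "(\<lambda>x. S x + T x) \<in> commutant H M" if "S \<in> commutant H M" "T \<in> commutant H M"
    by (rule commutantI)
      (use that bounded_ops_add[OF H] bounded_opsD(4)[OF M'] in \<open>auto simp: commutantD\<close>)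
  show "(\<lambda>x. c *\<^sub>C T x) \<in> commutant H M" if "T \<in> commutant H M"
    by (rule commutantI)
      (use that bounded_ops_scaleC[OF H] bounded_opsD(2)[OF M'] in \<open>auto simp: commutantD\<close>)
  show "S \<circ> T \<in> commutant H M" if "S \<in> commutant H M" "T \<in> commutant H M"
    by (rule commutantI)
      (use that in \<open>auto simp: commutantD(2) intro: bounded_ops_compose commutantD(1)\<close>)
qed

lemma commutant_cadjoint:
  assumes H: "closed_csubspace H" and M: "M \<subseteq> bounded_ops H" "cadjoint ` M \<subseteq> M"
    and T: "T \<in> commutant H M"
  shows "cadjoint T \<in> commutant H M"
proof (rule commutantI)
  note T' = commutantD(1)[OF T]
  show "cadjoint T \<in> bounded_ops H" by (rule cadjoint_bounded_ops[OF H T'])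
  fix S x assume S: "S \<in> M"
  then have S': "S \<in> bounded_ops H" "cadjoint S \<in> M" using M by auto
  show "cadjoint T (S x) = S (cadjoint T x)"
  proof (rule cinner_eqI)
    fix z
    have "cinner z (cadjoint T (S x)) = cinner (cadjoint S (T z)) x"
      by (simp add: cadjoint_right[OF T'] cadjoint[OF S'(1)])
    also have "\<dots> = cinner (T (cadjoint S z)) x"
      using commutantD(2)[OF T S'(2)] by simp
    also have "\<dots> = cinner z (S (cadjoint T x))"
      by (simp add: cadjoint_right[OF T', symmetric] cadjoint[OF S'(1)])
    finally show "cinner z (cadjoint T (S x)) = cinner z (S (cadjoint T x))" .
  qed
qed

section \<open>Von Neumann algebras\<close>

locale vN_algebra =
  fixes H :: "'h::complex_hilbert set" and M :: "('h \<Rightarrow> 'h) set"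
  assumes vN: "von_neumann_algebra H M"
begin

lemma H: "closed_csubspace H"
  using vN by (simp add: von_neumann_algebra_def)

lemma bounded: "T \<in> M \<Longrightarrow> T \<in> bounded_ops H"
  using vN by (auto simp: von_neumann_algebra_def)

lemma cadjoint_mem: "T \<in> M \<Longrightarrow> cadjoint T \<in> M"
  using vN by (auto simp: von_neumann_algebra_def)

lemma double_commutant: "commutant H (commutant H M) = M"
  using vN by (simp add: von_neumann_algebra_def)

lemma mem: "id_op H \<in> M" "(\<lambda>x. 0) \<in> M" "S \<in> M \<Longrightarrow> T \<in> M \<Longrightarrow> (\<lambda>x. S x + T x) \<in> M"
    "T \<in> M \<Longrightarrow> (\<lambda>x. c *\<^sub>C T x) \<in> M" "S \<in> M \<Longrightarrow> T \<in> M \<Longrightarrow> S \<circ> T \<in> M"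
proof -
  have "commutant H M \<subseteq> bounded_ops H" using commutantD(1) by blast
  note * = commutant_algebra[OF H this, unfolded double_commutant]
  show "id_op H \<in> M" "(\<lambda>x. 0) \<in> M" "S \<in> M \<Longrightarrow> T \<in> M \<Longrightarrow> (\<lambda>x. S x + T x) \<in> M"
    "T \<in> M \<Longrightarrow> (\<lambda>x. c *\<^sub>C T x) \<in> M" "S \<in> M \<Longrightarrow> T \<in> M \<Longrightarrow> S \<circ> T \<in> M"
    using * by auto
qed

lemma sum_mem: "(\<And>i. i \<in> A \<Longrightarrow> T i \<in> M) \<Longrightarrow> (\<lambda>x. \<Sum>i\<in>A. T i x) \<in> M"
  by (induction A rule: infinite_finite_induct) (auto intro: mem)

lemma commute: "t \<in> commutant H M \<Longrightarrow> T \<in> M \<Longrightarrow> t (T x) = T (t x)"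
  by (rule commutantD)

lemma memI:
  assumes "T \<in> bounded_ops H" "\<And>t x. t \<in> commutant H M \<Longrightarrow> T (t x) = t (T x)"
  shows "T \<in> M"
proof -
  have "T \<in> commutant H (commutant H M)" by (rule commutantI) (use assms in auto)
  then show ?thesis by (simp add: double_commutant)
qed

lemma commutant_cadjoint_mem: "t \<in> commutant H M \<Longrightarrow> cadjoint t \<in> commutant H M"
  by (rule commutant_cadjoint[OF H]) (use bounded cadjoint_mem in auto)

lemma exists_nonzero: "\<exists>x\<in>H. x \<noteq> 0"
proof (rule ccontr)
  assume *: "\<not> ?thesis"
  have "T = (\<lambda>x. 0)" if "T \<in> M" for T
    using bounded_opsD(3)[OF bounded[OF that]] * by blast
  then have "M = {\<lambda>x. 0}" using mem(2) by blast
  then show False using vN by (simp add: von_neumann_algebra_def)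
qed

end

lemma von_neumann_algebra_double_commutant:
  assumes H: "closed_csubspace H" and S: "S \<subseteq> bounded_ops H" "cadjoint ` S \<subseteq> S"
    and nz: "x \<in> H" "x \<noteq> 0"
  shows "von_neumann_algebra H (commutant H (commutant H S))"
proof -
  have sub: "commutant H S \<subseteq> bounded_ops H" for S :: "('a \<Rightarrow> 'a) set"
    using commutantD(1) by blast
  have "cadjoint ` commutant H S \<subseteq> commutant H S"
    using commutant_cadjoint[OF H S] by blast
  then have "cadjoint ` commutant H (commutant H S) \<subseteq> commutant H (commutant H S)"
    using commutant_cadjoint[OF H sub] by blast
  moreover have "id_op H x \<noteq> 0" using id_op(2)[OF H] nz by simp
  then have "commutant H (commutant H S) \<noteq> {\<lambda>_. 0}"
    using commutant_algebra(1)[OF H sub[of S]] by (metis singletonD)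
  ultimately show ?thesis
    unfolding von_neumann_algebra_def using H sub triple_commutant[OF sub] by simp
qed

text \<open>The double commutant of \<open>S\<close> together with its adjoints is a von Neumann
  algebra containing \<open>S\<close>, so it contains \<open>M\<close>. This is how minimality of a
  generated algebra is exploited.\<close>

lemma generates_commutant:
  assumes gen: "generates H S M"
    and t: "t \<in> bounded_ops H" "\<And>s x. s \<in> S \<Longrightarrow> t (s x) = s (t x)"
      "\<And>s x. s \<in> S \<Longrightarrow> t (cadjoint s x) = cadjoint s (t x)"
  shows "t \<in> commutant H M"
proof -
  interpret vN_algebra H M using gen by unfold_locales (simp add: generates_def)
  define S' where "S' = S \<union> cadjoint ` S"
  have SM: "S' \<subseteq> M" using gen cadjoint_mem by (auto simp: generates_def S'_def)
  then have S': "S' \<subseteq> bounded_ops H" using bounded by blast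
  have "cadjoint ` S' \<subseteq> S'"
  proof -
    have "cadjoint (cadjoint s) = s" if "s \<in> S" for s
      using cadjoint_cadjoint that S' by (auto simp: S'_def)
    then show ?thesis by (auto simp: S'_def)
  qed
  moreover obtain x where "x \<in> H" "x \<noteq> 0" using exists_nonzero by blast
  ultimately have "von_neumann_algebra H (commutant H (commutant H S'))"
    using von_neumann_algebra_double_commutant[OF H S'] by blast
  moreover have "S \<subseteq> commutant H (commutant H S')"
    using subset_double_commutant[OF S'] by (auto simp: S'_def)
  ultimately have "M \<subseteq> commutant H (commutant H S')"
    using gen by (simp add: generates_def)
  moreover have "t \<in> commutant H S'"
    by (rule commutantI) (use t in \<open>auto simp: S'_def\<close>)
  ultimately show ?thesis
    using commutantD(2)[of _ H "commutant H S'" t] t(1) by (intro commutantI) auto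
qed

section \<open>Weak compactness of balls\<close>

text \<open>On operators identified with their forms, the product topology is the weak operator topology.\<close>

definition op_form :: "('h::complex_hilbert \<Rightarrow> 'h) \<Rightarrow> 'h \<times> 'h \<Rightarrow> complex" where
  "op_form T = (\<lambda>(u, v). cinner u (T v))"

definition op_ball :: "real \<Rightarrow> ('h::complex_hilbert \<Rightarrow> 'h) set \<Rightarrow> ('h \<Rightarrow> 'h) set" where
  "op_ball r M = {T \<in> M. \<forall>v. norm (T v) \<le> r * norm v}"

lemma op_form_apply [simp]: "op_form T (u, v) = cinner u (T v)"
  by (simp add: op_form_def)

lemma compact_PiE_UNIV:
  fixes S :: "'i \<Rightarrow> 'a::topological_space set"
  assumes "\<And>i. compact (S i)"
  shows "compact (PiE UNIV S)"
proof -
  have "compactin (product_topology (\<lambda>i. euclidean) UNIV) (PiE UNIV S)"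
    unfolding compactin_PiE using assms by simp
  then show ?thesis by (simp add: euclidean_product_topology)
qed

text \<open>Each condition involves only finitely many coordinates of \<open>f\<close>, so the set
  is visibly closed in the product topology. The bound and sesquilinearity produce an operator, the
  two \<open>id_op\<close> conditions confine it to \<open>H\<close>, and the last one expresses
  commutation with the commutant, hence membership in \<open>M\<close>.\<close>

lemma (in vN_algebra) op_form_ball_eq:
  "op_form ` op_ball r M = {f.
     (\<forall>u v. cmod (f (u, v)) \<le> r * norm u * norm v) \<and>
     (\<forall>u u' v. f (u + u', v) = f (u, v) + f (u', v)) \<and>
     (\<forall>u v v'. f (u, v + v') = f (u, v) + f (u, v')) \<and>
     (\<forall>c u v. f (c *\<^sub>C u, v) = cnj c * f (u, v)) \<and>
     (\<forall>c u v. f (u, c *\<^sub>C v) = c * f (u, v)) \<and>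
     (\<forall>u v. f (id_op H u, v) = f (u, v)) \<and>
     (\<forall>u v. f (u, id_op H v) = f (u, v)) \<and>
     (\<forall>t u v. t \<in> commutant H M \<longrightarrow> f (cadjoint t u, v) = f (u, t v))}" (is "_ = ?R")
proof (intro equalityI subsetI)
  fix f assume "f \<in> op_form ` op_ball r M"
  then obtain T where T: "T \<in> M" "\<And>v. norm (T v) \<le> r * norm v" and f: "f = op_form T"
    by (auto simp: op_ball_def)
  note T' = bounded[OF T(1)]
  have "cmod (f (u, v)) \<le> r * norm u * norm v" for u v
    using cinner_Cauchy_Schwarz[of u "T v"] mult_left_mono[OF T(2)[of v], of "norm u"]
    by (simp add: f mult_ac)
  moreover have "f (cadjoint t u, v) = f (u, t v)" if "t \<in> commutant H M" for t u v
    using commute[OF that T(1)] cadjoint[OF commutantD(1)[OF that]] by (simp add: f)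
  ultimately show "f \<in> ?R"
    by (simp add: f cinner_add_left cinner_add_right cinner_scaleC_left cinner_scaleC_right
        bounded_opsD[OF T'] bounded_ops_id_op[OF H T'] id_op_selfadjoint[OF H])
next
  fix f assume f: "f \<in> ?R"
  have "\<exists>T\<in>bounded_ops UNIV. (\<forall>u v. f (u, v) = cinner u (T v)) \<and> (\<forall>v. norm (T v) \<le> r * norm v)"
    by (rule sesquilinear_form_representation) (use f in auto)
  then obtain T where T: "T \<in> bounded_ops UNIV" "\<And>u v. f (u, v) = cinner u (T v)"
    "\<And>v. norm (T v) \<le> r * norm v" by blast
  have id: "id_op H (T v) = T v" "T (id_op H v) = T v" for v
    by (rule cinner_eqI, use f in \<open>simp add: T(2) id_op_selfadjoint[OF H, symmetric]\<close>)+
  have "T \<in> bounded_ops H"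
  proof (rule bounded_opsI[OF bounded_opsD(4,2)[OF T(1)] T(3)])
    show "T x \<in> H" for x using id_op_in[OF H] id(1) by metis
    show "T x = 0" if "\<And>y. y \<in> H \<Longrightarrow> cinner y x = 0" for x
      using id(2)[of x] id_op_eqI[OF H closed_csubspaceD(1)[OF H], of x] that
      by (simp add: bounded_opsD(5)[OF T(1)])
  qed
  then have "T \<in> M"
  proof (rule memI)
    fix t x assume t: "t \<in> commutant H M"
    show "T (t x) = t (T x)"
      by (rule cinner_eqI) (use f t in \<open>simp add: T(2)[symmetric] cadjoint[OF commutantD(1)[OF t], symmetric]\<close>)
  qed
  then have "T \<in> op_ball r M" using T(3) by (simp add: op_ball_def)
  moreover have "f = op_form T" using T(2) by (auto simp: op_form_def)
  ultimately show "f \<in> op_form ` op_ball r M" by blast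
qed

lemma closed_Collect_imp_const:
  "(P \<Longrightarrow> closed {x. Q x}) \<Longrightarrow> closed {x. P \<longrightarrow> Q x}"
  by (cases P) auto

lemma (in vN_algebra) closed_op_ball: "closed (op_form ` op_ball r M)"
  unfolding op_form_ball_eq
  by (intro closed_Collect_conj closed_Collect_all closed_Collect_imp_const
      closed_Collect_eq closed_Collect_le continuous_intros continuous_on_product_coordinates)

text \<open>Tychonoff: the value at \<open>(u, v)\<close> stays in a disc of radius
  \<open>r * norm u * norm v\<close>.\<close>

lemma (in vN_algebra) compact_op_ball: "compact (op_form ` op_ball r M)"
proof -
  let ?K = "PiE UNIV (\<lambda>(u, v). cball (0::complex) (r * norm u * norm v)) :: ('h \<times> 'h \<Rightarrow> complex) set"
  have "compact ?K" by (rule compact_PiE_UNIV) auto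
  moreover note closed_op_ball
  moreover have "op_form ` op_ball r M \<subseteq> ?K"
    unfolding op_form_ball_eq by (auto simp: PiE_iff)
  ultimately show ?thesis by (metis compact_Int_closed inf.absorb2)
qed

section \<open>Closed complex spans\<close>

definition cspan :: "'h::complex_hilbert set \<Rightarrow> 'h set" where
  "cspan X = \<Inter>{K. closed_csubspace K \<and> X \<subseteq> K}"

lemma closed_csubspace_cspan: "closed_csubspace (cspan X)"
  unfolding cspan_def closed_csubspace_def by (auto intro!: closed_Inter)

lemma cspan_superset: "X \<subseteq> cspan X"
  by (auto simp: cspan_def)

lemma cspan_minimal: "closed_csubspace K \<Longrightarrow> X \<subseteq> K \<Longrightarrow> cspan X \<subseteq> K"
  by (auto simp: cspan_def)

lemma closed_csubspace_orthogonal: "closed_csubspace {x. cinner y x = 0}"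
proof -
  have "closed {x. cinner y x = 0}" by (intro closed_Collect_eq continuous_intros)
  then show ?thesis by (simp add: closed_csubspace_def cinner_add_right cinner_scaleC_right)
qed

lemma cspan_orthogonal: "(\<And>x. x \<in> X \<Longrightarrow> cinner y x = 0) \<Longrightarrow> x \<in> cspan X \<Longrightarrow> cinner y x = 0"
  using cspan_minimal[OF closed_csubspace_orthogonal[of y], of X] by blast

lemma closed_csubspace_equalizer:
  assumes S: "S \<in> bounded_ops H" and T: "T \<in> bounded_ops K"
  shows "closed_csubspace {x. S x = T x}"
proof -
  have "closed {x. S x = T x}"
    by (intro closed_Collect_eq linear_continuous_on bounded_opsD(1)[OF S] bounded_opsD(1)[OF T])
  then show ?thesis by (simp add: closed_csubspace_def bounded_opsD[OF S] bounded_opsD[OF T])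
qed

lemma cspan_agree:
  assumes "S \<in> bounded_ops H" "T \<in> bounded_ops K" "\<And>x. x \<in> X \<Longrightarrow> S x = T x" "x \<in> cspan X"
  shows "S x = T x"
  using cspan_minimal[OF closed_csubspace_equalizer[OF assms(1,2)], of X] assms(3,4) by blast

lemma cspan_invariant:
  assumes T: "T \<in> bounded_ops H" and inv: "\<And>x. x \<in> X \<Longrightarrow> T x \<in> cspan X" and x: "x \<in> cspan X"
  shows "T x \<in> cspan X"
proof -
  have "closed {x. T x \<in> cspan X}"
    using closed_vimage[OF closed_csubspaceD(4)[OF closed_csubspace_cspan]
        linear_continuous_on[OF bounded_opsD(1)[OF T]]] by (simp add: vimage_def)
  then have "closed_csubspace {x. T x \<in> cspan X}"
    using closed_csubspaceD[OF closed_csubspace_cspan[of X]]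
    by (simp add: closed_csubspace_def bounded_opsD[OF T])
  from cspan_minimal[OF this, of X] show ?thesis using inv x by blast
qed

text \<open>Moving \<open>T\<close> to the other side of the inner product keeps vectors of
  \<open>E\<close> in \<open>E\<close>, where the projection is invisible; this is where invariance
  under the adjoint enters.\<close>

lemma id_op_commute:
  assumes E: "closed_csubspace E" and T: "T \<in> bounded_ops H"
    and inv: "\<And>x. x \<in> E \<Longrightarrow> T x \<in> E" "\<And>x. x \<in> E \<Longrightarrow> cadjoint T x \<in> E"
  shows "T (id_op E x) = id_op E (T x)"
  by (rule id_op_eqI[OF E, symmetric])
    (simp_all add: inv id_op_in[OF E] cadjoint[OF T, symmetric] cinner_id_op[OF E])

section \<open>Orthogonal families\<close>

text \<open>Zorn's lemma, used for orthonormal bases and for orthogonal families of central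
  subspaces. \<open>R\<close> is not assumed symmetric, so a new element must be related in both
  directions; the guard \<open>x \<noteq> y\<close> lets \<open>R\<close> fail on the diagonal, as
  orthogonality does.\<close>

lemma maximal_pairwise:
  "\<exists>X\<subseteq>P. (\<forall>x\<in>X. \<forall>y\<in>X. x \<noteq> y \<longrightarrow> R x y) \<and>
     (\<forall>y\<in>P. (\<forall>x\<in>X. x \<noteq> y \<longrightarrow> R x y \<and> R y x) \<longrightarrow> y \<in> X)"
proof -
  define A where "A = {X. X \<subseteq> P \<and> (\<forall>x\<in>X. \<forall>y\<in>X. x \<noteq> y \<longrightarrow> R x y)}"
  have "\<exists>X\<in>A. \<forall>Y\<in>A. X \<subseteq> Y \<longrightarrow> Y = X"
  proof (rule subset_Zorn')
    fix C assume C: "subset.chain A C"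
    then have CA: "C \<subseteq> A" by (simp add: subset_chain_def)
    have "R x y" if xy: "x \<in> \<Union>C" "y \<in> \<Union>C" "x \<noteq> y" for x y
    proof -
      obtain U V where UV: "U \<in> C" "V \<in> C" "x \<in> U" "y \<in> V" using xy by blast
      then have "U \<subseteq> V \<or> V \<subseteq> U" using C by (auto simp: subset_chain_def)
      then obtain W where "W \<in> C" "x \<in> W" "y \<in> W" using UV by blast
      then show ?thesis using CA xy(3) by (auto simp: A_def)
    qed
    then show "\<Union>C \<in> A" using CA by (auto simp: A_def)
  qed
  then obtain X where X: "X \<in> A" "\<And>Y. Y \<in> A \<Longrightarrow> X \<subseteq> Y \<Longrightarrow> Y = X" by blast
  have "y \<in> X" if y: "y \<in> P" "\<forall>x\<in>X. x \<noteq> y \<longrightarrow> R x y \<and> R y x" for y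
  proof -
    have "insert y X \<in> A" using X(1) y by (auto simp: A_def)
    then show "y \<in> X" using X(2) by blast
  qed
  with X(1) show ?thesis by (intro exI[of _ X]) (auto simp: A_def)
qed

lemma hilbert_basis_exists:
  assumes H: "closed_csubspace H"
  obtains B where "hilbert_basis H B"
proof -
  obtain B where B: "B \<subseteq> {b\<in>H. norm b = 1}"
    "\<forall>x\<in>B. \<forall>y\<in>B. x \<noteq> y \<longrightarrow> cinner x y = 0"
    "\<forall>y\<in>{b\<in>H. norm b = 1}. (\<forall>x\<in>B. x \<noteq> y \<longrightarrow> cinner x y = 0 \<and> cinner y x = 0) \<longrightarrow> y \<in> B"
    using maximal_pairwise[of "{b\<in>H. norm b = 1}" "\<lambda>x y. cinner x y = 0"] by blast
  have "x = 0" if x: "x \<in> H" "\<And>b. b \<in> B \<Longrightarrow> cinner b x = 0" for x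
  proof (rule ccontr)
    assume "x \<noteq> 0"
    define y where "y = (1 / norm x) *\<^sub>R x"
    have y: "y \<in> H" "norm y = 1"
      using \<open>x \<noteq> 0\<close> closed_csubspaceD(6)[OF H x(1)] by (auto simp: y_def)
    have y': "y = complex_of_real (1 / norm x) *\<^sub>C x"
      unfolding y_def scaleC_of_real ..
    have by0: "cinner b y = 0" if "b \<in> B" for b
      using x(2)[OF that] by (simp add: y' cinner_scaleC_right)
    then have "cinner y b = 0" if "b \<in> B" for b
      using that by (metis cinner_commute complex_cnj_zero)
    with by0 have "y \<in> B" using B(3) y(1,2) by blast
    then have "cinner y y = 0" using by0 by blast
    then show False using y(2) by simp
  qed
  then have "hilbert_basis H B"
    unfolding hilbert_basis_def using B(1,2) by (auto simp: cinner_self)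
  then show thesis by (rule that)
qed

lemma norm_sum_orthogonal:
  fixes f :: "'i \<Rightarrow> 'h::complex_hilbert"
  assumes "finite I" "\<And>i j. i \<in> I \<Longrightarrow> j \<in> I \<Longrightarrow> i \<noteq> j \<Longrightarrow> cinner (f i) (f j) = 0"
  shows "(norm (sum f I))\<^sup>2 = (\<Sum>i\<in>I. (norm (f i))\<^sup>2)"
  by (rule norm_sum_Pythagorean)
    (use assms in \<open>auto simp: pairwise_def orthogonal_def inner_eq_Re_cinner\<close>)

text \<open>The condition on \<open>v\<close> says that \<open>f i\<close> is the projection of
  \<open>v\<close> onto the line through \<open>f i\<close>. This covers projections onto orthogonal
  subspaces as well as coefficients in an orthonormal set.\<close>

lemma Bessel_inequality:
  fixes f :: "'i \<Rightarrow> 'h::complex_hilbert"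
  assumes "finite I" and orth: "\<And>i j. i \<in> I \<Longrightarrow> j \<in> I \<Longrightarrow> i \<noteq> j \<Longrightarrow> cinner (f i) (f j) = 0"
    and v: "\<And>i. i \<in> I \<Longrightarrow> cinner v (f i) = cinner (f i) (f i)"
  shows "(\<Sum>i\<in>I. (norm (f i))\<^sup>2) \<le> (norm v)\<^sup>2"
proof -
  define w where "w = sum f I"
  have w: "(norm w)\<^sup>2 = (\<Sum>i\<in>I. (norm (f i))\<^sup>2)"
    unfolding w_def by (rule norm_sum_orthogonal) (use assms in auto)
  have "cinner v w = complex_of_real ((norm w)\<^sup>2)"
    unfolding w unfolding w_def cinner_sum_right by (simp add: v cinner_self)
  then have "(norm w)\<^sup>2 = cmod (cinner v w)"
    by (metis norm_of_real abs_of_nonneg zero_le_power2)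
  also have "\<dots> \<le> norm v * norm w" by (rule cinner_Cauchy_Schwarz)
  finally have "norm w \<le> norm v"
    by (cases "w = 0") (auto simp: power2_eq_square)
  then show ?thesis unfolding w[symmetric] by (intro power_mono) auto
qed

section \<open>Reduction by a central projection\<close>

text \<open>For a central projection z with range \<open>E\<close> this is z \<open>M\<close>.
  Composing on one side is enough because z commutes with \<open>M\<close>, and the result vanishes
  off \<open>E\<close> as operators on \<open>E\<close> must.\<close>

definition reduced_algebra :: "('h::complex_hilbert \<Rightarrow> 'h) set \<Rightarrow> 'h set \<Rightarrow> ('h \<Rightarrow> 'h) set" where
  "reduced_algebra M E = (\<lambda>T. T \<circ> id_op E) ` M"

text \<open>Central projections are handled through their ranges: invariance under \<open>M\<close>
  and under its commutant makes the projection onto \<open>E\<close> commute with both. The vector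
  \<open>x0\<close> witnesses that the reduced algebra is nonzero.\<close>

locale central_subspace = vN_algebra +
  fixes E x0
  assumes E: "closed_csubspace E" "E \<subseteq> H" "x0 \<in> E" "x0 \<noteq> 0"
    and invariant: "\<And>T x. T \<in> M \<Longrightarrow> x \<in> E \<Longrightarrow> T x \<in> E"
      "\<And>t x. t \<in> commutant H M \<Longrightarrow> x \<in> E \<Longrightarrow> t x \<in> E"
begin

lemma id_op_commute_M: "T \<in> M \<Longrightarrow> T (id_op E x) = id_op E (T x)"
  by (rule id_op_commute[OF E(1) bounded]) (auto intro: invariant cadjoint_mem)

lemma id_op_commute_commutant: "t \<in> commutant H M \<Longrightarrow> t (id_op E x) = id_op E (t x)"
  by (rule id_op_commute[OF E(1) commutantD(1)]) (auto intro: invariant commutant_cadjoint_mem)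

lemma id_op_bounded: "id_op E \<in> bounded_ops H"
  using bounded_ops_mono[OF E(2)] id_op(1)[OF E(1)] by blast

lemma id_op_mem: "id_op E \<in> M"
  by (rule memI[OF id_op_bounded]) (simp add: id_op_commute_commutant)

lemma reduced_subset: "reduced_algebra M E \<subseteq> M"
  using mem(5) id_op_mem by (auto simp: reduced_algebra_def)

lemma compose_id_op_bounded:
  assumes "T \<in> bounded_ops H" "\<And>x. x \<in> E \<Longrightarrow> T x \<in> E"
  shows "T \<circ> id_op E \<in> bounded_ops E"
proof -
  have "T \<circ> id_op E \<in> bounded_ops H" by (rule bounded_ops_compose[OF assms(1) id_op_bounded])
  moreover have "id_op E x = 0" if "\<forall>y\<in>E. cinner y x = 0" for x
    using bounded_ops_orthogonal[OF id_op(1)[OF E(1)]] that by blast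
  ultimately show ?thesis
    using assms(2) id_op_in[OF E(1)] bounded_opsD(5)[OF assms(1)]
    unfolding bounded_ops_def[of E] by (auto simp: bounded_ops_def[of H])
qed

lemma reduced_bounded: "reduced_algebra M E \<subseteq> bounded_ops E"
  using compose_id_op_bounded[OF bounded invariant(1)] by (auto simp: reduced_algebra_def)

lemma reduced_compose_id_op: "S \<in> reduced_algebra M E \<Longrightarrow> S (id_op E x) = S x"
  using bounded_ops_id_op(1)[OF E(1)] reduced_bounded by blast

lemma cadjoint_reduced: "T \<in> M \<Longrightarrow> cadjoint (T \<circ> id_op E) = cadjoint T \<circ> id_op E"
  by (subst cadjoint_compose[OF bounded id_op_bounded])
    (auto simp: cadjoint_id_op[OF E(1)] fun_eq_iff id_op_commute_M[OF cadjoint_mem])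

text \<open>Operators of the commutant of \<open>M\<close>, cut down to \<open>E\<close>, commute
  with the reduced algebra. An element of its double commutant therefore commutes with them, and
  since it lives on \<open>E\<close> it commutes with the whole commutant of \<open>M\<close>, which
  puts it in \<open>M\<close>.\<close>

lemma von_neumann_algebra_reduced: "von_neumann_algebra E (reduced_algebra M E)"
  unfolding von_neumann_algebra_def
proof (intro conjI)
  show "closed_csubspace E" by (rule E(1))
  show "reduced_algebra M E \<subseteq> bounded_ops E" by (rule reduced_bounded)
  show "cadjoint ` reduced_algebra M E \<subseteq> reduced_algebra M E"
    using cadjoint_reduced cadjoint_mem by (auto simp: reduced_algebra_def)
  have "id_op E \<circ> id_op E \<in> reduced_algebra M E"
    using id_op_mem by (auto simp: reduced_algebra_def)
  moreover have "(id_op E \<circ> id_op E) x0 \<noteq> 0" using E id_op(2)[OF E(1)] by simp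
  ultimately show "reduced_algebra M E \<noteq> {\<lambda>_. 0}" by (metis singletonD)
  show "commutant E (commutant E (reduced_algebra M E)) = reduced_algebra M E"
  proof
    show "reduced_algebra M E \<subseteq> commutant E (commutant E (reduced_algebra M E))"
      by (rule subset_double_commutant[OF reduced_bounded])
    show "commutant E (commutant E (reduced_algebra M E)) \<subseteq> reduced_algebra M E"
    proof
      fix T assume T: "T \<in> commutant E (commutant E (reduced_algebra M E))"
      note TE = commutantD(1)[OF T]
      have "T \<in> M"
      proof (rule memI)
        show "T \<in> bounded_ops H" using TE bounded_ops_mono[OF E(2)] by blast
        fix t x assume t: "t \<in> commutant H M"
        have "t \<circ> id_op E \<in> commutant E (reduced_algebra M E)"
        proof (rule commutantI)
          show "t \<circ> id_op E \<in> bounded_ops E"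
            by (rule compose_id_op_bounded[OF commutantD(1)[OF t] invariant(2)[OF t]])
          show "(t \<circ> id_op E) (S x) = S ((t \<circ> id_op E) x)" if S: "S \<in> reduced_algebra M E" for S x
          proof -
            have SM: "S \<in> M" using S reduced_subset by blast
            have "(t \<circ> id_op E) (S x) = t (S (id_op E x))" using id_op_commute_M[OF SM] by simp
            also have "\<dots> = S ((t \<circ> id_op E) x)" using commute[OF t SM] by simp
            finally show ?thesis .
          qed
        qed
        from commutantD(2)[OF T this] have *: "T (t (id_op E y)) = t (id_op E (T y))" for y by simp
        have "T (t x) = T (id_op E (t x))" by (simp add: bounded_ops_id_op[OF E(1) TE])
        also have "\<dots> = t (T x)"
          using * by (simp add: id_op_commute_commutant[OF t, symmetric] bounded_ops_id_op[OF E(1) TE])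
        finally show "T (t x) = t (T x)" .
      qed
      moreover have "T = T \<circ> id_op E" using bounded_ops_id_op(1)[OF E(1) TE] by auto
      ultimately show "T \<in> reduced_algebra M E" by (auto simp: reduced_algebra_def)
    qed
  qed
qed

end

section \<open>Cyclic subspaces\<close>

context vN_algebra
begin

definition cyclic :: "'h \<Rightarrow> 'h set" where
  "cyclic x = cspan {T x | T. T \<in> M}"

text \<open>The range of the central support of the projection onto \<open>cyclic x\<close>.\<close>

definition central_cyclic :: "'h \<Rightarrow> 'h set" where
  "central_cyclic x = cspan {T (t x) | T t. T \<in> M \<and> t \<in> commutant H M}"

lemma commutant_mem: "id_op H \<in> commutant H M"
    "s \<in> commutant H M \<Longrightarrow> t \<in> commutant H M \<Longrightarrow> s \<circ> t \<in> commutant H M"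
proof -
  have "M \<subseteq> bounded_ops H" using bounded by (rule subsetI)
  note * = commutant_algebra[OF H this]
  show "id_op H \<in> commutant H M" by (rule *(1))
  show "s \<in> commutant H M \<Longrightarrow> t \<in> commutant H M \<Longrightarrow> s \<circ> t \<in> commutant H M" by (rule *(5))
qed

lemma cyclic_invariant:
  assumes "T \<in> M" "y \<in> cyclic x"
  shows "T y \<in> cyclic x"
  unfolding cyclic_def
proof (rule cspan_invariant[OF bounded[OF assms(1)]])
  fix y assume "y \<in> {T x | T. T \<in> M}"
  then obtain S where "S \<in> M" "y = S x" by blast
  then have "T y = (T \<circ> S) x" "T \<circ> S \<in> M" using mem(5)[OF assms(1)] by auto
  then have "T y \<in> {T x | T. T \<in> M}" by blast
  then show "T y \<in> cspan {T x | T. T \<in> M}" by (rule subsetD[OF cspan_superset])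
qed (use assms(2) in \<open>simp add: cyclic_def\<close>)

lemma cyclic_mem: "x \<in> H \<Longrightarrow> x \<in> cyclic x"
  unfolding cyclic_def
proof (rule subsetD[OF cspan_superset])
  assume "x \<in> H"
  then have "x = id_op H x" using id_op(2)[OF H] by simp
  then show "x \<in> {T x | T. T \<in> M}" using mem(1) by blast
qed

lemma cyclic_subset: "x \<in> H \<Longrightarrow> cyclic x \<subseteq> central_cyclic x"
  unfolding cyclic_def central_cyclic_def
proof (rule cspan_minimal[OF closed_csubspace_cspan], rule subsetI)
  fix y assume x: "x \<in> H" and "y \<in> {T x | T. T \<in> M}"
  then obtain T where T: "T \<in> M" "y = T x" by blast
  then have "y = T (id_op H x)" using id_op(2)[OF H x] by simp
  then have "y \<in> {T (t x) | T t. T \<in> M \<and> t \<in> commutant H M}" using commutant_mem(1) T(1) by blast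
  then show "y \<in> cspan {T (t x) | T t. T \<in> M \<and> t \<in> commutant H M}"
    by (rule subsetD[OF cspan_superset])
qed

lemma central_cyclic_mem: "x \<in> H \<Longrightarrow> x \<in> central_cyclic x"
  by (rule subsetD[OF cyclic_subset cyclic_mem])

lemma central_subspace_cyclic:
  assumes "x \<in> H" "x \<noteq> 0"
  shows "central_subspace H M (central_cyclic x) x"
proof
  let ?G = "{T (t x) | T t. T \<in> M \<and> t \<in> commutant H M}"
  show "closed_csubspace (central_cyclic x)"
    unfolding central_cyclic_def by (rule closed_csubspace_cspan)
  show "central_cyclic x \<subseteq> H"
    unfolding central_cyclic_def
    by (rule cspan_minimal[OF H]) (auto intro: bounded_opsD(3)[OF bounded])
  show "x \<in> central_cyclic x" by (rule central_cyclic_mem[OF assms(1)])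
  show "x \<noteq> 0" by fact
  show "T y \<in> central_cyclic x" if "T \<in> M" "y \<in> central_cyclic x" for T y
    unfolding central_cyclic_def
  proof (rule cspan_invariant[OF bounded[OF that(1)]])
    fix y assume "y \<in> ?G"
    then obtain S s where S: "S \<in> M" "s \<in> commutant H M" "y = S (s x)" by blast
    then have "T y = (T \<circ> S) (s x)" "T \<circ> S \<in> M" using mem(5)[OF that(1)] by auto
    then have "T y \<in> ?G" using S(2) by blast
    then show "T y \<in> cspan ?G" by (rule subsetD[OF cspan_superset])
  qed (use that(2) in \<open>simp add: central_cyclic_def\<close>)
  show "t y \<in> central_cyclic x" if "t \<in> commutant H M" "y \<in> central_cyclic x" for t y
    unfolding central_cyclic_def
  proof (rule cspan_invariant[OF commutantD(1)[OF that(1)]])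
    fix y assume "y \<in> ?G"
    then obtain S s where S: "S \<in> M" "s \<in> commutant H M" "y = S (s x)" by blast
    then have "t y = S ((t \<circ> s) x)" "t \<circ> s \<in> commutant H M"
      using commutant_mem(2)[OF that(1) S(2)] commute[OF that(1) S(1)] by auto
    then have "t y \<in> ?G" using S(1) by blast
    then show "t y \<in> cspan ?G" by (rule subsetD[OF cspan_superset])
  qed (use that(2) in \<open>simp add: central_cyclic_def\<close>)
qed

text \<open>Let \<open>y\<close> be orthogonal to all subspaces of a maximal family. Moving
  \<open>T\<close> and \<open>t\<close> across the inner product keeps the other vector in its
  invariant subspace, so all of \<open>central_cyclic y\<close> is orthogonal to the family. A
  nonzero \<open>y\<close> would then belong to the family and be orthogonal to itself.\<close>

lemma central_decomposition:
  "\<exists>X\<subseteq>H - {0}.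
    (\<forall>x\<in>X. \<forall>y\<in>X. x \<noteq> y \<longrightarrow> (\<forall>u\<in>central_cyclic x. \<forall>v\<in>central_cyclic y. cinner u v = 0)) \<and>
    (\<forall>y\<in>H. (\<forall>x\<in>X. \<forall>u\<in>central_cyclic x. cinner u y = 0) \<longrightarrow> y = 0)"
proof -
  define R where "R x y \<longleftrightarrow> (\<forall>u\<in>central_cyclic x. \<forall>v\<in>central_cyclic y. cinner u v = 0)" for x y
  obtain X where X: "X \<subseteq> H - {0}" "\<forall>x\<in>X. \<forall>y\<in>X. x \<noteq> y \<longrightarrow> R x y"
    "\<forall>y\<in>H - {0}. (\<forall>x\<in>X. x \<noteq> y \<longrightarrow> R x y \<and> R y x) \<longrightarrow> y \<in> X"
    using maximal_pairwise[of "H - {0}" R] by (elim exE conjE) (rule that)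
  have total: "y = 0" if y: "y \<in> H" "\<And>x u. x \<in> X \<Longrightarrow> u \<in> central_cyclic x \<Longrightarrow> cinner u y = 0" for y
  proof (rule ccontr)
    assume "y \<noteq> 0"
    have R: "cinner u v = 0" if x: "x \<in> X" and u: "u \<in> central_cyclic x" and v: "v \<in> central_cyclic y"
      for x u v
    proof (rule cspan_orthogonal[OF _ v[unfolded central_cyclic_def]])
      interpret central_subspace H M "central_cyclic x" x
        by (rule central_subspace_cyclic) (use x X(1) in auto)
      fix w assume "w \<in> {T (t y) | T t. T \<in> M \<and> t \<in> commutant H M}"
      then obtain T t where Tt: "T \<in> M" "t \<in> commutant H M" and w: "w = T (t y)" by blast
      have "cinner u w = cinner (cadjoint t (cadjoint T u)) y"
        by (simp add: w cadjoint[OF bounded[OF Tt(1)]] cadjoint[OF commutantD(1)[OF Tt(2)]])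
      also have "\<dots> = 0"
        by (rule y(2)[OF x invariant(2)[OF commutant_cadjoint_mem[OF Tt(2)]
              invariant(1)[OF cadjoint_mem[OF Tt(1)] u]]])
      finally show "cinner u w = 0" .
    qed
    have "cinner v u = 0" if "x \<in> X" "u \<in> central_cyclic x" "v \<in> central_cyclic y" for x u v
      using R[OF that] cinner_commute[of v u] by simp
    with R have "R x y \<and> R y x" if "x \<in> X" for x
      unfolding R_def using that by blast
    then have "y \<in> X" using X(3) y(1) \<open>y \<noteq> 0\<close> by auto
    then have "cinner y y = 0" by (rule y(2)) (rule central_cyclic_mem[OF y(1)])
    then show False using \<open>y \<noteq> 0\<close> by simp
  qed
  show ?thesis
  proof (intro exI[of _ X] conjI ballI impI)
    show "y = 0" if "y \<in> H" "\<forall>x\<in>X. \<forall>u\<in>central_cyclic x. cinner u y = 0" for y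
      by (rule total) (use that in auto)
  qed (use X(1,2) in \<open>auto simp: R_def\<close>)
qed

end

section \<open>Normal representations on cyclic subspaces\<close>

lemma topspace_ultraweak:
  assumes "closed_csubspace H"
  shows "topspace (ultraweak_topology H) = bounded_ops H"
proof -
  have "\<exists>\<xi> \<eta> U. bounded_ops H = {T \<in> bounded_ops H. (\<Sum>n. cinner (\<xi> n) (T (\<eta> n))) \<in> U} \<and>
      range \<xi> \<subseteq> H \<and> range \<eta> \<subseteq> H \<and>
      summable (\<lambda>n::nat. (norm (\<xi> n))\<^sup>2) \<and> summable (\<lambda>n::nat. (norm (\<eta> n))\<^sup>2) \<and> open U"
    using closed_csubspaceD(1)[OF assms]
    by (intro exI[of _ "\<lambda>_. 0"] exI[of _ UNIV]) auto
  then show ?thesis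
    unfolding ultraweak_topology_def topology_generated_by_topspace by blast
qed

lemma openin_ultraweak:
  assumes "range \<xi> \<subseteq> H" "range \<eta> \<subseteq> H" "open U"
    "summable (\<lambda>n::nat. (norm (\<xi> n))\<^sup>2)" "summable (\<lambda>n::nat. (norm (\<eta> n))\<^sup>2)"
  shows "openin (ultraweak_topology H) {T \<in> bounded_ops H. (\<Sum>n. cinner (\<xi> n) (T (\<eta> n))) \<in> U}"
  unfolding ultraweak_topology_def by (rule topology_generated_by_Basis) (use assms in blast)

lemma continuous_map_ultraweakI:
  assumes "f ` topspace X \<subseteq> bounded_ops K" and K: "closed_csubspace K"
    and "\<And>\<xi> \<eta> U. range \<xi> \<subseteq> K \<Longrightarrow> range \<eta> \<subseteq> K \<Longrightarrow> open U \<Longrightarrow>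
      summable (\<lambda>n::nat. (norm (\<xi> n))\<^sup>2) \<Longrightarrow> summable (\<lambda>n::nat. (norm (\<eta> n))\<^sup>2) \<Longrightarrow>
      openin X {x \<in> topspace X. (\<Sum>n. cinner (\<xi> n) (f x (\<eta> n))) \<in> U}"
  shows "continuous_map X (ultraweak_topology K) f"
  unfolding ultraweak_topology_def
proof (rule continuous_on_generated_topo, goal_cases)
  case (1 V)
  then obtain \<xi> \<eta> U where V: "V = {T \<in> bounded_ops K. (\<Sum>n. cinner (\<xi> n) (T (\<eta> n))) \<in> U}"
    and *: "range \<xi> \<subseteq> K" "range \<eta> \<subseteq> K" "open U"
      "summable (\<lambda>n::nat. (norm (\<xi> n))\<^sup>2)" "summable (\<lambda>n::nat. (norm (\<eta> n))\<^sup>2)" by auto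
  have "f -` V \<inter> topspace X = {x \<in> topspace X. (\<Sum>n. cinner (\<xi> n) (f x (\<eta> n))) \<in> U}"
    using assms(1) by (auto simp: V)
  then show ?case using assms(3)[OF *] by simp
next
  case 2
  then show ?case
    using assms(1) topspace_ultraweak[OF K]
    unfolding ultraweak_topology_def topology_generated_by_topspace by simp
qed

text \<open>Square-summable sequences in \<open>K\<close> are such sequences in \<open>H\<close>,
  and \<open>f T\<close> agrees with \<open>T\<close> on them, so preimages of subbasic sets are
  traces of subbasic sets.\<close>

lemma ultraweak_subtopology_continuousI:
  assumes M: "M \<subseteq> bounded_ops H" and H: "closed_csubspace H"
    and K: "closed_csubspace K" "K \<subseteq> H" and f: "f ` M \<subseteq> bounded_ops K"
    and agree: "\<And>T v. T \<in> M \<Longrightarrow> v \<in> K \<Longrightarrow> f T v = T v"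
  shows "continuous_map (subtopology (ultraweak_topology H) M) (ultraweak_topology K) f"
proof (rule continuous_map_ultraweakI[OF _ K(1)])
  have top: "topspace (subtopology (ultraweak_topology H) M) = M"
    using M by (auto simp: topspace_ultraweak[OF H])
  then show "f ` topspace (subtopology (ultraweak_topology H) M) \<subseteq> bounded_ops K"
    using f by simp
  fix \<xi> \<eta> :: "nat \<Rightarrow> 'a" and U :: "complex set"
  assume *: "range \<xi> \<subseteq> K" "range \<eta> \<subseteq> K" "open U"
    "summable (\<lambda>n. (norm (\<xi> n))\<^sup>2)" "summable (\<lambda>n. (norm (\<eta> n))\<^sup>2)"
  have "f T (\<eta> n) = T (\<eta> n)" if "T \<in> M" for T n
    by (rule agree[OF that]) (use *(2) in blast)
  then have "{T \<in> M. (\<Sum>n. cinner (\<xi> n) (f T (\<eta> n))) \<in> U}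
      = {T \<in> bounded_ops H. (\<Sum>n. cinner (\<xi> n) (T (\<eta> n))) \<in> U} \<inter> M"
    using M by auto
  moreover have "openin (ultraweak_topology H) {T \<in> bounded_ops H. (\<Sum>n. cinner (\<xi> n) (T (\<eta> n))) \<in> U}"
    by (rule openin_ultraweak) (use * K(2) in auto)
  ultimately show "openin (subtopology (ultraweak_topology H) M)
      {T \<in> topspace (subtopology (ultraweak_topology H) M). (\<Sum>n. cinner (\<xi> n) (f T (\<eta> n))) \<in> U}"
    unfolding top openin_subtopology by blast
qed

lemma op_algebra_simps [simp]:
  "carrier (op_algebra H M) = M" "mult (op_algebra H M) = (\<circ>)" "one (op_algebra H M) = id_op H"
  "add (op_algebra H M) = (\<lambda>S T x. S x + T x)" "smult (op_algebra H M) = (\<lambda>c T x. c *\<^sub>C T x)"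
  "star (op_algebra H M) = cadjoint"
  by (simp_all add: op_algebra_def)

lemma (in vN_algebra) faithful_normal_rep_id: "faithful_normal_rep H M H (\<lambda>T. T)"
  unfolding faithful_normal_rep_def
proof (intro conjI)
  show "(\<lambda>T. T) \<in> star_hom (op_algebra H M) (op_algebra H (bounded_ops H))"
    by (auto simp: star_hom_def ring_hom_def bounded)
  show "continuous_map (subtopology (ultraweak_topology H) M) (ultraweak_topology H) (\<lambda>T. T)"
    by (rule ultraweak_subtopology_continuousI) (use H bounded in auto)
qed (simp add: inj_on_def)

text \<open>The representation restricts operators to an invariant subspace. It is faithful because
  operators of \<open>M\<close> that agree on \<open>cyclic x\<close> also agree on its images under
  the commutant, and these span \<open>central_cyclic x\<close>.\<close>

lemma (in vN_algebra) faithful_normal_rep_cyclic: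
  assumes x: "x \<in> H" "x \<noteq> 0"
  shows "faithful_normal_rep (central_cyclic x) (reduced_algebra M (central_cyclic x)) (cyclic x)
    (\<lambda>T. T \<circ> id_op (cyclic x))"
proof -
  define E where "E = central_cyclic x"
  define L where "L = cyclic x"
  interpret central_subspace H M E x
    unfolding E_def by (rule central_subspace_cyclic[OF x])
  have L: "closed_csubspace L" "L \<subseteq> E"
    unfolding L_def E_def cyclic_def using closed_csubspace_cspan cyclic_subset[OF x(1)]
    by (auto simp: cyclic_def)
  have NM: "T \<in> M" if "T \<in> reduced_algebra M E" for T using that reduced_subset by blast
  have inv: "T v \<in> L" if "T \<in> M" "v \<in> L" for T v
    using that cyclic_invariant by (simp add: L_def)
  have comm: "T (id_op L v) = id_op L (T v)" if "T \<in> M" for T v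
    by (rule id_op_commute[OF L(1) bounded[OF that]]) (use inv cadjoint_mem that in auto)
  have LH: "L \<subseteq> H" using L(2) E(2) by blast
  have idL: "id_op L \<in> bounded_ops H"
    using bounded_ops_mono[OF LH] id_op(1)[OF L(1)] by blast
  have bd: "T \<circ> id_op L \<in> bounded_ops L" if "T \<in> M" for T
  proof -
    have "T \<circ> id_op L \<in> bounded_ops H" by (rule bounded_ops_compose[OF bounded[OF that] idL])
    moreover have "id_op L x = 0" if "\<forall>y\<in>L. cinner y x = 0" for x
      using bounded_ops_orthogonal[OF id_op(1)[OF L(1)]] that by blast
    ultimately show ?thesis
      using inv[OF that] id_op_in[OF L(1)] bounded_opsD(5)[OF bounded[OF that]]
      unfolding bounded_ops_def[of L] by (auto simp: bounded_ops_def[of H])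
  qed
  have "faithful_normal_rep E (reduced_algebra M E) L (\<lambda>T. T \<circ> id_op L)"
    unfolding faithful_normal_rep_def
  proof (intro conjI)
    have star: "cadjoint (T \<circ> id_op L) = cadjoint T \<circ> id_op L" if "T \<in> M" for T
      unfolding cadjoint_compose[OF bounded[OF that] idL]
      by (auto simp: cadjoint_id_op[OF L(1)] comm[OF cadjoint_mem[OF that]])
    have mult: "id_op L (T (id_op L v)) = T (id_op L v)" if "T \<in> M" for T v
      by (simp add: comm[OF that, symmetric] id_op(2)[OF L(1) id_op_in[OF L(1)]])
    have one: "id_op E (id_op L v) = id_op L v" for v
      using id_op(2)[OF E(1)] id_op_in[OF L(1)] L(2) by auto
    show "(\<lambda>T. T \<circ> id_op L) \<in> star_hom (op_algebra E (reduced_algebra M E)) (op_algebra L (bounded_ops L))"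
      unfolding star_hom_def ring_hom_def
      by (auto simp: fun_eq_iff bd[OF NM] star[OF NM] mult[OF NM] one)
    show "inj_on (\<lambda>T. T \<circ> id_op L) (reduced_algebra M E)"
    proof (rule inj_onI)
      fix S T assume ST: "S \<in> reduced_algebra M E" "T \<in> reduced_algebra M E"
        and eq: "S \<circ> id_op L = T \<circ> id_op L"
      note ST' = NM[OF ST(1)] NM[OF ST(2)]
      have agree: "S v = T v" if "v \<in> L" for v
        using fun_cong[OF eq, of v] id_op(2)[OF L(1) that] by simp
      have "S v = T v" if v: "v \<in> E" for v
      proof (rule cspan_agree[OF bounded[OF ST'(1)] bounded[OF ST'(2)] _ v[unfolded E_def central_cyclic_def]])
        fix w assume "w \<in> {T (t x) | T t. T \<in> M \<and> t \<in> commutant H M}"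
        then obtain A t where A: "A \<in> M" "t \<in> commutant H M" "w = A (t x)" by blast
        then have w: "w = t (A x)" using commute by simp
        have "A x \<in> L" using inv[OF A(1)] cyclic_mem[OF x(1)] by (simp add: L_def)
        then have "S (A x) = T (A x)" by (rule agree)
        then show "S w = T w"
          by (simp add: w commute[OF A(2) ST'(1), symmetric] commute[OF A(2) ST'(2), symmetric])
      qed
      then show "S = T"
        using reduced_compose_id_op[OF ST(1)] reduced_compose_id_op[OF ST(2)] id_op_in[OF E(1)]
        by (metis ext)
    qed
    show "continuous_map (subtopology (ultraweak_topology E) (reduced_algebra M E)) (ultraweak_topology L)
        (\<lambda>T. T \<circ> id_op L)"
      by (rule ultraweak_subtopology_continuousI[OF reduced_bounded E(1) L])
        (use bd NM id_op(2)[OF L(1)] in auto)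
  qed
  then show ?thesis by (simp add: E_def L_def)
qed

section \<open>Cardinality of orthonormal bases\<close>

text \<open>By Bessel the squared coefficients of \<open>d\<close> are summable, and a summable
  family has countable support.\<close>

lemma countable_nonorthogonal:
  fixes B :: "'h::complex_hilbert set"
  assumes B: "\<forall>b\<in>B. \<forall>b'\<in>B. cinner b b' = (if b = b' then 1 else 0)"
  shows "countable {b\<in>B. cinner b d \<noteq> 0}"
proof -
  have "(\<Sum>b\<in>F. (cmod (cinner b d))\<^sup>2) \<le> (norm d)\<^sup>2" if F: "finite F" "F \<subseteq> B" for F
  proof -
    have B1: "cinner b b = 1" if "b \<in> F" for b using B F that by auto
    then have n1: "norm b = 1" if "b \<in> F" for b
      using that cinner_self[of b] by (metis norm_eq_1 inner_eq_Re_cinner one_complex.sel(1))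
    have "(\<Sum>b\<in>F. (norm (cinner b d *\<^sub>C b))\<^sup>2) \<le> (norm d)\<^sup>2"
    proof (rule Bessel_inequality[OF F(1)])
      show "cinner (cinner b d *\<^sub>C b) (cinner b' d *\<^sub>C b') = 0" if "b \<in> F" "b' \<in> F" "b \<noteq> b'" for b b'
      proof -
        have "cinner b b' = 0" using that B F by (auto simp: subset_iff)
        then show ?thesis by (simp add: cinner_scaleC_left cinner_scaleC_right)
      qed
      show "cinner d (cinner b d *\<^sub>C b) = cinner (cinner b d *\<^sub>C b) (cinner b d *\<^sub>C b)" if "b \<in> F" for b
        using B1[OF that] cinner_commute[of d b]
        by (simp add: cinner_scaleC_left cinner_scaleC_right)
    qed
    then show ?thesis using n1 by (simp add: norm_scaleC)
  qed
  then have "(\<lambda>b. (cmod (cinner b d))\<^sup>2) summable_on B"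
    by (intro nonneg_bdd_above_summable_on bdd_aboveI[of _ "(norm d)\<^sup>2"]) auto
  from summable_countable_real[OF this] show ?thesis by simp
qed

lemma countable_card_le:
  assumes "countable A" "Cinfinite r"
  shows "|A| \<le>o r"
proof -
  obtain f :: "'a \<Rightarrow> nat" where "inj_on f A" using countableE[OF assms(1)] by blast
  then have "|A| \<le>o |UNIV :: nat set|"
    unfolding card_of_ordLeq[symmetric] by blast
  also have "|UNIV :: nat set| =o natLeq" by (rule card_of_nat)
  also have "natLeq \<le>o r" by (rule natLeq_ordLeq_cinfinite[OF assms(2)])
  finally show ?thesis .
qed

text \<open>Every \<open>b\<close> is non-orthogonal to some \<open>d\<close>, as it would otherwise
  be orthogonal to itself, and each \<open>d\<close> accounts for only countably many
  \<open>b\<close>.\<close>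

lemma card_orthonormal_le:
  fixes B D :: "'h::complex_hilbert set"
  assumes B: "\<forall>b\<in>B. \<forall>b'\<in>B. cinner b b' = (if b = b' then 1 else 0)" "B \<subseteq> cspan D"
    and r: "Cinfinite r" "|D| \<le>o r"
  shows "|B| \<le>o r"
proof -
  have "B \<subseteq> (\<Union>d\<in>D. {b\<in>B. cinner b d \<noteq> 0})"
  proof
    fix b assume b: "b \<in> B"
    show "b \<in> (\<Union>d\<in>D. {b\<in>B. cinner b d \<noteq> 0})"
    proof (rule ccontr)
      assume "\<not> ?thesis"
      then have "cinner b d = 0" if "d \<in> D" for d using that b by blast
      then have "cinner b b = 0" using cspan_orthogonal[of D b b] b B(2) by blast
      then show False using B(1) b by auto
    qed
  qed
  then have "|B| \<le>o |\<Union>d\<in>D. {b\<in>B. cinner b d \<noteq> 0}|" by (rule card_of_mono1)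
  also have "|\<Union>d\<in>D. {b\<in>B. cinner b d \<noteq> 0}| \<le>o r"
    using countable_card_le[OF countable_nonorthogonal[OF B(1)] r(1)]
    by (intro UNION_Cinfinite_bound r) auto
  finally show ?thesis .
qed

lemma card_lists_le:
  assumes r: "Cinfinite r" "|A| \<le>o r"
  shows "|lists A| \<le>o r"
proof -
  have "|{w \<in> lists A. length w = n}| \<le>o r" for n
  proof (induction n)
    case 0
    have "countable {w \<in> lists A. length w = 0}"
      by (rule countable_subset[of _ "{[]}"]) auto
    then show ?case by (rule countable_card_le[OF _ r(1)])
  next
    case (Suc n)
    have "{w \<in> lists A. length w = Suc n} \<subseteq> (\<lambda>(a, w). a # w) ` (A \<times> {w \<in> lists A. length w = n})"
      by (auto simp: length_Suc_conv image_iff)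
    then have "|{w \<in> lists A. length w = Suc n}| \<le>o |A \<times> {w \<in> lists A. length w = n}|"
      by (rule ordLeq_transitive[OF card_of_mono1 card_of_image])
    also have "|A \<times> {w \<in> lists A. length w = n}| \<le>o r"
      using r Suc by (intro card_of_Times_ordLeq_infinite_Field) (auto simp: cinfinite_def)
    finally show ?case .
  qed
  then have "|\<Union>n\<in>UNIV. {w \<in> lists A. length w = n}| \<le>o r"
    using countable_card_le[of "UNIV :: nat set", OF _ r(1)] by (intro UNION_Cinfinite_bound r) auto
  moreover have "lists A = (\<Union>n\<in>UNIV. {w \<in> lists A. length w = n})" by auto
  ultimately show ?thesis by simp
qed

text \<open>The closed span of the words is invariant under the generators and their adjoints, so
  its projection commutes with \<open>M\<close>. The projection fixes \<open>x\<close>, the empty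
  word, and hence fixes \<open>T x\<close> for every \<open>T\<close> in \<open>M\<close>.\<close>

lemma (in vN_algebra) cyclic_subset_cspan_words:
  assumes gen: "generates H S M" and x: "x \<in> H"
  shows "cyclic x \<subseteq> cspan ((\<lambda>w. foldr (\<lambda>s v. s v) w x) ` lists (S \<union> cadjoint ` S))" (is "_ \<subseteq> cspan ?D")
proof -
  let ?S = "S \<union> cadjoint ` S"
  have S: "s \<in> M" if "s \<in> ?S" for s
    using that gen cadjoint_mem by (auto simp: generates_def)
  have DH: "?D \<subseteq> H"
  proof
    fix y assume "y \<in> ?D"
    then obtain w where w: "w \<in> lists ?S" "y = foldr (\<lambda>s v. s v) w x" by blast
    from w(1) have "foldr (\<lambda>s v. s v) w x \<in> H"
      by (induction w) (use x bounded_opsD(3)[OF bounded[OF S]] in auto)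
    then show "y \<in> H" by (simp add: w(2))
  qed
  have closed: "closed_csubspace (cspan ?D)" by (rule closed_csubspace_cspan)
  have inv: "s v \<in> cspan ?D" if s: "s \<in> ?S" and v: "v \<in> cspan ?D" for s v
  proof (rule cspan_invariant[OF bounded[OF S[OF s]] _ v])
    fix y assume "y \<in> ?D"
    then obtain w where "w \<in> lists ?S" "y = foldr (\<lambda>s v. s v) w x" by blast
    then have "s # w \<in> lists ?S" "s y = foldr (\<lambda>s v. s v) (s # w) x" using s by auto
    then have "s y \<in> ?D" by blast
    then show "s y \<in> cspan ?D" by (rule subsetD[OF cspan_superset])
  qed
  have ss: "cadjoint s \<in> ?S" if "s \<in> ?S" for s
    using that gen cadjoint_cadjoint[OF bounded] by (auto simp: generates_def)
  have p: "id_op (cspan ?D) \<in> bounded_ops H"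
    using id_op(1)[OF closed] bounded_ops_mono[OF cspan_minimal[OF H DH]] by blast
  have comm: "id_op (cspan ?D) (s v) = s (id_op (cspan ?D) v)" if "s \<in> ?S" for s v
    by (rule id_op_commute[OF closed bounded[OF S[OF that]], symmetric]) (use inv ss that in auto)
  have pc: "id_op (cspan ?D) \<in> commutant H M"
    by (rule generates_commutant[OF gen p]) (use comm in auto)
  have "x \<in> ?D" by (rule image_eqI[of _ _ "[]"]) auto
  then have x: "id_op (cspan ?D) x = x"
    using id_op(2)[OF closed] cspan_superset[of ?D] by blast
  have "T x \<in> cspan ?D" if "T \<in> M" for T
    using commute[OF pc that, of x] x id_op_in[OF closed, of "T x"] by simp
  then show ?thesis
    unfolding cyclic_def by (intro cspan_minimal[OF closed]) blast
qed

lemma (in vN_algebra) card_basis_cyclic: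
  assumes gen: "generates H S M" and x: "x \<in> H" and r: "Cinfinite r" "|S| \<le>o r"
    and B: "hilbert_basis (cyclic x) B"
  shows "|B| \<le>o r"
proof (rule card_orthonormal_le[OF _ _ r(1)])
  show "\<forall>b\<in>B. \<forall>b'\<in>B. cinner b b' = (if b = b' then 1 else 0)"
    using B by (simp add: hilbert_basis_def)
  show "B \<subseteq> cspan ((\<lambda>w. foldr (\<lambda>s v. s v) w x) ` lists (S \<union> cadjoint ` S))"
    using B cyclic_subset_cspan_words[OF gen x] by (auto simp: hilbert_basis_def)
  have "|cadjoint ` S| \<le>o r" by (rule ordLeq_transitive[OF card_of_image r(2)])
  then have "|lists (S \<union> cadjoint ` S)| \<le>o r"
    by (intro card_lists_le Un_Cinfinite_bound r)
  then show "|(\<lambda>w. foldr (\<lambda>s v. s v) w x) ` lists (S \<union> cadjoint ` S)| \<le>o r"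
    by (rule ordLeq_transitive[OF card_of_image])
qed

section \<open>The direct sum decomposition\<close>

text \<open>Totality of \<open>U\<close> is given by orthogonality, not by density of a span. It is
  therefore applied to the adjoint of the difference, whose range is orthogonal to
  \<open>U\<close>.\<close>

lemma bounded_ops_eqI:
  assumes H: "closed_csubspace H" and S: "S \<in> bounded_ops H" and T: "T \<in> bounded_ops H"
    and total: "\<And>y. y \<in> H \<Longrightarrow> (\<And>u. u \<in> U \<Longrightarrow> cinner u y = 0) \<Longrightarrow> y = 0"
    and agree: "\<And>u. u \<in> U \<Longrightarrow> S u = T u"
  shows "S = T"
proof -
  define D where "D = (\<lambda>v. S v + (-1) *\<^sub>C T v)"
  have D: "D \<in> bounded_ops H"
    unfolding D_def by (intro bounded_ops_add bounded_ops_scaleC H S T)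
  have "cadjoint D v = 0" for v
  proof (rule total)
    show "cadjoint D v \<in> H" by (rule bounded_opsD(3)[OF cadjoint_bounded_ops[OF H D]])
    show "cinner u (cadjoint D v) = 0" if "u \<in> U" for u
      using agree[OF that] by (simp add: cadjoint_right[OF D]) (simp add: D_def)
  qed
  then have "cinner v (D w) = 0" for v w
    by (simp add: cadjoint[OF D, symmetric])
  then have "D w = 0" for w using cinner_self_eq_zero by blast
  then show "S = T" by (auto simp: D_def fun_eq_iff)
qed

text \<open>The operator assembled from a bounded family is a weak limit point of the finite partial sums.\<close>

lemma (in vN_algebra) decomposition_surjective:
  assumes E: "\<And>x. x \<in> X \<Longrightarrow> central_subspace H M (E x) (e x)"
    and orth: "\<And>x y u v. x \<in> X \<Longrightarrow> y \<in> X \<Longrightarrow> x \<noteq> y \<Longrightarrow> u \<in> E x \<Longrightarrow> v \<in> E y \<Longrightarrow> cinner u v = 0"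
    and S: "\<And>x. x \<in> X \<Longrightarrow> S x \<in> reduced_algebra M (E x)"
    and C: "C \<ge> 0" "\<And>x v. x \<in> X \<Longrightarrow> norm (S x v) \<le> C * norm v"
  shows "\<exists>T\<in>op_ball C M. \<forall>x\<in>X. T \<circ> id_op (E x) = S x"
proof -
  have Ec: "closed_csubspace (E x)" if "x \<in> X" for x
    using central_subspace.E(1)[OF E[OF that]] .
  have Sz: "S x (id_op (E x) v) = S x v" "S x v \<in> E x" "S x \<in> M" if "x \<in> X" for x v
  proof -
    interpret central_subspace H M "E x" "e x" by (rule E[OF that])
    show "S x (id_op (E x) v) = S x v" by (rule reduced_compose_id_op[OF S[OF that]])
    show "S x v \<in> E x" using S[OF that] reduced_bounded bounded_opsD(3) by blast
    show "S x \<in> M" using S[OF that] reduced_subset by blast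
  qed
  \<comment> \<open>Membership says that the operator restricts to \<open>S x\<close> on
    \<open>E x\<close>; on forms this is a closed condition, so compactness reduces the claim to
    finitely many \<open>x\<close>.\<close>
  define A where "A x = {f. \<forall>u v. f (u, id_op (E x) v) = cinner u (S x v)}" for x
  have "op_form ` op_ball C M \<inter> (\<Inter>x\<in>X. A x) \<noteq> {}"
  proof (rule compact_imp_fip_image[OF compact_op_ball])
    show "closed (A x)" for x
      unfolding A_def by (intro closed_Collect_all closed_Collect_eq continuous_intros
          continuous_on_product_coordinates)
    fix F assume F: "finite F" "F \<subseteq> X"
    define T where "T v = (\<Sum>x\<in>F. S x v)" for v
    have "T \<in> M" unfolding T_def by (rule sum_mem) (use F Sz in auto)
    moreover have "norm (T v) \<le> C * norm v" for v
    proof -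
      have "(norm (T v))\<^sup>2 = (\<Sum>x\<in>F. (norm (S x v))\<^sup>2)"
        unfolding T_def
        by (rule norm_sum_orthogonal[OF F(1)], rule orth[OF _ _ _ Sz(2) Sz(2)]) (use F(2) in auto)
      \<comment> \<open>\<open>S x\<close> sees only the component of \<open>v\<close> in
        \<open>E x\<close>. By Bessel the bound \<open>C\<close> thus survives the summation,
        uniformly in \<open>F\<close>.\<close>
      also have "\<dots> \<le> (\<Sum>x\<in>F. C\<^sup>2 * (norm (id_op (E x) v))\<^sup>2)"
      proof (rule sum_mono)
        fix x assume "x \<in> F"
        then have "x \<in> X" using F by blast
        then have "norm (S x v) \<le> C * norm (id_op (E x) v)" using C(2)[of x "id_op (E x) v"] Sz by simp
        then show "(norm (S x v))\<^sup>2 \<le> C\<^sup>2 * (norm (id_op (E x) v))\<^sup>2"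
          unfolding power_mult_distrib[symmetric] by (intro power_mono) auto
      qed
      also have "\<dots> = C\<^sup>2 * (\<Sum>x\<in>F. (norm (id_op (E x) v))\<^sup>2)" by (simp add: sum_distrib_left)
      also have "\<dots> \<le> C\<^sup>2 * (norm v)\<^sup>2"
      proof (intro mult_left_mono Bessel_inequality[OF F(1)])
        show "cinner (id_op (E x) v) (id_op (E y) v) = 0" if "x \<in> F" "y \<in> F" "x \<noteq> y" for x y
          using that F id_op_in[OF Ec] by (intro orth[of x y]) auto
        show "cinner v (id_op (E x) v) = cinner (id_op (E x) v) (id_op (E x) v)" if "x \<in> F" for x
          using that F Ec[of x] by (simp add: id_op_selfadjoint id_op(2) id_op_in subset_iff)
      qed auto
      finally have "(norm (T v))\<^sup>2 \<le> (C * norm v)\<^sup>2" by (simp add: power_mult_distrib)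
      then show ?thesis using C(1) by (simp add: power2_le_iff_abs_le)
    qed
    ultimately have "T \<in> op_ball C M" by (simp add: op_ball_def)
    moreover have "op_form T \<in> A x" if x: "x \<in> F" for x
    proof -
      have "S y (id_op (E x) v) = 0" if y: "y \<in> F" "y \<noteq> x" for y v
      proof -
        have X: "x \<in> X" "y \<in> X" using x y F by auto
        have "id_op (E y) (id_op (E x) v) = 0"
        proof (rule id_op_eqI[OF Ec[OF X(2)]])
          show "0 \<in> E y" by (rule closed_csubspaceD(1)[OF Ec[OF X(2)]])
          show "cinner u 0 = cinner u (id_op (E x) v)" if "u \<in> E y" for u
            using orth[OF X(2,1) y(2) that id_op_in[OF Ec[OF X(1)]]] by simp
        qed
        with X show ?thesis
          using Sz(1)[of y "id_op (E x) v"] bounded_opsD(5)[OF bounded[OF Sz(3)[of y]]] by simp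
      qed
      then have "T (id_op (E x) v) = S x (id_op (E x) v)" for v
        unfolding T_def using F(1) x by (subst sum.remove[OF F(1) x]) (auto intro!: sum.neutral)
      then show ?thesis using Sz(1) x F by (auto simp: A_def)
    qed
    ultimately show "op_form ` op_ball C M \<inter> (\<Inter>x\<in>F. A x) \<noteq> {}" by blast
  qed
  then obtain T where T: "T \<in> op_ball C M" "\<And>x. x \<in> X \<Longrightarrow> op_form T \<in> A x" by blast
  have "T \<circ> id_op (E x) = S x" if "x \<in> X" for x
  proof
    fix v
    show "(T \<circ> id_op (E x)) v = S x v"
      by (rule cinner_eqI) (use T(2)[OF that] in \<open>simp add: A_def\<close>)
  qed
  with T(1) show ?thesis by blast
qed

section \<open>Small generating sets\<close>

text \<open>The partial sums involve finitely many coordinates, and the common bound on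
  \<open>A\<close> makes the series converge uniformly. Hence the ultraweak functionals are weakly
  continuous on the unit ball.\<close>

lemma continuous_on_suminf_form:
  fixes A :: "('h::complex_hilbert \<times> 'h \<Rightarrow> complex) set"
  assumes A: "\<And>f u v. f \<in> A \<Longrightarrow> cmod (f (u, v)) \<le> norm u * norm v"
    and "summable (\<lambda>n::nat. (norm (\<xi> n))\<^sup>2)" "summable (\<lambda>n::nat. (norm (\<eta> n))\<^sup>2)"
  shows "continuous_on A (\<lambda>f. \<Sum>n. f (\<xi> n, \<eta> n))"
proof (rule uniform_limit_theorem)
  show "uniform_limit A (\<lambda>n f. \<Sum>i<n. f (\<xi> i, \<eta> i)) (\<lambda>f. \<Sum>n. f (\<xi> n, \<eta> n)) sequentially"
  proof (rule Weierstrass_m_test)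
    show "summable (\<lambda>n. (norm (\<xi> n))\<^sup>2 + (norm (\<eta> n))\<^sup>2)" by (intro summable_add assms)
    fix n f assume "f \<in> A"
    then have "cmod (f (\<xi> n, \<eta> n)) \<le> norm (\<xi> n) * norm (\<eta> n)" by (rule A)
    also have "\<dots> \<le> 2 * norm (\<xi> n) * norm (\<eta> n)" by simp
    also have "\<dots> \<le> (norm (\<xi> n))\<^sup>2 + (norm (\<eta> n))\<^sup>2" by (rule sum_squares_bound)
    finally show "cmod (f (\<xi> n, \<eta> n)) \<le> (norm (\<xi> n))\<^sup>2 + (norm (\<eta> n))\<^sup>2" .
  qed
  have "continuous_on A (\<lambda>f. f x)" for x :: "'h \<times> 'h"
    using continuous_on_subset[OF continuous_on_product_coordinates subset_UNIV] .
  then show "\<forall>\<^sub>F n in sequentially. continuous_on A (\<lambda>f. \<Sum>i<n. f (\<xi> i, \<eta> i))"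
    by (intro always_eventually allI continuous_intros) auto
qed simp

lemma continuous_map_ultraweak_coordinate:
  assumes K: "closed_csubspace K" and b: "b \<in> K" "b' \<in> K"
  shows "continuous_map (ultraweak_topology K) euclidean (\<lambda>T. cinner b (T b'))"
proof (rule continuous_map_openin_preimage_eq[THEN iffD2], intro conjI allI impI)
  fix U :: "complex set" assume "openin euclidean U"
  then have U: "open U" by simp
  \<comment> \<open>Sequences supported at index 0 turn the ultraweak functional into a single
    matrix coefficient.\<close>
  define \<xi> where "\<xi> n = (if n = 0 then b else 0)" for n :: nat
  define \<eta> where "\<eta> n = (if n = 0 then b' else 0)" for n :: nat
  have "summable (\<lambda>n. (norm (\<xi> n))\<^sup>2)" "summable (\<lambda>n. (norm (\<eta> n))\<^sup>2)"
    by (rule summable_finite[of "{0}"]; simp add: \<xi>_def \<eta>_def)+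
  moreover have "range \<xi> \<subseteq> K" "range \<eta> \<subseteq> K"
    using b closed_csubspaceD(1)[OF K] by (auto simp: \<xi>_def \<eta>_def)
  ultimately have "openin (ultraweak_topology K)
      {T \<in> bounded_ops K. (\<Sum>n. cinner (\<xi> n) (T (\<eta> n))) \<in> U}"
    using U by (intro openin_ultraweak)
  moreover have "(\<Sum>n. cinner (\<xi> n) (T (\<eta> n))) = cinner b (T b')" for T
    by (subst suminf_finite[of "{0}"]) (auto simp: \<xi>_def \<eta>_def)
  ultimately have "openin (ultraweak_topology K) {T \<in> bounded_ops K. cinner b (T b') \<in> U}" by simp
  also have "{T \<in> bounded_ops K. cinner b (T b') \<in> U}
      = topspace (ultraweak_topology K) \<inter> (\<lambda>T. cinner b (T b')) -` U"
    by (auto simp: topspace_ultraweak[OF K])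
  finally show "openin (ultraweak_topology K)
      (topspace (ultraweak_topology K) \<inter> (\<lambda>T. cinner b (T b')) -` U)" .
qed simp

lemma hilbert_basis_operators_eqI:
  assumes K: "closed_csubspace K" and B: "hilbert_basis K B"
    and S: "S \<in> bounded_ops K" and T: "T \<in> bounded_ops K"
    and eq: "\<And>b b'. b \<in> B \<Longrightarrow> b' \<in> B \<Longrightarrow> cinner b (S b') = cinner b (T b')"
  shows "S = T"
proof (rule bounded_ops_eqI[OF K S T])
  show "y = 0" if "y \<in> K" "\<And>u. u \<in> B \<Longrightarrow> cinner u y = 0" for y
    using B that by (auto simp: hilbert_basis_def)
  fix u assume u: "u \<in> B"
  have "S u - T u \<in> K"
    using bounded_opsD(3)[OF S] bounded_opsD(3)[OF T] closed_csubspaceD(5)[OF K] by blast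
  then have "S u - T u = 0"
    using B eq[OF _ u] by (auto simp: hilbert_basis_def cinner_diff_right)
  then show "S u = T u" by simp
qed

section \<open>Matrix coefficients of a faithful normal representation\<close>

locale faithful_rep = vN_algebra +
  fixes K \<pi> B
  assumes K: "closed_csubspace K" and B: "hilbert_basis K B"
    and rep: "faithful_normal_rep H M K \<pi>"
begin

lemma rep_bounded: "T \<in> M \<Longrightarrow> \<pi> T \<in> bounded_ops K"
  using rep by (auto simp: faithful_normal_rep_def star_hom_def ring_hom_def)

lemma rep_add: "S \<in> M \<Longrightarrow> T \<in> M \<Longrightarrow> \<pi> (\<lambda>x. S x + T x) = (\<lambda>x. \<pi> S x + \<pi> T x)"
  using rep by (auto simp: faithful_normal_rep_def star_hom_def ring_hom_def)

lemma rep_scaleC: "T \<in> M \<Longrightarrow> \<pi> (\<lambda>x. c *\<^sub>C T x) = (\<lambda>x. c *\<^sub>C \<pi> T x)"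
  using rep by (auto simp: faithful_normal_rep_def star_hom_def)

lemma coefficients_separate:
  assumes "S \<in> M" "T \<in> M"
    "\<And>b b'. b \<in> B \<Longrightarrow> b' \<in> B \<Longrightarrow> cinner b (\<pi> S b') = cinner b (\<pi> T b')"
  shows "S = T"
proof -
  have "\<pi> S = \<pi> T"
    by (rule hilbert_basis_operators_eqI[OF K B rep_bounded rep_bounded assms(3)]) (use assms in auto)
  then show ?thesis
    using rep assms(1,2) by (auto simp: faithful_normal_rep_def inj_on_def)
qed

lemma basis_nonempty: "B \<noteq> {}"
proof
  assume "B = {}"
  obtain x where x: "x \<in> H" "x \<noteq> 0" using exists_nonzero by blast
  have "id_op H = (\<lambda>x. 0)"
    by (rule coefficients_separate[OF mem(1,2)]) (simp add: \<open>B = {}\<close>)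
  then show False using id_op(2)[OF H x(1)] x(2) by simp
qed

text \<open>The compact topology lives on forms whereas \<open>\<pi>\<close> acts on operators; this
  returns from the former to the latter.\<close>

definition ball_op :: "('a \<times> 'a \<Rightarrow> complex) \<Rightarrow> 'a \<Rightarrow> 'a" where
  "ball_op = inv_into (op_ball 1 M) op_form"

lemma ball_op:
  assumes "f \<in> op_form ` op_ball 1 M"
  shows "ball_op f \<in> M" "op_form (ball_op f) = f"
  using inv_into_into[OF assms] f_inv_into_f[OF assms] by (auto simp: ball_op_def op_ball_def)

text \<open>The map factors through the ultraweak topologies of \<open>H\<close> and
  \<open>K\<close>. Its first factor is continuous because only the unit ball is considered, its
  second by normality of \<open>\<pi>\<close>.\<close>

lemma continuous_on_coefficient:
  assumes b: "b \<in> B" "b' \<in> B"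
  shows "continuous_on (op_form ` op_ball 1 M) (\<lambda>f. cinner b (\<pi> (ball_op f) b'))"
proof -
  let ?C = "op_form ` op_ball 1 M"
  have "continuous_map (top_of_set ?C) (ultraweak_topology H) ball_op"
  proof (rule continuous_map_ultraweakI[OF _ H])
    show "ball_op ` topspace (top_of_set ?C) \<subseteq> bounded_ops H"
      using ball_op(1) bounded by auto
    fix \<xi> \<eta> :: "nat \<Rightarrow> 'a" and U :: "complex set"
    assume *: "open U" "summable (\<lambda>n. (norm (\<xi> n))\<^sup>2)" "summable (\<lambda>n. (norm (\<eta> n))\<^sup>2)"
    have eq: "cinner u (ball_op f v) = f (u, v)" if "f \<in> ?C" for f u v
      using fun_cong[OF ball_op(2)[OF that], of "(u, v)"] by simp
    have "continuous_on ?C (\<lambda>f. \<Sum>n. f (\<xi> n, \<eta> n))"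
      by (rule continuous_on_suminf_form[OF _ *(2,3)]) (simp add: op_form_ball_eq)
    then have "openin (top_of_set ?C) (?C \<inter> (\<lambda>f. \<Sum>n. f (\<xi> n, \<eta> n)) -` U)"
      using *(1) by (rule continuous_openin_preimage_gen)
    moreover have "?C \<inter> (\<lambda>f. \<Sum>n. f (\<xi> n, \<eta> n)) -` U
        = {f \<in> ?C. (\<Sum>n. cinner (\<xi> n) (ball_op f (\<eta> n))) \<in> U}"
      by (auto simp: eq)
    ultimately show "openin (top_of_set ?C)
        {f \<in> topspace (top_of_set ?C). (\<Sum>n. cinner (\<xi> n) (ball_op f (\<eta> n))) \<in> U}" by simp
  qed
  then have "continuous_map (top_of_set ?C) (subtopology (ultraweak_topology H) M) ball_op"
    using ball_op(1) by (auto simp: continuous_map_in_subtopology)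
  moreover have "continuous_map (subtopology (ultraweak_topology H) M) (ultraweak_topology K) \<pi>"
    using rep by (simp add: faithful_normal_rep_def)
  moreover have "continuous_map (ultraweak_topology K) euclidean (\<lambda>T. cinner b (T b'))"
    by (rule continuous_map_ultraweak_coordinate[OF K]) (use b B in \<open>auto simp: hilbert_basis_def\<close>)
  ultimately have "continuous_map (top_of_set ?C) euclidean ((\<lambda>T. cinner b (T b')) \<circ> (\<pi> \<circ> ball_op))"
    by (intro continuous_map_compose)
  then show ?thesis by (simp add: comp_def)
qed

text \<open>
  On the weakly compact unit ball the matrix coefficients of the representation are continuous and
  separate points, so they determine the topology of the ball.
\<close>

lemma ball_dense_subset:
  assumes D: "D \<subseteq> op_form ` op_ball 1 M" and f0: "f0 \<in> op_form ` op_ball 1 M"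
    and approx: "\<And>P e. finite P \<Longrightarrow> P \<subseteq> B \<times> B \<Longrightarrow> e > 0 \<Longrightarrow>
      \<exists>f\<in>D. \<forall>(b, b')\<in>P. cmod (cinner b (\<pi> (ball_op f) b') - cinner b (\<pi> (ball_op f0) b')) < e"
  shows "f0 \<in> closure D"
proof -
  let ?C = "op_form ` op_ball 1 M"
  define g where "g f p = cinner (fst p) (\<pi> (ball_op f) (snd p))" for f p
  \<comment> \<open>The forms of the ball whose coefficient at \<open>p\<close> is within
    \<open>e\<close> of that of \<open>f0\<close>. By \<open>approx\<close> finitely many of these
    closed sets meet \<open>D\<close>, so by compactness all of them share a point of its
    closure.\<close>
  define A where "A = (\<lambda>(p, e). ?C \<inter> (\<lambda>f. g f p) -` cball (g f0 p) e)"
  let ?I = "(B \<times> B) \<times> {(0::real)<..}"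
  have "(?C \<inter> closure D) \<inter> (\<Inter>i\<in>?I. A i) \<noteq> {}"
  proof (rule compact_imp_fip_image)
    show "compact (?C \<inter> closure D)" by (intro compact_Int_closed compact_op_ball closed_closure)
    show "closed (A i)" if "i \<in> ?I" for i
    proof -
      obtain b b' e where i: "i = ((b, b'), e)" "b \<in> B" "b' \<in> B" using \<open>i \<in> ?I\<close> by auto
      show ?thesis
        unfolding A_def i(1) prod.case g_def fst_conv snd_conv
        by (intro continuous_closed_preimage continuous_on_coefficient closed_op_ball closed_cball i)
    qed
    fix J assume J: "finite J" "J \<subseteq> ?I"
    \<comment> \<open>Inserting 1 keeps the minimum defined and positive when \<open>J\<close> is
      empty.\<close>
    define e where "e = Min (insert 1 (snd ` J))"
    have "e > 0" unfolding e_def using J by (subst Min_gr_iff) auto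
    moreover have "finite (fst ` J)" "fst ` J \<subseteq> B \<times> B" using J by auto
    ultimately obtain f where f: "f \<in> D"
      "\<And>p. p \<in> fst ` J \<Longrightarrow> cmod (g f p - g f0 p) < e"
      using approx[of "fst ` J" e] by (fastforce simp: g_def)
    have "f \<in> A i" if i: "i \<in> J" for i
    proof -
      have "e \<le> snd i" unfolding e_def using J(1) i by (intro Min_le) auto
      with f(2)[of "fst i"] i have "cmod (g f (fst i) - g f0 (fst i)) \<le> snd i" by force
      then show ?thesis
        using D f(1) by (auto simp: A_def case_prod_beta dist_norm norm_minus_commute)
    qed
    moreover have "f \<in> ?C \<inter> closure D" using f(1) D closure_subset by blast
    ultimately show "(?C \<inter> closure D) \<inter> (\<Inter>i\<in>J. A i) \<noteq> {}" by blast
  qed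
  then obtain f where f: "f \<in> ?C" "f \<in> closure D" "\<And>i. i \<in> ?I \<Longrightarrow> f \<in> A i" by blast
  \<comment> \<open>A common point has exactly the coefficients of \<open>f0\<close>, so
    faithfulness identifies the two.\<close>
  have "ball_op f = ball_op f0"
  proof (rule coefficients_separate[OF ball_op(1)[OF f(1)] ball_op(1)[OF f0]])
    fix b b' assume b: "b \<in> B" "b' \<in> B"
    have "dist (g f0 (b, b')) (g f (b, b')) \<le> e" if "e > 0" for e
      using f(3)[of "((b, b'), e)"] b that by (simp add: A_def)
    then have "dist (g f0 (b, b')) (g f (b, b')) \<le> 0"
      by (rule field_le_epsilon[where y=0, simplified])
    then show "cinner b (\<pi> (ball_op f) b') = cinner b (\<pi> (ball_op f0) b')" by (simp add: g_def)
  qed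
  then have "f = f0" using ball_op(2)[OF f(1)] ball_op(2)[OF f0] by metis
  then show ?thesis using f(2) by simp
qed

text \<open>Commuting with a fixed \<open>t\<close> in the commutant of \<open>N\<close> is a closed
  condition on forms, so it passes from \<open>D\<close> to the whole unit ball; rescaling then
  reaches every element of \<open>M\<close>.\<close>

lemma dense_ball_generates:
  assumes D: "D \<subseteq> op_form ` op_ball 1 M" "op_form ` op_ball 1 M \<subseteq> closure D"
  shows "generates H (ball_op ` D) M"
  unfolding generates_def
proof (intro conjI allI impI)
  show "von_neumann_algebra H M" by (rule vN)
  show "ball_op ` D \<subseteq> M" using D(1) ball_op(1) by blast
  fix N assume N: "von_neumann_algebra H N \<and> ball_op ` D \<subseteq> N"
  then interpret N: vN_algebra H N by unfold_locales simp
  have ball: "T \<in> N" if T: "T \<in> op_ball 1 M" for T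
  proof (rule N.memI)
    have TM: "T \<in> M" using T by (simp add: op_ball_def)
    then show "T \<in> bounded_ops H" by (rule bounded)
    fix t x assume t: "t \<in> commutant H N"
    let ?W = "{f. \<forall>u v. f (cadjoint t u, v) = f (u, t v)} :: ('a \<times> 'a \<Rightarrow> complex) set"
    have "D \<subseteq> ?W"
    proof
      fix f assume f: "f \<in> D"
      then have f': "f = op_form (ball_op f)" "ball_op f \<in> N" using D(1) ball_op(2) N by auto
      have "op_form (ball_op f) (cadjoint t u, v) = op_form (ball_op f) (u, t v)" for u v
        using N.commute[OF t f'(2)] by (simp add: cadjoint[OF commutantD(1)[OF t]])
      then show "f \<in> ?W" using f'(1) by simp
    qed
    moreover have "closed ?W"
      by (intro closed_Collect_all closed_Collect_eq continuous_on_product_coordinates)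
    ultimately have "closure D \<subseteq> ?W" by (rule closure_minimal)
    then have W: "cinner (cadjoint t u) (T v) = cinner u (T (t v))" for u v
      using D(2) T by fastforce
    show "T (t x) = t (T x)"
      by (rule cinner_eqI) (simp add: W[symmetric] cadjoint[OF commutantD(1)[OF t]])
  qed
  show "M \<subseteq> N"
  proof
    fix T assume T: "T \<in> M"
    obtain r where r: "r \<ge> 0" "\<And>x. norm (T x) \<le> r * norm x"
      using bounded_ops_bound[OF bounded[OF T]] by blast
    \<comment> \<open>Dividing by \<open>r + 1\<close> instead of \<open>r\<close> keeps the factor
      invertible when \<open>r\<close> is 0.\<close>
    define c where "c = complex_of_real (1 / (r + 1))"
    have "norm (c *\<^sub>C T x) \<le> 1 * norm x" for x
    proof -
      have "norm (T x) \<le> (r + 1) * norm x"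
        by (rule order_trans[OF r(2)]) (simp add: distrib_right)
      moreover have "cmod c = 1 / (r + 1)" using r(1) unfolding c_def norm_of_real by simp
      ultimately show ?thesis using r(1) by (simp add: norm_scaleC divide_le_eq mult.commute)
    qed
    then have "(\<lambda>x. c *\<^sub>C T x) \<in> op_ball 1 M" using mem(4)[OF T] by (simp add: op_ball_def)
    then have "(\<lambda>x. c *\<^sub>C T x) \<in> N" by (rule ball)
    then have "(\<lambda>x. complex_of_real (r + 1) *\<^sub>C c *\<^sub>C T x) \<in> N" by (rule N.mem(4))
    moreover have "complex_of_real (r + 1) * c = 1"
      using r(1) unfolding c_def of_real_mult[symmetric] by simp
    ultimately show "T \<in> N" by (simp add: scaleC_scaleC)
  qed
qed

text \<open>A list prescribes finitely many coefficients, each up to 1/(m+1), with targets in a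
  countable dense set of complex numbers. Choosing one form for every satisfiable list gives a dense
  subset of the ball, and there are at most \<open>r\<close> lists.\<close>

lemma small_generating_set:
  assumes r: "Cinfinite r" "|B| \<le>o r"
  obtains S where "generates H S M" "|S| \<le>o r"
proof -
  let ?C = "op_form ` op_ball 1 M"
  obtain Q :: "complex set" where Q: "countable Q" "\<And>X. open X \<Longrightarrow> X \<noteq> {} \<Longrightarrow> \<exists>q\<in>Q. q \<in> X"
    using countable_dense_exists by metis
  define g where "g f p = cinner (fst p) (\<pi> (ball_op f) (snd p))" for f p
  define ok where "ok w f \<longleftrightarrow> f \<in> ?C \<and> (\<forall>(p, q, m)\<in>set w. cmod (g f p - q) < inverse (real (Suc m)))"
    for w :: "(('a \<times> 'a) \<times> complex \<times> nat) list" and f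
  let ?W = "lists ((B \<times> B) \<times> Q \<times> (UNIV :: nat set))"
  define D where "D = (\<lambda>w. SOME f. ok w f) ` {w \<in> ?W. \<exists>f. ok w f}"
  have D: "(SOME f. ok w f) \<in> D" "ok w (SOME f. ok w f)" if "w \<in> ?W" "ok w f" for w f
    using that someI[of "ok w" f] by (auto simp: D_def)
  have DC: "D \<subseteq> ?C"
  proof
    fix f assume "f \<in> D"
    then obtain w where "f = (SOME f. ok w f)" "\<exists>f. ok w f" by (auto simp: D_def)
    then have "ok w f" using someI_ex by metis
    then show "f \<in> ?C" by (simp add: ok_def)
  qed
  have cD: "|D| \<le>o r"
  proof -
    have inf: "infinite (Field r)" using r(1) by (simp add: cinfinite_def)
    have "|(B \<times> B) \<times> Q \<times> (UNIV :: nat set)| \<le>o r"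
      using r countable_card_le[OF Q(1) r(1)] countable_card_le[of "UNIV :: nat set", OF _ r(1)]
      by (intro card_of_Times_ordLeq_infinite_Field inf) auto
    then have "|?W| \<le>o r" by (rule card_lists_le[OF r(1)])
    then have "|{w \<in> ?W. \<exists>f. ok w f}| \<le>o r"
      by (rule ordLeq_transitive[OF card_of_mono1, rotated]) auto
    then show ?thesis unfolding D_def by (rule ordLeq_transitive[OF card_of_image])
  qed
  have "f0 \<in> closure D" if f0: "f0 \<in> ?C" for f0
  proof (rule ball_dense_subset[OF DC f0])
    fix P :: "('a \<times> 'a) set" and e :: real assume P: "finite P" "P \<subseteq> B \<times> B" "e > 0"
    obtain m where m: "inverse (real (Suc m)) < e / 2" using reals_Archimedean[of "e / 2"] P(3) by auto
    have "\<exists>q\<in>Q. q \<in> ball (g f0 p) (inverse (real (Suc m)))" for p by (rule Q(2)) auto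
    then obtain q where q: "\<And>p. q p \<in> Q" "\<And>p. dist (g f0 p) (q p) < inverse (real (Suc m))"
      by (simp only: mem_ball) metis
    obtain ps where ps: "set ps = P" using finite_list[OF P(1)] by blast
    \<comment> \<open>\<open>f0\<close> itself satisfies this list, so a form was chosen for it;
      both lie within 1/(m+1) of the targets, hence within \<open>e\<close> of each other.\<close>
    define w where "w = map (\<lambda>p. (p, q p, m)) ps"
    have w: "w \<in> ?W" "ok w f0" using ps P(2) q f0 by (auto simp: w_def ok_def dist_norm)
    define f where "f = (SOME f. ok w f)"
    have f: "f \<in> D" "ok w f" using D[OF w] by (simp_all add: f_def)
    have "cmod (g f p - g f0 p) < e" if "p \<in> P" for p
    proof -
      have "cmod (g f p - q p) < inverse (real (Suc m))"
        using f(2) that ps by (auto simp: ok_def w_def)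
      moreover have "cmod (g f0 p - q p) < inverse (real (Suc m))"
        using q(2)[of p] by (simp add: dist_norm)
      ultimately show ?thesis
        using m norm_triangle_ineq4[of "g f p - q p" "g f0 p - q p"] by simp
    qed
    then show "\<exists>f\<in>D. \<forall>(b, b')\<in>P. cmod (cinner b (\<pi> (ball_op f) b') - cinner b (\<pi> (ball_op f0) b')) < e"
      using f(1) by (intro bexI[of _ f]) (auto simp: g_def)
  qed
  then have "generates H (ball_op ` D) M" by (intro dense_ball_generates[OF DC]) blast
  moreover have "|ball_op ` D| \<le>o r" by (rule ordLeq_transitive[OF card_of_image cD])
  ultimately show thesis by (rule that)
qed

end

text \<open>Induction on the functionals: pass to the kernel of \<open>\<phi>\<close>, and if it is
  proper add one \<open>T0\<close> outside it, since a multiple of \<open>T0\<close> corrects any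
  element into the kernel. Spanning is phrased through all linearly closed sets \<open>W\<close>, so
  that it can be applied directly to von Neumann algebras.\<close>

lemma finite_spanning_set:
  fixes V :: "('a \<Rightarrow> 'h::complex_hilbert) set" and F :: "(('a \<Rightarrow> 'h) \<Rightarrow> complex) set"
  assumes "finite F"
    and "\<And>S T. S \<in> V \<Longrightarrow> T \<in> V \<Longrightarrow> (\<lambda>x. S x + T x) \<in> V"
    and "\<And>c T. T \<in> V \<Longrightarrow> (\<lambda>x. c *\<^sub>C T x) \<in> V"
    and "\<And>\<phi> S T. \<phi> \<in> F \<Longrightarrow> S \<in> V \<Longrightarrow> T \<in> V \<Longrightarrow> \<phi> (\<lambda>x. S x + T x) = \<phi> S + \<phi> T"
    and "\<And>\<phi> c T. \<phi> \<in> F \<Longrightarrow> T \<in> V \<Longrightarrow> \<phi> (\<lambda>x. c *\<^sub>C T x) = c * \<phi> T"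
    and "\<And>T. T \<in> V \<Longrightarrow> (\<And>\<phi>. \<phi> \<in> F \<Longrightarrow> \<phi> T = 0) \<Longrightarrow> T = (\<lambda>_. 0)"
  shows "\<exists>S\<subseteq>V. finite S \<and> card S \<le> card F \<and>
    (\<forall>W. (\<lambda>_. 0) \<in> W \<longrightarrow> (\<forall>S\<in>W. \<forall>T\<in>W. (\<lambda>x. S x + T x) \<in> W) \<longrightarrow>
      (\<forall>c. \<forall>T\<in>W. (\<lambda>x. c *\<^sub>C T x) \<in> W) \<longrightarrow> S \<subseteq> W \<longrightarrow> V \<subseteq> W)"
  using assms
proof (induction F arbitrary: V rule: finite_induct)
  case empty
  then have "V \<subseteq> {\<lambda>_. 0}" by blast
  then show ?case by (intro exI[of _ "{}"]) auto
next
  case (insert \<phi> F)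
  note add = insert.prems(1) and scl = insert.prems(2)
    and \<phi>add = insert.prems(3) and \<phi>scl = insert.prems(4) and sep = insert.prems(5)
  define V' where "V' = {T \<in> V. \<phi> T = 0}"
  have "\<exists>S\<subseteq>V'. finite S \<and> card S \<le> card F \<and>
    (\<forall>W. (\<lambda>_. 0) \<in> W \<longrightarrow> (\<forall>S\<in>W. \<forall>T\<in>W. (\<lambda>x. S x + T x) \<in> W) \<longrightarrow>
      (\<forall>c. \<forall>T\<in>W. (\<lambda>x. c *\<^sub>C T x) \<in> W) \<longrightarrow> S \<subseteq> W \<longrightarrow> V' \<subseteq> W)"
  proof (rule insert.IH)
    show "T = (\<lambda>_. 0)" if "T \<in> V'" "\<And>\<psi>. \<psi> \<in> F \<Longrightarrow> \<psi> T = 0" for T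
      by (rule sep) (use that in \<open>auto simp: V'_def\<close>)
    show "\<psi> (\<lambda>x. S x + T x) = \<psi> S + \<psi> T" if "\<psi> \<in> F" "S \<in> V'" "T \<in> V'" for \<psi> S T
      by (rule \<phi>add) (use that in \<open>auto simp: V'_def\<close>)
    show "\<psi> (\<lambda>x. c *\<^sub>C T x) = c * \<psi> T" if "\<psi> \<in> F" "T \<in> V'" for \<psi> c T
      by (rule \<phi>scl) (use that in \<open>auto simp: V'_def\<close>)
  qed (use add scl \<phi>add[of \<phi>] \<phi>scl[of \<phi>] in \<open>auto simp: V'_def\<close>)
  then obtain S where S: "S \<subseteq> V'" "finite S" "card S \<le> card F"
    and span: "\<And>W. (\<lambda>_. 0) \<in> W \<Longrightarrow> (\<forall>S\<in>W. \<forall>T\<in>W. (\<lambda>x. S x + T x) \<in> W) \<Longrightarrow>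
      (\<forall>c. \<forall>T\<in>W. (\<lambda>x. c *\<^sub>C T x) \<in> W) \<Longrightarrow> S \<subseteq> W \<Longrightarrow> V' \<subseteq> W" by blast
  show ?case
  proof (cases "V' = V")
    case True
    then show ?thesis using S span insert.hyps by (intro exI[of _ S]) auto
  next
    case False
    then obtain T0 where T0: "T0 \<in> V" "\<phi> T0 \<noteq> 0" by (auto simp: V'_def)
    show ?thesis
    proof (intro exI[of _ "insert T0 S"] conjI allI impI)
      show "insert T0 S \<subseteq> V" using T0(1) S(1) by (auto simp: V'_def)
      show "finite (insert T0 S)" using S(2) by simp
      show "card (insert T0 S) \<le> card (insert \<phi> F)"
        using S(2,3) insert.hyps by (simp add: card_insert_if)
      fix W assume W: "(\<lambda>_. 0) \<in> W" "\<forall>S\<in>W. \<forall>T\<in>W. (\<lambda>x. S x + T x) \<in> W"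
        "\<forall>c. \<forall>T\<in>W. (\<lambda>x. c *\<^sub>C T x) \<in> W" "insert T0 S \<subseteq> W"
      have V'W: "V' \<subseteq> W" by (rule span) (use W in auto)
      show "V \<subseteq> W"
      proof
        fix T assume T: "T \<in> V"
        define c where "c = \<phi> T / \<phi> T0"
        have "(\<lambda>x. T x + (- c) *\<^sub>C T0 x) \<in> V'"
          unfolding V'_def using T T0 by (simp add: add scl \<phi>add[of \<phi>] \<phi>scl[of \<phi>] c_def)
        moreover have "(\<lambda>x. c *\<^sub>C T0 x) \<in> W" using W(3,4) by auto
        ultimately have "(\<lambda>x. (T x + (- c) *\<^sub>C T0 x) + c *\<^sub>C T0 x) \<in> W"
          using bspec[OF bspec[OF W(2) subsetD[OF V'W]]] by simp
        then show "T \<in> W" by (simp add: add.assoc scaleC_add_left[symmetric])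
      qed
    qed
  qed
qed

text \<open>The matrix coefficients are finitely many linear functionals separating
  \<open>M\<close>, and any von Neumann algebra containing a spanning set contains
  \<open>M\<close>.\<close>

lemma (in faithful_rep) finite_generating_set:
  assumes "finite B"
  obtains S where "generates H S M" "finite S" "card S \<le> (card B)\<^sup>2"
proof -
  define F where "F = (\<lambda>(b, b') T. cinner b (\<pi> T b')) ` (B \<times> B)"
  have "\<exists>S\<subseteq>M. finite S \<and> card S \<le> card F \<and>
    (\<forall>W. (\<lambda>_. 0) \<in> W \<longrightarrow> (\<forall>S\<in>W. \<forall>T\<in>W. (\<lambda>x. S x + T x) \<in> W) \<longrightarrow>
      (\<forall>c. \<forall>T\<in>W. (\<lambda>x. c *\<^sub>C T x) \<in> W) \<longrightarrow> S \<subseteq> W \<longrightarrow> M \<subseteq> W)"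
  proof (rule finite_spanning_set)
    show "finite F" unfolding F_def using assms by simp
    show "T = (\<lambda>_. 0)" if T: "T \<in> M" "\<And>\<phi>. \<phi> \<in> F \<Longrightarrow> \<phi> T = 0" for T
    proof (rule coefficients_separate[OF T(1) mem(2)])
      fix b b' assume b: "b \<in> B" "b' \<in> B"
      have "\<pi> (\<lambda>_. 0) = (\<lambda>_. 0)" using rep_scaleC[OF T(1), of 0] by simp
      moreover have "(\<lambda>T. cinner b (\<pi> T b')) \<in> F" unfolding F_def using b by force
      ultimately show "cinner b (\<pi> T b') = cinner b (\<pi> (\<lambda>_. 0) b')" using T(2) by fastforce
    qed
  qed (use mem in \<open>auto simp: F_def rep_add rep_scaleC cinner_add_right cinner_scaleC_right\<close>)
  then obtain S where S: "S \<subseteq> M" "finite S" "card S \<le> card F"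
    and span: "\<And>W. (\<lambda>_. 0) \<in> W \<Longrightarrow> (\<forall>S\<in>W. \<forall>T\<in>W. (\<lambda>x. S x + T x) \<in> W) \<Longrightarrow>
      (\<forall>c. \<forall>T\<in>W. (\<lambda>x. c *\<^sub>C T x) \<in> W) \<Longrightarrow> S \<subseteq> W \<Longrightarrow> M \<subseteq> W" by blast
  have "generates H S M"
    unfolding generates_def
  proof (intro conjI allI impI)
    fix N assume N: "von_neumann_algebra H N \<and> S \<subseteq> N"
    then interpret N: vN_algebra H N by unfold_locales simp
    show "M \<subseteq> N" by (rule span) (use N N.mem in auto)
  qed (use vN S in auto)
  moreover have "card F \<le> card (B \<times> B)" unfolding F_def using assms by (intro card_image_le) simp
  then have "card S \<le> (card B)\<^sup>2" using S(3) by (simp add: card_cartesian_product power2_eq_square)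
  ultimately show thesis using that S(2) by blast
qed

section \<open>The cardinal invariants\<close>

lemma min_card:
  assumes "C \<noteq> {}" "\<And>\<kappa>. \<kappa> \<in> C \<Longrightarrow> Card_order \<kappa>"
  shows "min_card C \<in> C" "\<kappa> \<in> C \<Longrightarrow> min_card C \<le>o \<kappa>"
proof -
  have "\<exists>\<kappa>\<in>C. \<forall>\<kappa>'\<in>C. \<kappa> \<le>o \<kappa>'" using exists_minim_Card_order[of C] assms by blast
  then have "\<exists>\<kappa>. \<kappa> \<in> C \<and> (\<forall>\<kappa>'\<in>C. \<kappa> \<le>o \<kappa>')" by blast
  then have "min_card C \<in> C \<and> (\<forall>\<kappa>'\<in>C. min_card C \<le>o \<kappa>')"
    unfolding min_card_def by (rule someI_ex)
  then show "min_card C \<in> C" "\<kappa> \<in> C \<Longrightarrow> min_card C \<le>o \<kappa>" by auto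
qed

lemma chi_r_le:
  assumes "closed_csubspace K" "hilbert_basis K B" "faithful_normal_rep H M K \<pi>"
  shows "chi_r H M \<le>o |B|"
  unfolding chi_r_def by (rule min_card(2)) (use assms in \<open>auto simp: card_of_Card_order\<close>)

lemma chi_r_attained:
  assumes "von_neumann_algebra H M"
  obtains K \<pi> B where "faithful_rep H M K \<pi> B" "chi_r H M = |B|"
proof -
  interpret vN_algebra H M by unfold_locales (rule assms)
  let ?C = "{|B| | B. \<exists>K \<pi>. closed_csubspace K \<and> hilbert_basis K B \<and> faithful_normal_rep H M K \<pi>}"
  obtain B where "hilbert_basis H B" by (rule hilbert_basis_exists[OF H])
  then have "|B| \<in> ?C" using H faithful_normal_rep_id by blast
  then have "chi_r H M \<in> ?C" unfolding chi_r_def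
    by (intro min_card(1)) (auto simp: card_of_Card_order)
  then obtain K \<pi> B where "chi_r H M = |B|" "closed_csubspace K" "hilbert_basis K B"
    "faithful_normal_rep H M K \<pi>" by blast
  then show thesis by (intro that[of K \<pi> B]) (unfold_locales, auto)
qed

text \<open>An operator commuting with all rank-one operators is a scalar.\<close>

lemma von_neumann_algebra_scalars:
  assumes H: "closed_csubspace H" and x: "x \<in> H" "x \<noteq> 0"
  shows "von_neumann_algebra H {\<lambda>v. c *\<^sub>C id_op H v | c. True}" (is "von_neumann_algebra H ?Z")
  unfolding von_neumann_algebra_def
proof (intro conjI)
  note id = id_op(1)[OF H]
  show "closed_csubspace H" by (rule H)
  show sub: "?Z \<subseteq> bounded_ops H" using bounded_ops_scaleC[OF H id] by auto
  have "cadjoint (\<lambda>v. c *\<^sub>C id_op H v) = (\<lambda>v. cnj c *\<^sub>C id_op H v)" for c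
    by (rule cadjoint_eqI)
      (simp add: cinner_scaleC_left cinner_scaleC_right id_op_selfadjoint[OF H])
  then show "cadjoint ` ?Z \<subseteq> ?Z" by auto
  have "id_op H x \<noteq> 0" using id_op(2)[OF H] x by simp
  moreover have "(\<lambda>v. 1 *\<^sub>C id_op H v) \<in> ?Z" by blast
  ultimately show "?Z \<noteq> {\<lambda>_. 0}" by (metis scaleC_one singletonD)
  show "commutant H (commutant H ?Z) = ?Z"
  proof
    show "?Z \<subseteq> commutant H (commutant H ?Z)" by (rule subset_double_commutant[OF sub])
    show "commutant H (commutant H ?Z) \<subseteq> ?Z"
    proof
      fix T assume T: "T \<in> commutant H (commutant H ?Z)"
      note T' = commutantD(1)[OF T]
      define c where "c = cinner x (T x) / cinner x x"
      have "T y = c *\<^sub>C y" if y: "y \<in> H" for y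
      proof -
        \<comment> \<open>A rank-one operator sending \<open>x\<close> to a multiple of
          \<open>y\<close>. Comparing \<open>T (R x)\<close> with \<open>R (T x)\<close> gives
          \<open>T y\<close> as a multiple of \<open>y\<close> whose factor does not depend on
          \<open>y\<close>.\<close>
        define R where "R v = cinner x v *\<^sub>C y" for v
        have R: "R \<in> bounded_ops H"
        proof (rule bounded_opsI[where r="norm x * norm y"])
          show "norm (R v) \<le> norm x * norm y * norm v" for v
            using mult_right_mono[OF cinner_Cauchy_Schwarz[of x v], of "norm y"]
            by (simp add: R_def norm_scaleC mult_ac)
          show "R v = 0" if "\<And>y. y \<in> H \<Longrightarrow> cinner y v = 0" for v
            using that[OF x(1)] by (simp add: R_def)
        qed (auto simp: R_def cinner_add_right scaleC_add_left cinner_scaleC_right scaleC_scaleC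
            closed_csubspaceD(3)[OF H y])
        have "R \<in> commutant H ?Z"
          by (rule commutantI[OF R]) (auto simp: bounded_opsD[OF R] bounded_ops_id_op[OF H R])
        then have "T (R x) = R (T x)" by (rule commutantD(2)[OF T])
        then have "cinner x x *\<^sub>C T y = cinner x (T x) *\<^sub>C y"
          by (simp add: R_def bounded_opsD[OF T'])
        then have "(1 / cinner x x) *\<^sub>C cinner x x *\<^sub>C T y = (1 / cinner x x) *\<^sub>C cinner x (T x) *\<^sub>C y"
          by simp
        then show ?thesis using x(2) by (simp add: scaleC_scaleC c_def)
      qed
      then have "T = (\<lambda>v. c *\<^sub>C id_op H v)"
        using bounded_ops_id_op(1)[OF H T'] id_op_in[OF H] by (metis ext)
      then show "T \<in> ?Z" by blast
    qed
  qed
qed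

text \<open>The bound on a singleton serves the scalars, where \<open>gen\<close> is 1 by convention
  even if \<open>S\<close> is empty.\<close>

lemma gen_le:
  assumes "generates H S M" "|S| \<le>o r" "|{id_op H}| \<le>o r"
  shows "gen H M \<le>o r"
proof (cases "M = {\<lambda>x. c *\<^sub>C id_op H x | c. True}")
  case True
  then show ?thesis using assms(3) by (simp add: gen_def)
next
  case False
  have "min_card {|S| | S. generates H S M} \<le>o |S|"
    by (rule min_card(2)) (use assms in \<open>auto simp: card_of_Card_order\<close>)
  then show ?thesis using False ordLeq_transitive[OF _ assms(2)] by (simp add: gen_def)
qed

text \<open>The convention is compatible with generation, as the identity generates the scalars. The
  empty set generates nothing more than the scalars, so outside that case a generating set is
  nonempty; this is the source of the lower bound 1.\<close>

lemma gen_attained: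
  assumes vN: "von_neumann_algebra H M"
  obtains S where "generates H S M" "gen H M = |S|" "S \<noteq> {}"
proof -
  interpret vN_algebra H M by unfold_locales (rule vN)
  let ?Z = "{\<lambda>x. c *\<^sub>C id_op H x | c. True}"
  show thesis
  proof (cases "M = ?Z")
    case True
    have "M \<subseteq> N" if N: "von_neumann_algebra H N" for N
    proof -
      interpret N: vN_algebra H N by unfold_locales (rule N)
      show ?thesis unfolding True using N.mem by blast
    qed
    then have "generates H {id_op H} M" using mem(1) by (simp add: generates_def vN)
    then show thesis using True by (intro that[of "{id_op H}"]) (auto simp: gen_def)
  next
    case False
    have "generates H M M" by (simp add: generates_def vN)
    then have "gen H M \<in> {|S| | S. generates H S M}"
      using False unfolding gen_def by (simp only: if_False) (rule min_card(1), auto simp: card_of_Card_order)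
    then obtain S where S: "generates H S M" "gen H M = |S|" by blast
    have "S \<noteq> {}"
    proof
      assume "S = {}"
      obtain x where "x \<in> H" "x \<noteq> 0" using exists_nonzero by blast
      from von_neumann_algebra_scalars[OF H this] have "M \<subseteq> ?Z"
        using S(1) \<open>S = {}\<close> by (simp add: generates_def)
      moreover have "?Z \<subseteq> M" using mem(1,4) by blast
      ultimately show False using False by blast
    qed
    then show thesis using S that by blast
  qed
qed

section \<open>Direct sums\<close>

lemma linf_sum_simps [simp]:
  "mult (linf_sum nrm I A) = (\<lambda>x y. \<lambda>i\<in>I. x i \<otimes>\<^bsub>A i\<^esub> y i)"
  "one (linf_sum nrm I A) = (\<lambda>i\<in>I. \<one>\<^bsub>A i\<^esub>)"
  "add (linf_sum nrm I A) = (\<lambda>x y. \<lambda>i\<in>I. x i \<oplus>\<^bsub>A i\<^esub> y i)"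
  "smult (linf_sum nrm I A) = (\<lambda>c x. \<lambda>i\<in>I. c \<odot>\<^bsub>A i\<^esub> x i)"
  "star (linf_sum nrm I A) = (\<lambda>x. \<lambda>i\<in>I. star (A i) (x i))"
  by (simp_all add: linf_sum_def)

lemma bdd_above_image_iff: "bdd_above (f ` I) \<longleftrightarrow> (\<exists>C\<ge>0. \<forall>i\<in>I. f i \<le> (C::real))"
proof
  assume "bdd_above (f ` I)"
  then obtain C where "\<And>i. i \<in> I \<Longrightarrow> f i \<le> C" by (auto simp: bdd_above_def)
  then show "\<exists>C\<ge>0. \<forall>i\<in>I. f i \<le> C"
    by (intro exI[of _ "max C 0"]) (auto simp: le_max_iff_disj)
qed (auto simp: bdd_above_def)

lemma onorm_le_iff:
  assumes "T \<in> bounded_ops H" "C \<ge> 0"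
  shows "onorm T \<le> C \<longleftrightarrow> (\<forall>v. norm (T v) \<le> C * norm v)"
proof
  assume C: "onorm T \<le> C"
  show "\<forall>v. norm (T v) \<le> C * norm v"
  proof
    fix v
    have "norm (T v) \<le> onorm T * norm v" by (rule onorm[OF bounded_opsD(1)[OF assms(1)]])
    also have "\<dots> \<le> C * norm v" by (rule mult_right_mono[OF C]) simp
    finally show "norm (T v) \<le> C * norm v" .
  qed
qed (auto intro: onorm_bound assms)

text \<open>Replaces \<open>onorm\<close> by pointwise estimates with one nonnegative constant, the
  form in which \<open>op_ball\<close> takes its radius.\<close>

lemma carrier_linf_sum_op:
  assumes "\<And>i. i \<in> I \<Longrightarrow> N i \<subseteq> bounded_ops (K i)"
  shows "x \<in> carrier (linf_sum onorm I (\<lambda>i. op_algebra (K i) (N i))) \<longleftrightarrow>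
    x \<in> (\<Pi>\<^sub>E i\<in>I. N i) \<and> (\<exists>C\<ge>0. \<forall>i\<in>I. \<forall>v. norm (x i v) \<le> C * norm v)"
proof -
  have *: "onorm (x i) \<le> C \<longleftrightarrow> (\<forall>v. norm (x i v) \<le> C * norm v)"
    if "x \<in> (\<Pi>\<^sub>E i\<in>I. N i)" "i \<in> I" "C \<ge> 0" for i C
    using onorm_le_iff[of "x i" "K i" C] assms[OF that(2)] PiE_mem[OF that(1,2)] that(3) by blast
  show ?thesis
  proof (cases "x \<in> (\<Pi>\<^sub>E i\<in>I. N i)")
    case True
    have "(\<exists>C\<ge>0. \<forall>i\<in>I. onorm (x i) \<le> C) \<longleftrightarrow> (\<exists>C\<ge>0. \<forall>i\<in>I. \<forall>v. norm (x i v) \<le> C * norm v)"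
      by (intro ex_cong conj_cong refl ball_cong *[OF True])
    with True show ?thesis unfolding linf_sum_def bdd_above_image_iff by simp
  qed (simp add: linf_sum_def)
qed

lemma star_isomorphic_trans:
  assumes "star_isomorphic A B" "star_isomorphic B C"
  shows "star_isomorphic A C"
proof -
  obtain f g where f: "f \<in> star_hom A B" "bij_betw f (carrier A) (carrier B)"
    and g: "g \<in> star_hom B C" "bij_betw g (carrier B) (carrier C)"
    using assms by (auto simp: star_isomorphic_def)
  have fB: "f x \<in> carrier B" if "x \<in> carrier A" for x using f(2) that by (auto simp: bij_betw_def)
  have "g \<circ> f \<in> star_hom A C"
    using f(1) g(1) fB unfolding star_hom_def ring_hom_def by auto
  then show ?thesis
    unfolding star_isomorphic_def using bij_betw_trans[OF f(2) g(2)] by blast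
qed

text \<open>The trivial decomposition; it shows that the set minimized in
  \<open>localization\<close> is nonempty.\<close>

lemma star_isomorphic_singleton_sum:
  assumes M: "M \<subseteq> bounded_ops H"
  shows "star_isomorphic (op_algebra H M) (linf_sum onorm {a} (\<lambda>_. op_algebra H M))" (is "star_isomorphic ?A ?B")
proof -
  let ?f = "\<lambda>T. \<lambda>i\<in>{a}. T"
  have car: "x \<in> carrier ?B \<longleftrightarrow> x \<in> (\<Pi>\<^sub>E i\<in>{a}. M)" for x
  proof -
    have "\<exists>C\<ge>0. \<forall>v. norm (x a v) \<le> C * norm v" if "x \<in> (\<Pi>\<^sub>E i\<in>{a}. M)"
    proof -
      have "x a \<in> bounded_ops H" using PiE_mem[OF that, of a] M by auto
      then obtain r where "r \<ge> 0" "\<And>v. norm (x a v) \<le> r * norm v"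
        using bounded_ops_bound by metis
      then show ?thesis by blast
    qed
    then show ?thesis by (subst carrier_linf_sum_op) (use M in auto)
  qed
  have "?f \<in> star_hom ?A ?B"
    unfolding star_hom_def ring_hom_def by (auto simp: car)
  moreover have "bij_betw ?f (carrier ?A) (carrier ?B)"
  proof (rule bij_betw_byWitness[where f'="\<lambda>x. x a"])
    show "\<forall>x\<in>carrier ?B. ?f (x a) = x"
      by (auto simp: car fun_eq_iff PiE_def extensional_def)
  qed (auto simp: car)
  ultimately show ?thesis by (auto simp: star_isomorphic_def)
qed

text \<open>The empty sum has a single element, so one and zero would coincide in
  \<open>M\<close>.\<close>

lemma star_isomorphic_sum_nonempty:
  assumes vN: "von_neumann_algebra H M" and iso: "star_isomorphic (op_algebra H M) (linf_sum nrm I A)"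
  shows "I \<noteq> {}"
proof
  assume "I = {}"
  interpret vN_algebra H M by unfold_locales (rule vN)
  obtain f where "bij_betw f M (carrier (linf_sum nrm I A))"
    using iso by (auto simp: star_isomorphic_def)
  then have "inj_on f M" and im: "f ` M = {\<lambda>_. undefined}"
    using \<open>I = {}\<close> by (auto simp: bij_betw_def linf_sum_def)
  moreover have "f (id_op H) = f (\<lambda>_. 0)"
    using imageI[OF mem(1), of f] imageI[OF mem(2), of f] unfolding im by simp
  ultimately have "id_op H = (\<lambda>_. 0)" using mem(1,2) by (auto simp: inj_on_def)
  then show False using exists_nonzero id_op(2)[OF H] by auto
qed

text \<open>The isomorphism restricts every component to its central subspaces. It is injective
  because these are total and surjective by reassembling bounded families. Pairs of indices are
  coded by \<open>enc\<close> since \<open>localization\<close> expects indices in the Hilbert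
  space; \<open>E'\<close> and \<open>i'\<close> undo the coding.\<close>

lemma direct_sum_refinement:
  fixes K :: "'i \<Rightarrow> 'h::complex_hilbert set" and enc :: "'i \<times> 'j \<Rightarrow> 'k"
  assumes vN: "\<And>i. i \<in> I \<Longrightarrow> von_neumann_algebra (K i) (N i)"
    and E: "\<And>i x. i \<in> I \<Longrightarrow> x \<in> X i \<Longrightarrow> central_subspace (K i) (N i) (E i x) (e i x)"
    and orth: "\<And>i x y u v. i \<in> I \<Longrightarrow> x \<in> X i \<Longrightarrow> y \<in> X i \<Longrightarrow> x \<noteq> y \<Longrightarrow> u \<in> E i x \<Longrightarrow> v \<in> E i y
      \<Longrightarrow> cinner u v = 0"
    and total: "\<And>i y. i \<in> I \<Longrightarrow> y \<in> K i \<Longrightarrow> (\<And>x u. x \<in> X i \<Longrightarrow> u \<in> E i x \<Longrightarrow> cinner u y = 0) \<Longrightarrow> y = 0"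
    and enc: "inj enc"
  defines "E' \<equiv> \<lambda>j. case_prod E (inv_into UNIV enc j)" and "i' \<equiv> \<lambda>j. fst (inv_into UNIV enc j)"
  shows "star_isomorphic (linf_sum onorm I (\<lambda>i. op_algebra (K i) (N i)))
    (linf_sum onorm (enc ` (SIGMA i:I. X i)) (\<lambda>j. op_algebra (E' j) (reduced_algebra (N (i' j)) (E' j))))"
    (is "star_isomorphic ?A ?B")
proof -
  define J where "J = enc ` (SIGMA i:I. X i)"
  define z where "z j = id_op (E' j)" for j
  define h where "h x = (\<lambda>j\<in>J. x (i' j) \<circ> z j)" for x :: "'i \<Rightarrow> 'h \<Rightarrow> 'h"
  have dec [simp]: "i' (enc (i, x)) = i" "E' (enc (i, x)) = E i x" for i x
    using enc by (auto simp: i'_def E'_def)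
  have J: "\<exists>x\<in>X (i' j). j = enc (i' j, x) \<and> i' j \<in> I" if "j \<in> J" for j
    using that by (auto simp: J_def)
  have Ej: "central_subspace (K (i' j)) (N (i' j)) (E' j) (e (i' j) (snd (inv_into UNIV enc j)))" "i' j \<in> I" if "j \<in> J" for j
    using that E enc by (auto simp: J_def)
  have vNi: "vN_algebra (K i) (N i)" if "i \<in> I" for i by (rule vN_algebra.intro) (rule vN[OF that])
  have carA: "x \<in> carrier ?A \<longleftrightarrow>
      x \<in> (\<Pi>\<^sub>E i\<in>I. N i) \<and> (\<exists>C\<ge>0. \<forall>i\<in>I. \<forall>v. norm (x i v) \<le> C * norm v)" for x
    by (rule carrier_linf_sum_op) (use vN_algebra.bounded[OF vNi] in blast)
  have carB: "x \<in> carrier ?B \<longleftrightarrow>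
      x \<in> (\<Pi>\<^sub>E j\<in>J. reduced_algebra (N (i' j)) (E' j)) \<and>
      (\<exists>C\<ge>0. \<forall>j\<in>J. \<forall>v. norm (x j v) \<le> C * norm v)" for x
    unfolding J_def[symmetric]
    by (rule carrier_linf_sum_op) (rule central_subspace.reduced_bounded[OF Ej(1)])
  have h_car: "h x \<in> carrier ?B" if x: "x \<in> carrier ?A" for x
  proof -
    from x obtain C where C: "C \<ge> 0" "\<And>i v. i \<in> I \<Longrightarrow> norm (x i v) \<le> C * norm v"
      and xN: "\<And>i. i \<in> I \<Longrightarrow> x i \<in> N i" unfolding carA by blast
    have "h x j \<in> reduced_algebra (N (i' j)) (E' j)" if "j \<in> J" for j
      using that xN[OF Ej(2)[OF that]] by (simp add: h_def z_def reduced_algebra_def)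
    moreover have "norm (h x j v) \<le> C * norm v" if j: "j \<in> J" for j v
    proof -
      have "norm (h x j v) \<le> C * norm (z j v)" using j C(2)[OF Ej(2)[OF j]] by (simp add: h_def)
      also have "\<dots> \<le> C * norm v"
        unfolding z_def using C(1)
        by (intro mult_left_mono norm_id_op_le central_subspace.E(1)[OF Ej(1)[OF j]])
      finally show ?thesis .
    qed
    ultimately show ?thesis unfolding carB using C(1) by (auto simp: h_def)
  qed
  have zz: "z j (z j v) = z j v" if "j \<in> J" for j v
    unfolding z_def by (rule id_op(2)[OF central_subspace.E(1)[OF Ej(1)[OF that]]])
      (rule id_op_in[OF central_subspace.E(1)[OF Ej(1)[OF that]]])
  have zT: "T (z j v) = z j (T v)" if "j \<in> J" "T \<in> N (i' j)" for j T v
    unfolding z_def by (rule central_subspace.id_op_commute_M[OF Ej(1)[OF that(1)] that(2)])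
  have zTz: "z j (T (z j v)) = T (z j v)" if "j \<in> J" "T \<in> N (i' j)" for j T v
    using zT[OF that] zz[OF that(1)] by metis
  have zH: "id_op (K (i' j)) (z j v) = z j v" if j: "j \<in> J" for j v
    using central_subspace.E(1,2)[OF Ej(1)[OF j]] unfolding z_def
    by (intro id_op(2) vN_algebra.H[OF vNi[OF Ej(2)[OF j]]]) (use id_op_in in blast)
  have zadj: "cadjoint (T \<circ> z j) = cadjoint T \<circ> z j" if "j \<in> J" "T \<in> N (i' j)" for j T
    unfolding z_def by (rule central_subspace.cadjoint_reduced[OF Ej(1)[OF that(1)] that(2)])
  have h_hom: "h \<in> star_hom ?A ?B"
  proof -
    have xN: "x (i' j) \<in> N (i' j)" if "x \<in> carrier ?A" "j \<in> J" for x j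
      using that Ej(2) unfolding carA by blast
    have 1: "h (x \<otimes>\<^bsub>?A\<^esub> y) = h x \<otimes>\<^bsub>?B\<^esub> h y" if "x \<in> carrier ?A" "y \<in> carrier ?A" for x y
      unfolding J_def[symmetric] linf_sum_simps
      by (auto simp: h_def fun_eq_iff Ej(2) zTz[OF _ xN[OF that(2)]])
    have 2: "h (x \<oplus>\<^bsub>?A\<^esub> y) = h x \<oplus>\<^bsub>?B\<^esub> h y" for x y
      unfolding J_def[symmetric] linf_sum_simps by (auto simp: h_def fun_eq_iff Ej(2))
    have 3: "h \<one>\<^bsub>?A\<^esub> = \<one>\<^bsub>?B\<^esub>"
      unfolding J_def[symmetric] linf_sum_simps
      by (auto simp: h_def fun_eq_iff Ej(2) zH) (simp add: z_def)
    have 4: "h (c \<odot>\<^bsub>?A\<^esub> x) = c \<odot>\<^bsub>?B\<^esub> h x" for c x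
      unfolding J_def[symmetric] linf_sum_simps by (auto simp: h_def fun_eq_iff Ej(2))
    have 5: "h (star ?A x) = star ?B (h x)" if "x \<in> carrier ?A" for x
      unfolding J_def[symmetric] linf_sum_simps
      by (auto simp: h_def fun_eq_iff Ej(2) zadj[OF _ xN[OF that]])
    show ?thesis
      unfolding star_hom_def ring_hom_def using h_car 1 2 3 4 5 by blast
  qed
  have h_inj: "inj_on h (carrier ?A)"
  proof (rule inj_onI)
    fix x y assume x: "x \<in> carrier ?A" and y: "y \<in> carrier ?A" and eq: "h x = h y"
    have xy: "x \<in> (\<Pi>\<^sub>E i\<in>I. N i)" "y \<in> (\<Pi>\<^sub>E i\<in>I. N i)" using x y carA by auto
    show "x = y"
    proof (rule PiE_ext[OF xy])
      fix i assume i: "i \<in> I"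
      interpret vN_algebra "K i" "N i" by (rule vNi[OF i])
      show "x i = y i"
      proof (rule bounded_ops_eqI[OF H bounded bounded, where U="\<Union>u\<in>X i. E i u"])
        show "x i \<in> N i" "y i \<in> N i" using xy i by auto
        show "v = 0" if "v \<in> K i" "\<And>u. u \<in> (\<Union>u\<in>X i. E i u) \<Longrightarrow> cinner u v = 0" for v
          by (rule total[OF i that(1)]) (use that(2) in blast)
        fix u assume "u \<in> (\<Union>u\<in>X i. E i u)"
        then obtain w where w: "w \<in> X i" "u \<in> E i w" by blast
        then have j: "enc (i, w) \<in> J" using i by (auto simp: J_def)
        have "z (enc (i, w)) u = u"
          unfolding z_def using w(2) central_subspace.E(1)[OF E[OF i w(1)]] by (simp add: id_op(2))
        then show "x i u = y i u" using fun_cong[OF fun_cong[OF eq, of "enc (i, w)"], of u] j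
          by (simp add: h_def)
      qed
    qed
  qed
  have h_surj: "y \<in> h ` carrier ?A" if y: "y \<in> carrier ?B" for y
  proof -
    from y obtain C where C: "C \<ge> 0" "\<And>j v. j \<in> J \<Longrightarrow> norm (y j v) \<le> C * norm v"
      and yN: "y \<in> (\<Pi>\<^sub>E j\<in>J. reduced_algebra (N (i' j)) (E' j))" unfolding carB by blast
    \<comment> \<open>The radius is the same \<open>C\<close> for all \<open>i\<close>, so the
      assembled operators again form a bounded family.\<close>
    have "\<exists>T\<in>op_ball C (N i). \<forall>x\<in>X i. T \<circ> id_op (E i x) = y (enc (i, x))" if i: "i \<in> I" for i
    proof (rule vN_algebra.decomposition_surjective[OF vNi[OF i] E[OF i] orth[OF i] _ C(1)])
      fix x assume "x \<in> X i"
      then have j: "enc (i, x) \<in> J" using i by (auto simp: J_def)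
      show "y (enc (i, x)) \<in> reduced_algebra (N i) (E i x)" using PiE_mem[OF yN j] by simp
      show "norm (y (enc (i, x)) v) \<le> C * norm v" for v by (rule C(2)[OF j])
    qed
    then obtain T where T: "\<And>i. i \<in> I \<Longrightarrow> T i \<in> op_ball C (N i)"
      "\<And>i x. i \<in> I \<Longrightarrow> x \<in> X i \<Longrightarrow> T i \<circ> id_op (E i x) = y (enc (i, x))" by metis
    define x where "x = restrict T I"
    have "x \<in> carrier ?A" unfolding carA using T(1) C(1) by (auto simp: x_def op_ball_def)
    moreover have "h x = y"
    proof
      fix j
      show "h x j = y j"
      proof (cases "j \<in> J")
        case True
        then obtain i u where "j = enc (i, u)" "i \<in> I" "u \<in> X i" by (auto simp: J_def)
        then show ?thesis using True T(2) by (simp add: h_def x_def z_def)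
      next
        case False
        then show ?thesis using yN by (auto simp: h_def PiE_def extensional_def)
      qed
    qed
    ultimately show ?thesis by blast
  qed
  have "bij_betw h (carrier ?A) (carrier ?B)"
    unfolding bij_betw_def using h_inj h_car h_surj by blast
  then show ?thesis using h_hom by (auto simp: star_isomorphic_def)
qed

lemma (in vN_algebra) chi_r_reduced_le:
  assumes x: "x \<in> H" "x \<noteq> 0" and S: "generates H S M" and r: "Cinfinite r" "|S| \<le>o r"
  shows "chi_r (central_cyclic x) (reduced_algebra M (central_cyclic x)) \<le>o r"
proof -
  have L: "closed_csubspace (cyclic x)" unfolding cyclic_def by (rule closed_csubspace_cspan)
  obtain B where B: "hilbert_basis (cyclic x) B" by (rule hilbert_basis_exists[OF L])
  have "chi_r (central_cyclic x) (reduced_algebra M (central_cyclic x)) \<le>o |B|"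
    by (rule chi_r_le[OF L B faithful_normal_rep_cyclic[OF x]])
  also have "|B| \<le>o r" by (rule card_basis_cyclic[OF S x(1) r B])
  finally show ?thesis .
qed

section \<open>Localizations\<close>

lemma infinite_hilbert:
  assumes "(x::'h::complex_hilbert) \<noteq> 0"
  shows "infinite (UNIV :: 'h set)"
proof -
  have "inj (\<lambda>r::real. r *\<^sub>R x)" using assms by (auto simp: inj_on_def)
  then show ?thesis using finite_imageD[of "\<lambda>r::real. r *\<^sub>R x" UNIV] infinite_UNIV_char_0
    by (metis finite_subset subset_UNIV)
qed

text \<open>The part of \<open>localization\<close> that does not mention the invariant, so one
  decomposition can be used for both \<open>gen\<close> and \<open>chi_r\<close>.\<close>

definition direct_sum ::
  "'h::complex_hilbert set \<Rightarrow> ('h \<Rightarrow> 'h) set \<Rightarrow> 'h set \<Rightarrow> ('h \<Rightarrow> 'h set) \<Rightarrow> ('h \<Rightarrow> ('h \<Rightarrow> 'h) set) \<Rightarrow> bool"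
where
  "direct_sum H M I K N \<longleftrightarrow> (\<forall>i\<in>I. von_neumann_algebra (K i) (N i)) \<and>
    star_isomorphic (op_algebra H M) (linf_sum onorm I (\<lambda>i. op_algebra (K i) (N i)))"

lemma localization_eq:
  "localization F H M = min_card {\<kappa>. Card_order \<kappa> \<and>
     (\<exists>I K N. direct_sum H M I K N \<and> (\<forall>i\<in>I. F (K i) (N i) \<le>o \<kappa>))}"
  by (simp add: localization_def direct_sum_def ball_conj_distrib conj_ac)

lemma localization_le:
  fixes F :: "'h::complex_hilbert set \<Rightarrow> ('h \<Rightarrow> 'h) set \<Rightarrow> 'x rel" and \<kappa> :: "'x rel"
  assumes "direct_sum H M I K N" "Card_order \<kappa>" "\<And>i. i \<in> I \<Longrightarrow> F (K i) (N i) \<le>o \<kappa>"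
  shows "localization F H M \<le>o \<kappa>"
proof -
  let ?C = "{\<kappa> :: 'x rel. Card_order \<kappa> \<and> (\<exists>I K N. direct_sum H M I K N \<and> (\<forall>i\<in>I. F (K i) (N i) \<le>o \<kappa>))}"
  have "\<exists>I K N. direct_sum H M I K N \<and> (\<forall>i\<in>I. F (K i) (N i) \<le>o \<kappa>)"
    by (rule exI[of _ I], rule exI[of _ K], rule exI[of _ N]) (use assms in simp)
  then have \<kappa>: "\<kappa> \<in> ?C" using assms(2) by simp
  then have "?C \<noteq> {}" by (metis (no_types) empty_iff)
  then show ?thesis unfolding localization_eq by (rule min_card(2)) (use \<kappa> in simp_all)
qed

lemma localization_attained:
  fixes F :: "'h::complex_hilbert set \<Rightarrow> ('h \<Rightarrow> 'h) set \<Rightarrow> 'x rel"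
  assumes vN: "von_neumann_algebra H M" and F: "Card_order (F H M)"
  shows "Card_order (localization F H M)"
    "\<exists>I K N. direct_sum H M I K N \<and> (\<forall>i\<in>I. F (K i) (N i) \<le>o localization F H M)"
proof -
  let ?C = "{\<kappa> :: 'x rel. Card_order \<kappa> \<and> (\<exists>I K N. direct_sum H M I K N \<and> (\<forall>i\<in>I. F (K i) (N i) \<le>o \<kappa>))}"
  have "M \<subseteq> bounded_ops H" using vN by (simp add: von_neumann_algebra_def)
  then have "direct_sum H M {0} (\<lambda>_. H) (\<lambda>_. M)"
    unfolding direct_sum_def using vN star_isomorphic_singleton_sum[of M H 0] by simp
  then have "\<exists>I K N. direct_sum H M I K N \<and> (\<forall>i\<in>I. F (K i) (N i) \<le>o F H M)"
    using ordLeq_refl[OF F]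
    by (intro exI[of _ "{0}"] exI[of _ "\<lambda>_. H"] exI[of _ "\<lambda>_. M"]) auto
  then have "F H M \<in> ?C" using F by simp
  then have "?C \<noteq> {}" by (metis (no_types) empty_iff)
  then have "localization F H M \<in> ?C"
    unfolding localization_eq by (rule min_card(1)) simp
  then show "Card_order (localization F H M)"
    "\<exists>I K N. direct_sum H M I K N \<and> (\<forall>i\<in>I. F (K i) (N i) \<le>o localization F H M)" by simp_all
qed

lemma direct_sumD:
  assumes "direct_sum H M I K N"
  shows "i \<in> I \<Longrightarrow> von_neumann_algebra (K i) (N i)"
    "star_isomorphic (op_algebra H M) (linf_sum onorm I (\<lambda>i. op_algebra (K i) (N i)))"
    "von_neumann_algebra H M \<Longrightarrow> I \<noteq> {}"
  using assms star_isomorphic_sum_nonempty unfolding direct_sum_def by blast+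

section \<open>The invariants as nonzero cardinals, and arithmetic across types\<close>

lemma Card_order_gen: "von_neumann_algebra H M \<Longrightarrow> Card_order (gen H M)"
  using gen_attained card_of_Card_order by metis

lemma Card_order_chi_r: "von_neumann_algebra H M \<Longrightarrow> Card_order (chi_r H M)"
  using chi_r_attained card_of_Card_order by metis

lemma singleton_le_gen: "von_neumann_algebra H M \<Longrightarrow> |{a}| \<le>o gen H M"
  using gen_attained card_of_singl_ordLeq by metis

lemma singleton_le_chi_r: "von_neumann_algebra H M \<Longrightarrow> |{a}| \<le>o chi_r H M"
  using chi_r_attained card_of_singl_ordLeq faithful_rep.basis_nonempty by metis

text \<open>A cardinal can compete in \<open>localization\<close> only if it is a relation on the
  right type; this copies a bound such as \<open>natLeq *c \<rho>\<close> to a subset of that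
  type.\<close>

lemma Card_order_transfer:
  fixes r :: "'y rel"
  assumes "Card_order r" "r \<le>o |UNIV :: 'x set|"
  obtains A :: "'x set" where "|A| =o r"
proof -
  have "|Field r| \<le>o |UNIV :: 'x set|"
    using ordIso_ordLeq_trans[OF card_of_Field_ordIso[OF assms(1)] assms(2)] .
  then obtain A :: "'x set" where "|Field r| =o |A|"
    using iffD1[OF internalize_card_of_ordLeq2] by fastforce
  then have "|A| =o r"
    by (rule ordIso_transitive[OF ordIso_symmetric card_of_Field_ordIso[OF assms(1)]])
  then show thesis by (rule that)
qed

lemma Card_order_le_UNIV:
  assumes "Card_order (r :: 'x rel)"
  shows "r \<le>o |UNIV :: 'x set|"
  by (rule ordIso_ordLeq_trans[OF ordIso_symmetric[OF card_of_Field_ordIso[OF assms]]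
        card_of_mono1[OF subset_UNIV]])

lemma natLeq_Cnotzero: "Cnotzero natLeq"
  by (rule Cinfinite_Cnotzero[OF natLeq_Cinfinite])

text \<open>A singleton below \<open>r\<close> excludes the zero cardinal, for which the product
  would vanish.\<close>

lemma natLeq_cprod:
  assumes r: "Card_order r" "|{a}| \<le>o r"
  shows "Cinfinite (natLeq *c r)" "r \<le>o natLeq *c r"
proof -
  have "Field r \<noteq> {}"
  proof
    assume "Field r = {}"
    moreover have "|{a}| \<le>o |Field r|"
      by (rule ordLeq_ordIso_trans[OF r(2) ordIso_symmetric[OF card_of_Field_ordIso[OF r(1)]]])
    ultimately show False using card_of_empty3 by (metis insert_not_empty)
  qed
  then have r0: "Cnotzero r" using r(1) by (metis czeroE ordIso_refl)
  have "natLeq \<le>o natLeq *c r"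
    by (rule ordLeq_ordIso_trans[OF ordLeq_cprod2[OF r0 natLeq_Card_order] cprod_com])
  then show "Cinfinite (natLeq *c r)"
    using cinfinite_mono natLeq_cinfinite Card_order_cprod by blast
  show "r \<le>o natLeq *c r" by (rule ordLeq_cprod2[OF natLeq_Cnotzero r(1)])
qed

lemma natLeq_cprod_least:
  assumes "Card_order r" "r \<le>o s" "Cinfinite s"
  shows "natLeq *c r \<le>o s"
  by (rule cprod_cinfinite_bound[OF natLeq_ordLeq_cinfinite[OF assms(3)] assms(2) natLeq_Card_order
        assms(1,3)])

section \<open>Comparison of the two localized invariants\<close>

context vN_algebra
begin

abbreviation "\<gamma> \<equiv> localization gen H M"
abbreviation "\<rho> \<equiv> localization chi_r H M"

lemma Card_order_localization: "Card_order \<gamma>" "Card_order \<rho>"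
  by (rule localization_attained(1)[where F=gen, OF vN Card_order_gen[OF vN]])
    (rule localization_attained(1)[where F=chi_r, OF vN Card_order_chi_r[OF vN]])

lemma localization_gen:
  obtains I K N where "direct_sum H M I K N" "\<forall>i\<in>I. gen (K i) (N i) \<le>o \<gamma>"
  using localization_attained(2)[where F=gen, OF vN Card_order_gen[OF vN]] by (elim exE conjE)

lemma localization_chi_r:
  obtains I K N where "direct_sum H M I K N" "\<forall>i\<in>I. chi_r (K i) (N i) \<le>o \<rho>"
  using localization_attained(2)[where F=chi_r, OF vN Card_order_chi_r[OF vN]] by (elim exE conjE)

lemma singleton_le_localization: "|{a}| \<le>o \<gamma>" "|{a}| \<le>o \<rho>"
proof -
  obtain I K N where s: "direct_sum H M I K N" and le: "\<forall>i\<in>I. gen (K i) (N i) \<le>o \<gamma>"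
    by (rule localization_gen)
  obtain i where i: "i \<in> I" using direct_sumD(3)[OF s vN] by blast
  show "|{a}| \<le>o \<gamma>"
    by (rule ordLeq_transitive[OF singleton_le_gen[OF direct_sumD(1)[OF s i]] bspec[OF le i]])
next
  obtain I K N where s: "direct_sum H M I K N" and le: "\<forall>i\<in>I. chi_r (K i) (N i) \<le>o \<rho>"
    by (rule localization_chi_r)
  obtain i where i: "i \<in> I" using direct_sumD(3)[OF s vN] by blast
  show "|{a}| \<le>o \<rho>"
    by (rule ordLeq_transitive[OF singleton_le_chi_r[OF direct_sumD(1)[OF s i]] bspec[OF le i]])
qed

lemma infinite_UNIV_hilbert: "infinite (UNIV :: 'h set)"
proof -
  obtain x where "x \<in> H" "x \<noteq> 0" using exists_nonzero by blast
  then show ?thesis by (intro infinite_hilbert[of x])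
qed

lemma Cinfinite_UNIV: "Cinfinite |UNIV :: 'h set|" "|UNIV :: 'h set| \<le>o |UNIV :: ('h \<Rightarrow> 'h) set|"
proof -
  show "Cinfinite |UNIV :: 'h set|"
    unfolding cinfinite_def Field_card_of using infinite_UNIV_hilbert card_of_card_order_on by (rule conjI)
  have "inj (\<lambda>x :: 'h. \<lambda>_ :: 'h. x)" by (auto simp: inj_on_def fun_eq_iff)
  then show "|UNIV :: 'h set| \<le>o |UNIV :: ('h \<Rightarrow> 'h) set|"
    unfolding card_of_ordLeq[symmetric] by blast
qed

text \<open>The decomposition attaining \<open>\<rho>\<close> is used unchanged: each summand has a
  faithful representation of dimension at most \<open>\<rho>\<close>, hence a generating set of size
  at most \<open>natLeq *c \<rho>\<close>.\<close>

lemma gen_le_chi_r: "natLeq *c \<gamma> \<le>o natLeq *c \<rho>"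
proof -
  let ?\<kappa> = "natLeq *c \<rho>"
  note \<kappa> = natLeq_cprod[OF Card_order_localization(2) singleton_le_localization(2)]
  obtain I K N where s: "direct_sum H M I K N" and le: "\<forall>i\<in>I. chi_r (K i) (N i) \<le>o \<rho>"
    by (rule localization_chi_r)
  note vNi = direct_sumD(1)[OF s] and iso = direct_sumD(2)[OF s]
  \<comment> \<open>\<open>\<rho>\<close> is a cardinal on \<open>'h\<close>, which is infinite, so
    \<open>?\<kappa>\<close> fits into \<open>'h\<close> and then, through constant functions, into
    the type of \<open>\<gamma>\<close>.\<close>
  have "?\<kappa> \<le>o |UNIV :: 'h set|"
    by (rule natLeq_cprod_least[OF Card_order_localization(2)
          Card_order_le_UNIV[OF Card_order_localization(2)] Cinfinite_UNIV(1)])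
  then have "?\<kappa> \<le>o |UNIV :: ('h \<Rightarrow> 'h) set|" by (rule ordLeq_transitive[OF _ Cinfinite_UNIV(2)])
  then obtain A :: "('h \<Rightarrow> 'h) set" where A: "|A| =o ?\<kappa>"
    using Card_order_transfer[OF Card_order_cprod] by blast
  have "\<gamma> \<le>o |A|"
  proof (rule localization_le[where F=gen, OF s card_of_Card_order])
    fix i assume i: "i \<in> I"
    obtain L \<pi> B where "faithful_rep (K i) (N i) L \<pi> B" and B: "chi_r (K i) (N i) = |B|"
      by (rule chi_r_attained[OF vNi[OF i]])
    then interpret R: faithful_rep "K i" "N i" L \<pi> B by simp
    have "|B| \<le>o ?\<kappa>" using ordLeq_transitive[OF bspec[OF le i] \<kappa>(2)] by (simp add: B)
    then obtain S where S: "generates (K i) S (N i)" "|S| \<le>o ?\<kappa>"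
      using R.small_generating_set[OF \<kappa>(1)] by blast
    have "gen (K i) (N i) \<le>o ?\<kappa>"
      by (rule gen_le[OF S countable_card_le[OF _ \<kappa>(1)]]) simp
    then show "gen (K i) (N i) \<le>o |A|" using ordLeq_ordIso_trans[OF _ ordIso_symmetric[OF A]] by blast
  qed
  then have "\<gamma> \<le>o ?\<kappa>" by (rule ordLeq_ordIso_trans[OF _ A])
  then show ?thesis by (rule natLeq_cprod_least[OF Card_order_localization(1) _ \<kappa>(1)])
qed

text \<open>The decomposition attaining \<open>\<gamma>\<close> is refined by cutting each summand
  into central cyclic pieces. The generators of the whole summand bound the dimension of the cyclic
  subspace on which a piece acts.\<close>

lemma chi_r_le_gen: "natLeq *c \<rho> \<le>o natLeq *c \<gamma>"
proof -
  let ?\<kappa> = "natLeq *c \<gamma>"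
  note \<kappa> = natLeq_cprod[OF Card_order_localization(1) singleton_le_localization(1)]
  obtain I K N where s: "direct_sum H M I K N" and le: "\<forall>i\<in>I. gen (K i) (N i) \<le>o \<gamma>"
    by (rule localization_gen)
  note vNi = direct_sumD(1)[OF s] and iso = direct_sumD(2)[OF s]
  have vNA: "vN_algebra (K i) (N i)" if "i \<in> I" for i by (rule vN_algebra.intro) (rule vNi[OF that])
  define E where "E i = vN_algebra.central_cyclic (K i) (N i)" for i
  obtain X where X0: "\<And>i. i \<in> I \<Longrightarrow> X i \<subseteq> K i - {0}"
    and X1: "\<And>i. i \<in> I \<Longrightarrow> \<forall>x\<in>X i. \<forall>y\<in>X i. x \<noteq> y \<longrightarrow> (\<forall>u\<in>E i x. \<forall>v\<in>E i y. cinner u v = 0)"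
    and X2: "\<And>i. i \<in> I \<Longrightarrow> \<forall>y\<in>K i. (\<forall>x\<in>X i. \<forall>u\<in>E i x. cinner u y = 0) \<longrightarrow> y = 0"
    using vN_algebra.central_decomposition[OF vNA, folded E_def] by metis
  have orth: "cinner u v = 0"
    if "i \<in> I" "x \<in> X i" "y \<in> X i" "x \<noteq> y" "u \<in> E i x" "v \<in> E i y" for i x y u v
    using X1[OF that(1)] that(2-) by blast
  have total: "y = 0" if "i \<in> I" "y \<in> K i" "\<And>x u. x \<in> X i \<Longrightarrow> u \<in> E i x \<Longrightarrow> cinner u y = 0" for i y
    using X2[OF that(1)] that(2-) by blast
  have XK: "x \<in> K i" "x \<noteq> 0" if "i \<in> I" "x \<in> X i" for i x using X0[OF that(1)] that(2) by auto
  have CS: "central_subspace (K i) (N i) (E i x) x" if "i \<in> I" "x \<in> X i" for i x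
    unfolding E_def by (rule vN_algebra.central_subspace_cyclic[OF vNA[OF that(1)] XK[OF that]])
  have small: "chi_r (E i x) (reduced_algebra (N i) (E i x)) \<le>o ?\<kappa>" if i: "i \<in> I" and x: "x \<in> X i" for i x
  proof -
    obtain S where S: "generates (K i) S (N i)" "gen (K i) (N i) = |S|"
      by (rule gen_attained[OF vNi[OF i]])
    have S\<kappa>: "|S| \<le>o ?\<kappa>"
      using ordLeq_transitive[OF bspec[OF le i] \<kappa>(2)] by (simp add: S(2))
    show ?thesis
      unfolding E_def
      by (rule vN_algebra.chi_r_reduced_le[OF vNA[OF i] XK[OF i x] S(1) \<kappa>(1) S\<kappa>])
  qed
  \<comment> \<open>The refined summands are indexed by pairs, and \<open>'h\<close>, being
    infinite, can hold its own square.\<close>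
  have "|UNIV \<times> UNIV :: ('h \<times> 'h) set| =o |UNIV :: 'h set|"
    by (rule card_of_Times_same_infinite[OF infinite_UNIV_hilbert])
  then obtain enc :: "'h \<times> 'h \<Rightarrow> 'h" where "bij_betw enc (UNIV \<times> UNIV) UNIV"
    unfolding card_of_ordIso[symmetric] by blast
  then have enc: "inj enc" by (simp add: bij_betw_def)
  define E' where "E' j = case_prod E (inv_into UNIV enc j)" for j
  define N' where "N' j = reduced_algebra (N (fst (inv_into UNIV enc j))) (E' j)" for j
  define J where "J = enc ` (SIGMA i:I. X i)"
  have iso': "star_isomorphic (op_algebra H M) (linf_sum onorm J (\<lambda>j. op_algebra (E' j) (N' j)))"
    unfolding J_def N'_def E'_def
    by (rule star_isomorphic_trans[OF iso direct_sum_refinement[OF vNi CS orth total enc]])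
  have vN': "von_neumann_algebra (E' j) (N' j)" if "j \<in> J" for j
    using that central_subspace.von_neumann_algebra_reduced[OF CS] enc
    by (auto simp: J_def E'_def N'_def)
  have s': "direct_sum H M J E' N'" using vN' iso' by (simp add: direct_sum_def)
  have small': "chi_r (E' j) (N' j) \<le>o ?\<kappa>" if "j \<in> J" for j
    using that small enc by (auto simp: J_def E'_def N'_def)
  \<comment> \<open>\<open>\<rho>\<close> is the least among cardinals of subsets of \<open>'h\<close>, and \<open>?\<kappa>\<close> may exceed all of these.\<close>
  have "\<exists>A :: 'h set. |A| \<le>o ?\<kappa> \<and> (\<forall>j\<in>J. chi_r (E' j) (N' j) \<le>o |A| )"
  proof (cases "?\<kappa> \<le>o |UNIV :: 'h set|")
    case True
    then obtain A :: "'h set" where A: "|A| =o ?\<kappa>"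
      using Card_order_transfer[OF Card_order_cprod] by blast
    then show ?thesis
      using small' ordLeq_ordIso_trans[OF _ ordIso_symmetric[OF A]] ordIso_iff_ordLeq by blast
  next
    case False
    then have "|UNIV :: 'h set| \<le>o ?\<kappa>"
      using ordLeq_total[OF card_order_on_well_order_on[OF Card_order_cprod] card_of_Well_order] by blast
    then show ?thesis
      using Card_order_le_UNIV[OF Card_order_chi_r[OF vN']] by blast
  qed
  then obtain A :: "'h set" where A: "|A| \<le>o ?\<kappa>" "\<And>j. j \<in> J \<Longrightarrow> chi_r (E' j) (N' j) \<le>o |A|" by blast
  have "\<rho> \<le>o |A|" by (rule localization_le[where F=chi_r, OF s' card_of_Card_order A(2)])
  then have "\<rho> \<le>o ?\<kappa>" by (rule ordLeq_transitive[OF _ A(1)])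
  then show ?thesis by (rule natLeq_cprod_least[OF Card_order_localization(2) _ \<kappa>(1)])
qed

text \<open>Each summand has at most the square of the card of \<open>Field \<rho>\<close>
  generators, a bound independent of the summand, so it survives localization.\<close>

lemma finite_gen:
  assumes fin: "finite (Field \<rho>)"
  shows "finite (Field \<gamma>)"
proof -
  obtain I K N where s: "direct_sum H M I K N" and le: "\<forall>i\<in>I. chi_r (K i) (N i) \<le>o \<rho>"
    by (rule localization_chi_r)
  note vNi = direct_sumD(1)[OF s] and iso = direct_sumD(2)[OF s]
  have "infinite (UNIV :: ('h \<Rightarrow> 'h) set)"
    using card_of_ordLeq_infinite[OF Cinfinite_UNIV(2) infinite_UNIV_hilbert] .
  \<comment> \<open>The extra element makes room for the singleton that \<open>gen_le\<close>
    demands, without first checking that the square is positive.\<close>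
  then obtain A :: "('h \<Rightarrow> 'h) set" where A: "finite A" "card A = (card (Field \<rho>))\<^sup>2 + 1"
    using infinite_arbitrarily_large by blast
  have le_A: "|S| \<le>o |A|" if "finite S" "card S \<le> (card (Field \<rho>))\<^sup>2 + 1" for S :: "('h \<Rightarrow> 'h) set"
    using that A inj_on_iff_card_le[OF that(1) A(1)] unfolding card_of_ordLeq[symmetric] by auto
  have "\<gamma> \<le>o |A|"
  proof (rule localization_le[where F=gen, OF s card_of_Card_order])
    fix i assume i: "i \<in> I"
    obtain L \<pi> B where "faithful_rep (K i) (N i) L \<pi> B" and B: "chi_r (K i) (N i) = |B|"
      by (rule chi_r_attained[OF vNi[OF i]])
    then interpret R: faithful_rep "K i" "N i" L \<pi> B by simp
    have "|B| \<le>o |Field \<rho>|"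
      using bspec[OF le i] ordLeq_ordIso_trans[OF _ ordIso_symmetric[OF card_of_Field_ordIso[OF Card_order_localization(2)]]]
      by (simp add: B)
    then obtain f where "inj_on f B" "f ` B \<subseteq> Field \<rho>" unfolding card_of_ordLeq[symmetric] by blast
    then have "finite B" "card B \<le> card (Field \<rho>)"
      using fin inj_on_finite card_inj_on_le by blast+
    then obtain S where S: "generates (K i) S (N i)" "finite S" "card S \<le> (card B)\<^sup>2"
      using R.finite_generating_set by blast
    have "card S \<le> (card (Field \<rho>))\<^sup>2"
      by (rule order_trans[OF S(3) power_mono[OF \<open>card B \<le> card (Field \<rho>)\<close>]]) simp
    then have "card S \<le> (card (Field \<rho>))\<^sup>2 + 1" by simp
    then show "gen (K i) (N i) \<le>o |A|"
      by (intro gen_le[OF S(1)] le_A S(2)) auto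
  qed
  then have "|Field \<gamma>| \<le>o |A|"
    using ordIso_ordLeq_trans[OF card_of_Field_ordIso[OF Card_order_localization(1)]] by blast
  then show ?thesis using card_of_ordLeq_finite A(1) by blast
qed

text \<open>By the contrapositive of \<open>finite_gen\<close> both cardinals are infinite; each
  then absorbs \<open>natLeq\<close>, and the two inequalities give equality.\<close>

lemma infinite_gen:
  assumes inf: "infinite (Field \<gamma>)"
  shows "\<gamma> =o \<rho>"
proof -
  have *: "natLeq *c r =o r" if "Card_order r" "infinite (Field r)" for r :: "'x rel"
    using that by (intro cprod_infinite2' natLeq_Cnotzero natLeq_ordLeq_cinfinite)
      (auto simp: cinfinite_def)
  have "infinite (Field \<rho>)" using finite_gen inf by blast
  then have \<rho>: "natLeq *c \<rho> =o \<rho>" by (rule *[OF Card_order_localization(2)])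
  have "natLeq *c \<gamma> =o \<gamma>" by (rule *[OF Card_order_localization(1) inf])
  then have "\<gamma> =o natLeq *c \<gamma>" by (rule ordIso_symmetric)
  also have "natLeq *c \<gamma> =o natLeq *c \<rho>"
    using gen_le_chi_r chi_r_le_gen by (simp add: ordIso_iff_ordLeq)
  also have "natLeq *c \<rho> =o \<rho>" by (rule \<rho>)
  finally show ?thesis .
qed

end

section \<open>Atomic abelian algebras\<close>

text \<open>\<open>localization\<close> only admits summands that are operator algebras, so the
  complex numbers are realized as the scalars on a fixed nonzero space.\<close>

lemma star_isomorphic_scalar_sums:
  assumes K: "closed_csubspace K" and x: "x \<in> K" "x \<noteq> 0"
  shows "star_isomorphic (linf_sum cmod I (\<lambda>_. complex_algebra))
    (linf_sum onorm I (\<lambda>_. op_algebra K {\<lambda>v. c *\<^sub>C id_op K v | c. True}))" (is "star_isomorphic ?A ?B")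
proof -
  let ?Z = "{\<lambda>v. c *\<^sub>C id_op K v | c. True}"
  define h where "h y = (\<lambda>i\<in>I. \<lambda>v. y i *\<^sub>C id_op K v)" for y
  have idx: "id_op K x = x" by (rule id_op(2)[OF K x(1)])
  have carA: "y \<in> carrier ?A \<longleftrightarrow> y \<in> extensional I \<and> (\<exists>C\<ge>0. \<forall>i\<in>I. cmod (y i) \<le> C)" for y
    unfolding linf_sum_def bdd_above_image_iff by (auto simp: complex_algebra_def PiE_def)
  have carB: "y \<in> carrier ?B \<longleftrightarrow>
      y \<in> (\<Pi>\<^sub>E i\<in>I. ?Z) \<and> (\<exists>C\<ge>0. \<forall>i\<in>I. \<forall>v. norm (y i v) \<le> C * norm v)" for y
    by (rule carrier_linf_sum_op) (use bounded_ops_scaleC[OF K id_op(1)[OF K]] in auto)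
  have h_car: "h y \<in> carrier ?B" if y: "y \<in> carrier ?A" for y
  proof -
    obtain C where C: "C \<ge> 0" "\<And>i. i \<in> I \<Longrightarrow> cmod (y i) \<le> C" using y carA by blast
    have "norm (h y i v) \<le> C * norm v" if "i \<in> I" for i v
      using mult_mono[OF C(2)[OF that] norm_id_op_le[OF K, of v] C(1)] that
      by (simp add: h_def norm_scaleC)
    then show ?thesis unfolding carB using C(1) by (auto simp: h_def)
  qed
  have adj: "cadjoint (\<lambda>v. c *\<^sub>C id_op K v) = (\<lambda>v. cnj c *\<^sub>C id_op K v)" for c
    by (rule cadjoint_eqI)
      (simp add: cinner_scaleC_left cinner_scaleC_right id_op_selfadjoint[OF K])
  have "h \<in> star_hom ?A ?B"
    unfolding star_hom_def ring_hom_def using h_car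
    by (auto simp: h_def fun_eq_iff complex_algebra_def adj scaleC_scaleC scaleC_add_left
        bounded_opsD(2)[OF id_op(1)[OF K]] id_op(2)[OF K id_op_in[OF K]])
  moreover have "inj_on h (carrier ?A)"
  proof (rule inj_onI)
    fix y z assume y: "y \<in> carrier ?A" and z: "z \<in> carrier ?A" and eq: "h y = h z"
    have "y i = z i" if "i \<in> I" for i
    proof -
      have "y i *\<^sub>C x = z i *\<^sub>C x"
        using fun_cong[OF fun_cong[OF eq, of i], of x] that by (simp add: h_def idx)
      then have "y i * cinner x x = z i * cinner x x" by (metis cinner_scaleC_right)
      then show ?thesis using x(2) by simp
    qed
    then show "y = z" using y z by (intro extensionalityI[of y I z]) (auto simp: carA)
  qed
  moreover have "y \<in> h ` carrier ?A" if y: "y \<in> carrier ?B" for y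
  proof -
    obtain C where C: "C \<ge> 0" "\<And>i v. i \<in> I \<Longrightarrow> norm (y i v) \<le> C * norm v"
      and yZ: "y \<in> (\<Pi>\<^sub>E i\<in>I. ?Z)" using y carB by blast
    then have "\<forall>i\<in>I. \<exists>c. y i = (\<lambda>v. c *\<^sub>C id_op K v)" by blast
    then obtain c where c: "\<And>i. i \<in> I \<Longrightarrow> y i = (\<lambda>v. c i *\<^sub>C id_op K v)" by metis
    have "cmod (c i) \<le> C" if "i \<in> I" for i
      using C(2)[OF that, of x] x(2) by (simp add: c[OF that] idx norm_scaleC)
    then have "restrict c I \<in> carrier ?A" using C(1) by (auto simp: carA)
    moreover have "h (restrict c I) = y"
      using yZ c by (intro extensionalityI[of _ I]) (auto simp: h_def PiE_def)
    ultimately show ?thesis by blast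
  qed
  ultimately show ?thesis
    unfolding star_isomorphic_def bij_betw_def using h_car by blast
qed

text \<open>Every summand is realized as the scalars on one complex line, where both invariants are
  at most 1; with the general lower bound 1 both localizations equal 1.\<close>

lemma (in vN_algebra) atomic_abelian_localization:
  assumes "atomic_abelian H M"
  shows "\<gamma> =o \<rho>"
proof -
  obtain I :: "'h set" where I: "star_isomorphic (op_algebra H M) (linf_sum cmod I (\<lambda>_. complex_algebra))"
    using assms by (auto simp: atomic_abelian_def)
  obtain v where v: "v \<in> H" "v \<noteq> 0" using exists_nonzero by blast
  define b where "b = complex_of_real (1 / norm v) *\<^sub>C v"
  have "norm b = 1" unfolding b_def norm_scaleC norm_of_real using v(2) by simp
  then have bb: "cinner b b = 1" "b \<noteq> 0" by (auto simp: cinner_self)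
  define K where "K = cspan {b}"
  have K: "closed_csubspace K" "b \<in> K"
    unfolding K_def using closed_csubspace_cspan cspan_superset[of "{b}"] by auto
  let ?Z = "{\<lambda>v. c *\<^sub>C id_op K v | c. True}"
  have vNK: "von_neumann_algebra K ?Z" by (rule von_neumann_algebra_scalars[OF K bb(2)])
  have "y = 0" if "y \<in> K" "cinner b y = 0" for y
  proof -
    have "cinner y b = 0" using that(2) cinner_commute[of y b] by simp
    then have "cinner y y = 0" using cspan_orthogonal[of "{b}" y y] that(1) by (simp add: K_def)
    then show ?thesis by simp
  qed
  then have B: "hilbert_basis K {b}" using K(2) bb(1) by (simp add: hilbert_basis_def)
  have chi: "chi_r K ?Z \<le>o |{b}|"
    by (rule chi_r_le[OF K(1) B vN_algebra.faithful_normal_rep_id[OF vN_algebra.intro[OF vNK]]])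
  \<comment> \<open>Here the convention applies; without it the empty set would generate the
    scalars, and \<open>\<gamma>\<close> would be 0.\<close>
  have gen: "gen K ?Z \<le>o |{id_op K}|"
    unfolding gen_def by (simp add: ordLeq_refl card_of_Card_order)
  note iso = star_isomorphic_trans[OF I star_isomorphic_scalar_sums[OF K bb(2)]]
  have s: "direct_sum H M I (\<lambda>_. K) (\<lambda>_. ?Z)" using vNK iso by (simp add: direct_sum_def)
  have "\<gamma> \<le>o |{id_op K}|" by (rule localization_le[where F=gen, OF s card_of_Card_order gen])
  then have "\<gamma> \<le>o \<rho>" by (rule ordLeq_transitive[OF _ singleton_le_localization(2)])
  moreover have "\<rho> \<le>o |{b}|" by (rule localization_le[where F=chi_r, OF s card_of_Card_order chi])
  then have "\<rho> \<le>o \<gamma>" by (rule ordLeq_transitive[OF _ singleton_le_localization(1)])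
  ultimately show ?thesis by (simp add: ordIso_iff_ordLeq)
qed

theorem proposition5p4:
  fixes H :: "'h::complex_hilbert set" and M :: "('h \<Rightarrow> 'h) set"
  assumes "von_neumann_algebra H M"
  shows "natLeq *c localization chi_r H M =o natLeq *c localization gen H M \<and>
    (\<not> localization gen H M =o localization chi_r H M \<longrightarrow>
       finite (Field (localization gen H M)) \<and> \<not> atomic_abelian H M)"
proof -
  interpret vN_algebra H M by unfold_locales (rule assms)
  show ?thesis
    using gen_le_chi_r chi_r_le_gen infinite_gen atomic_abelian_localization
    by (auto simp: ordIso_iff_ordLeq)
qed

end
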